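(* Let $z>0$ and let $(a_i)_{i\ge1}$, $(b_i)_{i\ge2}$ be positive numbers; put $Q_1=1$, $Q_i=\frac{a_1a_2\cdots a_{i-1}}{b_2\cdots b_i}$ for $i\ge2$, and assume $$\sum_{m=2}^\infty Q_mz^m\Big(\sum_{k=m}^\infty\frac1{a_kQ_kz^{k+1}}\Big)=\infty .$$ Let $n\ge2$ and let $\Pi^{\mathrm{in}}$ be a probability distribution on $\mathcal E_n$ such that $\mathbf E_{\Pi^{\mathrm{in}}}\big[\sum_{i=2}^\infty C_i\big]<\infty$. Then for all $t\ge0$, $$\big\|\mathbf P_{\Pi^{\mathrm{in}}}\{\mathbf C(t)\in\cdot\mid\tau_n>t\}-\Pi_n^{\mathrm{qsd}}\big\|\le K_n\left(\frac{H_n^{\mathrm{in}}}{\mathbf P_{\Pi^{\mathrm{in}}}\{\tau_n>t\}}+e^{J_nt}H_n^{\mathrm{qsd}}\right)e^{-\gamma_nt},$$ where $\mathbf C$ is the Becker–Döring process and $$K_n=\Big(\sum_{i=2}^nQ_iz^i\Big)^{1/2},\qquad H_n^{\mathrm{in}}=\sum_{i=2}^n\sqrt{Q_iz^i}\,\frac{\mathbf E_{\Pi^{\mathrm{in}}}[C_i]}{f_i^n},\qquad H_n^{\mathrm{qsd}}=\sum_{i=2}^n\sqrt{Q_iz^i}.$$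
   Context: $\mathbb N_0=\{0,1,2,\ldots\}$, $\mathbb N_m=\{m,m+1,\ldots\}$. $\mathcal E=\ell^1(\mathbb N_2,\mathbb N_0)$ is the countable set of summable (hence finitely supported) $\mathbb N_0$-valued sequences $C=(C_2,C_3,\ldots)$, and $\mathcal E_n=\{C\in\mathcal E:C_i=0\text{ for all }i\ge n+1\}$. $\|\mu-\nu\|=\frac12\sum_x|\mu(x)-\nu(x)|$ is total variation distance. For a function $h$ on $\mathcal E$, $\mathbf E_\Pi[h(C)]=\sum_Ch(C)\Pi(C)$. Becker–Döring (BD) process: the continuous-time Markov chain $\mathbf C(t)=(C_2(t),C_3(t),\ldots)$ on $\mathcal E$ with generator $$\mathcal A\psi(C)=\sum_{i=1}^\infty\Big(a_izC_i[\psi(C+\Delta_i)-\psi(C)]+b_{i+1}C_{i+1}[\psi(C-\Delta_i)-\psi(C)]\Big),$$ with the convention $C_1=z$, and $\Delta_1=\mathbf e_2$, $\Delta_i=\mathbf e_{i+1}-\mathbf e_i$ for $i\ge2$, where $\mathbf e_2,\mathbf e_3,\ldots$ is the canonical basis. It is non-explosive under the divergence condition in the claim. $\mathbf P_\Pi$ denotes its law when $\mathbf C(0)\sim\Pi$. The exit time is $\tau_n=\inf\{t\ge0:\mathbf C(t)\notin\mathcal E_n\}$. Constants and QSD: $$J_n=\Big(\sum_{k=1}^n\frac1{a_kQ_kz^{k+1}}\Big)^{-1},\quad f_i^n=J_nQ_iz^i\sum_{k=i}^n\frac1{a_kQ_kz^{k+1}}\ (2\le i\le n),\quad \Pi_n^{\mathrm{qsd}}(C)=\prod_{i=2}^n\frac{(f_i^n)^{C_i}}{C_i!}e^{-f_i^n}\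 (C\in\mathcal E_n).$$ Constant $\gamma_n$: let $X$ be the continuous-time Markov chain on $\mathbb N_1$ with nonzero rates $q_{i,i+1}=a_iz$, $q_{i,i-1}=b_i$, $q_{i,i}=-(a_iz+b_i)$ for $i\ge2$ (state $1$ absorbing), $T_n=\inf\{t\ge0:X(t)\ge n+1\}$, $Y(t)=X(t\wedge T_n)$ and $p_{ij}^n(t)=\mathbf P\{Y(t)=j\mid Y(0)=i\}$. The truncated matrix $(q_{i,j})_{2\le i,j\le n}$ is similar to a symmetric one, and $\gamma_n>0$ denotes a constant (which exists, by Kreer 1993) such that for all $i\in\{2,\ldots,n\}$ and $t\ge0$, $$\Big(\sum_{j=2}^n\frac{p_{ij}^n(t)^2}{Q_jz^j}\Big)^{1/2}\le\frac{e^{-\gamma_nt}}{\sqrt{Q_iz^i}}.$$ *)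

theory Defs
  imports "HOL-Probability.Probability"
begin

section \<open>Continuous-time Markov chains on a countable state space\<close>

text \<open>
  \<open>q\<close> is a conservative Q-matrix on \<open>S\<close>: \<open>q x y\<close> is the rate of the jump \<open>x \<rightarrow> y\<close> for
  \<open>x \<noteq> y\<close>, and \<open>- q x x\<close> is the total rate of leaving \<open>x\<close>.
\<close>

definition jump_prob :: "('s \<Rightarrow> 's \<Rightarrow> real) \<Rightarrow> 's \<Rightarrow> 's \<Rightarrow> real" where
  "jump_prob q x y =
     (if q x x = 0 then (if y = x then 1 else 0)
      else if y = x then 0 else q x y / (- q x x))"

text \<open>
  \<open>X\<close> is a right-continuous Markov chain with Q-matrix \<open>q\<close> and initial distribution \<open>\<mu>\<close>,
  described by its jump chain \<open>Y\<close> and holding times \<open>H\<close>: the jump chain is a discrete-time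
  Markov chain with transition matrix \<open>jump_prob q\<close> started from \<open>\<mu>\<close> and, given the jump chain,
  the holding times are independent, \<open>H j\<close> being exponential with parameter
  \<open>- q (Y j) (Y j)\<close> (infinite if this parameter is \<open>0\<close>, i.e. in an absorbing state).
  Nothing is prescribed after the explosion time \<open>\<Sum>j. H j\<close>; for a non-explosive \<open>q\<close> this time is
  almost surely infinite, so that the law of \<open>X\<close> is determined by \<open>q\<close> and \<open>\<mu>\<close>.
  Right-continuity (for the discrete topology on \<open>S\<close>) is required of every path, which makes
  exit times measurable without completing \<open>M\<close>.
\<close>

definition ctmc ::
  "'w measure \<Rightarrow> (real \<Rightarrow> 'w \<Rightarrow> 's) \<Rightarrow> 's set \<Rightarrow> ('s \<Rightarrow> 's \<Rightarrow> real) \<Rightarrow> 's pmf \<Rightarrow> bool" where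
  "ctmc M X S q \<mu> \<longleftrightarrow>
     prob_space M \<and>
     (\<forall>t\<ge>0. X t \<in> M \<rightarrow>\<^sub>M count_space S) \<and>
     (\<forall>\<omega>\<in>space M. \<forall>t\<ge>0. \<forall>\<^sub>F s in at_right t. X s \<omega> = X t \<omega>) \<and>
     (\<exists>(Y :: nat \<Rightarrow> 'w \<Rightarrow> 's) (H :: nat \<Rightarrow> 'w \<Rightarrow> ennreal).
        (\<forall>j. Y j \<in> M \<rightarrow>\<^sub>M count_space S) \<and>
        (\<forall>j. H j \<in> borel_measurable M) \<and>
        (AE \<omega> in M. \<forall>k. \<forall>t\<ge>0.
           (\<Sum>j<k. H j \<omega>) \<le> ennreal t \<and> ennreal t < (\<Sum>j\<le>k. H j \<omega>) \<longrightarrow> X t \<omega> = Y k \<omega>) \<and>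
        (\<forall>k. \<forall>y :: nat \<Rightarrow> 's. \<forall>s :: nat \<Rightarrow> real.
           (\<forall>j\<le>k. y j \<in> S \<and> 0 \<le> s j) \<longrightarrow>
           \<P>(\<omega> in M. \<forall>j\<le>k. Y j \<omega> = y j \<and> H j \<omega> > ennreal (s j)) =
             pmf \<mu> (y 0) * (\<Prod>j<k. jump_prob q (y j) (y (Suc j))) *
             (\<Prod>j\<le>k. exp (q (y j) (y j) * s j))))"

definition exit_time :: "(real \<Rightarrow> 'w \<Rightarrow> 's) \<Rightarrow> 's set \<Rightarrow> 'w \<Rightarrow> ennreal" where
  "exit_time X A \<omega> = Inf (ennreal ` {t. 0 \<le> t \<and> X t \<omega> \<notin> A})"

definition stopped :: "(real \<Rightarrow> 'w \<Rightarrow> 's) \<Rightarrow> ('w \<Rightarrow> ennreal) \<Rightarrow> real \<Rightarrow> 'w \<Rightarrow> 's" where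
  "stopped X T t \<omega> = X (enn2real (min (ennreal t) (T \<omega>))) \<omega>"

text \<open>Total variation distance of two distributions on \<open>S\<close>, given by their point masses.\<close>

definition tv_dist :: "'s set \<Rightarrow> ('s \<Rightarrow> real) \<Rightarrow> ('s \<Rightarrow> real) \<Rightarrow> real" where
  "tv_dist S \<mu> \<nu> = 1 / 2 * (\<Sum>\<^sub>\<infinity>x\<in>S. \<bar>\<mu> x - \<nu> x\<bar>)"


section \<open>The Becker--Doering process\<close>

text \<open>
  A sequence \<open>(C\<^sub>2, C\<^sub>3, \<dots>)\<close> is a function on \<open>nat\<close> normalised to be \<open>0\<close> at the two unused
  indices \<open>0\<close> and \<open>1\<close>.
\<close>

definition bd_states :: "(nat \<Rightarrow> nat) set" where
  "bd_states = {C. C 0 = 0 \<and> C 1 = 0 \<and> summable (\<lambda>i. real (C i))}"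

definition bd_trunc :: "nat \<Rightarrow> (nat \<Rightarrow> nat) set" where
  "bd_trunc n = {C \<in> bd_states. \<forall>i\<ge>n + 1. C i = 0}"

definition bd_unit :: "nat \<Rightarrow> nat \<Rightarrow> int" where
  "bd_unit i = (\<lambda>k. if k = i then 1 else 0)"

definition bd_Delta :: "nat \<Rightarrow> nat \<Rightarrow> int" where
  "bd_Delta i = (if i = 1 then bd_unit 2 else (\<lambda>k. bd_unit (i + 1) k - bd_unit i k))"

text \<open>
  The truncation at \<open>0\<close> by \<open>nat\<close> is only effective for moves whose rate in \<open>bd_gen\<close> is \<open>0\<close>.
\<close>

definition bd_add :: "(nat \<Rightarrow> nat) \<Rightarrow> (nat \<Rightarrow> int) \<Rightarrow> nat \<Rightarrow> nat" where
  "bd_add C d = (\<lambda>k. nat (int (C k) + d k))"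

definition bd_sub :: "(nat \<Rightarrow> nat) \<Rightarrow> (nat \<Rightarrow> int) \<Rightarrow> nat \<Rightarrow> nat" where
  "bd_sub C d = (\<lambda>k. nat (int (C k) - d k))"

text \<open>The convention \<open>C\<^sub>1 = z\<close>.\<close>

definition bd_conc :: "real \<Rightarrow> (nat \<Rightarrow> nat) \<Rightarrow> nat \<Rightarrow> real" where
  "bd_conc z C i = (if i = 1 then z else real (C i))"

definition bd_gen ::
  "(nat \<Rightarrow> real) \<Rightarrow> (nat \<Rightarrow> real) \<Rightarrow> real \<Rightarrow> ((nat \<Rightarrow> nat) \<Rightarrow> real) \<Rightarrow> (nat \<Rightarrow> nat) \<Rightarrow> real" where
  "bd_gen a b z \<psi> C =
     (\<Sum>\<^sub>\<infinity>i\<in>{1..}. a i * z * bd_conc z C i * (\<psi> (bd_add C (bd_Delta i)) - \<psi> C)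
                 + b (i + 1) * bd_conc z C (i + 1) * (\<psi> (bd_sub C (bd_Delta i)) - \<psi> C))"

text \<open>
  The Q-matrix of the generator: the value at \<open>C\<close> of the generator applied to the indicator
  function of \<open>{D}\<close>.
\<close>

definition bd_rate ::
  "(nat \<Rightarrow> real) \<Rightarrow> (nat \<Rightarrow> real) \<Rightarrow> real \<Rightarrow> (nat \<Rightarrow> nat) \<Rightarrow> (nat \<Rightarrow> nat) \<Rightarrow> real" where
  "bd_rate a b z C D = bd_gen a b z (indicator {D}) C"

definition bd_Q :: "(nat \<Rightarrow> real) \<Rightarrow> (nat \<Rightarrow> real) \<Rightarrow> nat \<Rightarrow> real" where
  "bd_Q a b i = (\<Prod>k=1..<i. a k) / (\<Prod>k=2..i. b k)"

definition bd_J :: "(nat \<Rightarrow> real) \<Rightarrow> (nat \<Rightarrow> real) \<Rightarrow> real \<Rightarrow> nat \<Rightarrow> real" where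
  "bd_J a b z n = inverse (\<Sum>k=1..n. 1 / (a k * bd_Q a b k * z ^ (k + 1)))"

definition bd_f :: "(nat \<Rightarrow> real) \<Rightarrow> (nat \<Rightarrow> real) \<Rightarrow> real \<Rightarrow> nat \<Rightarrow> nat \<Rightarrow> real" where
  "bd_f a b z n i =
     bd_J a b z n * bd_Q a b i * z ^ i * (\<Sum>k=i..n. 1 / (a k * bd_Q a b k * z ^ (k + 1)))"

definition bd_qsd ::
  "(nat \<Rightarrow> real) \<Rightarrow> (nat \<Rightarrow> real) \<Rightarrow> real \<Rightarrow> nat \<Rightarrow> (nat \<Rightarrow> nat) \<Rightarrow> real" where
  "bd_qsd a b z n C =
     (if C \<in> bd_trunc n
      then \<Prod>i=2..n. bd_f a b z n i ^ C i / fact (C i) * exp (- bd_f a b z n i)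
      else 0)"


section \<open>The size of a single cluster\<close>

definition cluster_rate ::
  "(nat \<Rightarrow> real) \<Rightarrow> (nat \<Rightarrow> real) \<Rightarrow> real \<Rightarrow> nat \<Rightarrow> nat \<Rightarrow> real" where
  "cluster_rate a b z i j =
     (if i < 2 then 0
      else if j = i + 1 then a i * z
      else if j = i - 1 then b i
      else if j = i then - (a i * z + b i)
      else 0)"

text \<open>
  \<open>P{Y(t) = j | Y(0) = i}\<close> for the chain \<open>X\<close> stopped at the first time it is at least \<open>n + 1\<close>,
  which is its exit time from \<open>{..n}\<close>.
\<close>

definition stopped_prob ::
  "'v measure \<Rightarrow> (real \<Rightarrow> 'v \<Rightarrow> nat) \<Rightarrow> nat \<Rightarrow> nat \<Rightarrow> nat \<Rightarrow> real \<Rightarrow> real" where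
  "stopped_prob N X n i j t =
     \<P>(\<omega> in N. stopped X (exit_time X {..n}) t \<omega> = j \<bar> stopped X (exit_time X {..n}) 0 \<omega> = i)"


section \<open>The constants of the estimate\<close>

definition bd_K :: "(nat \<Rightarrow> real) \<Rightarrow> (nat \<Rightarrow> real) \<Rightarrow> real \<Rightarrow> nat \<Rightarrow> real" where
  "bd_K a b z n = sqrt (\<Sum>i=2..n. bd_Q a b i * z ^ i)"

definition bd_Hin ::
  "(nat \<Rightarrow> real) \<Rightarrow> (nat \<Rightarrow> real) \<Rightarrow> real \<Rightarrow> nat \<Rightarrow> (nat \<Rightarrow> nat) pmf \<Rightarrow> real" where
  "bd_Hin a b z n \<Pi>in =
     (\<Sum>i=2..n. sqrt (bd_Q a b i * z ^ i) *
        (measure_pmf.expectation \<Pi>in (\<lambda>C. real (C i)) / bd_f a b z n i))"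

definition bd_Hqsd :: "(nat \<Rightarrow> real) \<Rightarrow> (nat \<Rightarrow> real) \<Rightarrow> real \<Rightarrow> nat \<Rightarrow> real" where
  "bd_Hqsd a b z n = (\<Sum>i=2..n. sqrt (bd_Q a b i * z ^ i))"

end

theory Submission
  imports Defs
begin

text \<open>
  The clusters of sizes \<open>2, ..., n\<close> in a Becker--Doering process do not interact: each of them is
  a copy of the chain with rates \<open>cluster_rate\<close>, dissolving at size \<open>1\<close>, and new clusters of size
  \<open>2\<close> immigrate at the constant rate \<open>a 1 * z * z\<close>.  The process is killed as soon as a single
  cluster reaches size \<open>n + 1\<close>.  Consequently the law at time \<open>t\<close> of the process started at \<open>C\<close> and
  not yet killed is explicit: it is the law of an independent superposition of a Poisson field (the
  immigrants) and of one random cluster for every cluster of \<open>C\<close>, multiplied by the probability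
  that none of them has been killed.  This sub-probability is the function \<open>law\<close> below; it
  satisfies the forward equation because creation and annihilation of clusters obey the
  commutation relation \<open>annihilate_create\<close>.

  The estimate then follows by exhibiting a common part of the two distributions.  The mass that
  \<open>law\<close> gives to the event that some cluster of \<open>C\<close> is left is at most
  \<open>\<Sum>i. C i * surviving i t\<close>; once all of them have dissolved, only the Poisson field with intensities
  \<open>m j t\<close> remains.  The quasi-stationary distribution is the Poisson field with intensities
  \<open>f j \<ge> m j t\<close>, so it contains the field with intensities \<open>m j t\<close> with the factor
  \<open>exp (- (\<Sum>j. f j - m j t))\<close>, and \<open>f j - m j t\<close> is what clusters distributed initially according
  to \<open>f\<close> would contribute at time \<open>t\<close>.  Both errors are therefore sums of the probabilities
  \<open>surviving i t\<close> that a cluster of size \<open>i\<close> is still between \<open>2\<close> and \<open>n\<close>, and the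
  Cauchy--Schwarz inequality bounds these by
  \<open>bd_K a b z n * exp (- \<gamma> * t) / sqrt (Q i * z ^ i)\<close> (\<open>surviving_le\<close>).  The two errors are combined
  in \<open>tv_conditional_law\<close>.  Since \<open>f i \<le> Q i * z ^ i\<close>, the resulting bound is at most the one that is
  claimed.

  The main work is to show that the given process has this law (\<open>bd_law\<close>), because a chain is
  specified by its jump chain and its holding times only.  From these one obtains the minimal
  nonnegative solution of the forward equation as a lower bound for the law of the killed chain,
  and a corresponding lower bound for the probability of having been killed.  Minimality gives
  \<open>minimal_flow \<le> law\<close>, and both functions conserve mass (\<open>conservation\<close>).  Hence they agree, the
  two lower bounds add up to \<open>1\<close>, and so they are equalities.  In particular there is no explosion
  before the exit.
\<close>

section \<open>Exponential holding times and product laws\<close>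

lemma emeasure_exponential_tail:
  assumes "0 < l" "0 \<le> s"
  shows "emeasure (density lborel (exponential_density l)) {x. s < x} = ennreal (exp (- l * s))"
proof -
  interpret prob_space "density lborel (exponential_density l)"
    by (rule prob_space_exponential_density) fact
  have "distributed (density lborel (exponential_density l)) lborel (\<lambda>x. x) (exponential_density l)"
    unfolding distributed_def by (auto simp: distr_id2)
  from exponential_distributedD_gt[OF this assms(2,1)]
  show ?thesis
    by (simp add: emeasure_eq_measure mult.commute)
qed

text \<open>
  The tails beyond nonnegative reals form a generator that is closed under intersection, but none
  of these sets contains \<open>0\<close>; this is why the mass at \<open>0\<close> is excluded separately.
\<close>

lemma measure_eq_from_tails:
  fixes N1 N2 :: "ennreal measure"
  assumes sets: "sets N1 = sets borel" "sets N2 = sets borel"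
    and fin: "emeasure N1 UNIV \<noteq> \<infinity>"
    and zero: "emeasure N1 {0} = 0" "emeasure N2 {0} = 0"
    and tails: "\<And>s. 0 \<le> s \<Longrightarrow> emeasure N1 {ennreal s<..} = emeasure N2 {ennreal s<..}"
  shows "N1 = N2"
proof (rule measure_eqI_generator_eq[where E = "insert UNIV (range greaterThan)" and \<Omega> = UNIV
      and A = "\<lambda>_. UNIV"])
  have "sigma_sets UNIV (insert UNIV (range greaterThan)) = sigma_sets UNIV (range (greaterThan :: ennreal \<Rightarrow> _))"
    by (intro sigma_sets_eqI) (auto intro: sigma_sets_top)
  then have "sets borel = sigma_sets UNIV (insert UNIV (range (greaterThan :: ennreal \<Rightarrow> _)))"
    by (simp add: borel_Ioi)
  then show "sets N1 = sigma_sets UNIV (insert UNIV (range greaterThan))"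
    "sets N2 = sigma_sets UNIV (insert UNIV (range greaterThan))"
    using sets by auto
  have *: "emeasure N1 {x<..} = emeasure N2 {x<..}" for x
  proof (cases x)
    case top
    have "{top::ennreal<..} = {}" by (auto simp: not_less)
    then show ?thesis using top by simp
  qed (use tails in auto)
  have "emeasure N UNIV = emeasure N {0} + emeasure N {0<..}" if "sets N = sets borel" for N :: "ennreal measure"
  proof -
    have "UNIV = {0} \<union> {0::ennreal<..}"
      by (auto simp: zero_less_iff_neq_zero)
    moreover have "emeasure N ({0} \<union> {0<..}) = emeasure N {0} + emeasure N {0<..}"
      by (rule plus_emeasure[symmetric]) (auto simp: that)
    ultimately show ?thesis by metis
  qed
  with sets * zero show "emeasure N1 X = emeasure N2 X" if "X \<in> insert UNIV (range greaterThan)" for X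
    using that by auto
  have "{x<..} \<inter> {y<..} = {max x y<..}" for x y :: ennreal by auto
  then show "Int_stable (insert UNIV (range (greaterThan :: ennreal \<Rightarrow> _)))"
    by (auto simp: Int_stable_def)
qed (use fin in auto)

text \<open>
  A chain prescribes its holding times only through their joint tails.  Here this is turned into a
  product law: \<open>N\<close> is the joint law of a jump time, with law \<open>R\<close> up to a factor, and the holding
  time that follows it, on an event of the jump chain whose probability enters into \<open>c\<close>.
\<close>

lemma product_law_from_tails:
  fixes N :: "(ennreal \<times> ennreal) measure" and R :: "real measure"
  assumes l: "0 < l"
    and sets: "sets N = sets (borel \<Otimes>\<^sub>M borel)" "sets R = sets borel"
    and fin: "finite_measure N" "finite_measure R" and c: "c \<noteq> \<infinity>"
    and zero: "emeasure N (UNIV \<times> {0}) = 0"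
    and tails: "\<And>B s. B \<in> sets borel \<Longrightarrow> 0 \<le> s \<Longrightarrow>
      emeasure N (B \<times> {ennreal s<..}) = c * emeasure R (ennreal -` B) * ennreal (exp (- l * s))"
    and P: "P \<in> sets (borel \<Otimes>\<^sub>M borel)"
  shows "emeasure N P =
    c * (\<integral>\<^sup>+r. (\<integral>\<^sup>+h. indicator P (ennreal r, ennreal h) * ennreal (exponential_density l h) \<partial>lborel) \<partial>R)"
proof -
  note [measurable_cong] = sets
  let ?e = "density lborel (exponential_density l)"
  let ?e' = "distr ?e borel ennreal" and ?R' = "scale_measure c (distr R borel ennreal)"
  interpret e: prob_space ?e by (rule prob_space_exponential_density) fact
  interpret e': prob_space ?e' by (rule e.prob_space_distr) simp
  interpret N: finite_measure N by fact
  interpret R: finite_measure R by fact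
  have spN: "space N = UNIV" using sets_eq_imp_space_eq[OF sets(1)] by (simp add: space_pair_measure)
  have spR: "space R = UNIV" using sets_eq_imp_space_eq[OF sets(2)] by simp
  have R'e: "emeasure ?R' B = c * emeasure R (ennreal -` B)" if "B \<in> sets borel" for B
    using that by (simp add: emeasure_distr spR)
  interpret R': finite_measure ?R'
    using c R.emeasure_finite[of UNIV]
    by (intro finite_measureI)
      (simp add: emeasure_distr spR space_scale_measure ennreal_mult_eq_top_iff)
  have e'0: "emeasure ?e' {0} = 0"
  proof -
    have "emeasure ?e' {0} \<le> emeasure ?e {x. \<not> 0 < x}"
      by (subst emeasure_distr) (auto intro!: emeasure_mono simp: ennreal_eq_0_iff)
    also have "\<dots> = emeasure ?e (space ?e - {x. 0 < x})"
      by (auto intro!: arg_cong2[where f=emeasure])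
    also have "\<dots> = emeasure ?e (space ?e) - emeasure ?e {x. 0 < x}"
      by (rule emeasure_compl) auto
    also have "\<dots> = 0"
      unfolding e.emeasure_space_1 using emeasure_exponential_tail[OF l, of 0] by simp
    finally show ?thesis by simp
  qed
  have e't: "emeasure ?e' {ennreal s<..} = ennreal (exp (- l * s))" if "0 \<le> s" for s
  proof -
    have "ennreal -` {ennreal s<..} = {x. s < x}"
      using that by (auto simp: ennreal_less_iff not_le)
    then show ?thesis
      using emeasure_exponential_tail[OF l that] by (simp add: emeasure_distr)
  qed
  have eq: "?R' \<Otimes>\<^sub>M ?e' = N"
  proof (rule pair_measure_eqI)
    show "sigma_finite_measure ?R'" by unfold_locales
    show "sigma_finite_measure ?e'" by unfold_locales
    show "sets (?R' \<Otimes>\<^sub>M ?e') = sets N"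
      using sets by (simp cong: sets_pair_measure_cong)
    fix A B :: "ennreal set" assume "A \<in> sets ?R'" "B \<in> sets ?e'"
    then have [measurable]: "A \<in> sets borel" "B \<in> sets borel" by auto
    \<comment> \<open>Fixing \<open>A\<close> leaves a measure in the second coordinate, which is identified by its tails.\<close>
    define N1 where "N1 = distr (density N (indicator (A \<times> UNIV))) borel snd"
    have N1: "emeasure N1 X = emeasure N (A \<times> X)" if [measurable]: "X \<in> sets borel" for X
    proof -
      have "A \<times> X \<in> sets N" unfolding sets by auto
      moreover have "snd -` X \<inter> space N \<inter> (A \<times> UNIV) = A \<times> X" by (auto simp: spN)
      moreover have "A \<times> UNIV \<in> sets N" unfolding sets by auto
      moreover have "snd -` X \<inter> space N \<in> sets N" by measurable
      ultimately show ?thesis unfolding N1_def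
        by (subst emeasure_distr)
          (auto simp: emeasure_density indicator_inter_arith[symmetric] nn_integral_indicator Int_commute)
    qed
    have "N1 = scale_measure (emeasure ?R' A) ?e'"
    proof (rule measure_eq_from_tails)
      show "emeasure N1 UNIV \<noteq> \<infinity>" by (simp add: N1)
      have "emeasure N1 {0} \<le> emeasure N (UNIV \<times> {0})"
        unfolding N1[of "{0}", simplified] by (rule emeasure_mono) (auto simp: sets)
      then show "emeasure N1 {0} = 0" using zero by simp
      show "emeasure N1 {ennreal s<..} = emeasure (scale_measure (emeasure ?R' A) ?e') {ennreal s<..}"
        if "0 \<le> s" for s
        using e't[OF that] tails[OF _ that, of A] by (simp add: N1 R'e emeasure_distr spR)
    qed (auto simp: N1_def e'0)
    then have "emeasure N1 B = emeasure ?R' A * emeasure ?e' B" by simp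
    then show "emeasure ?R' A * emeasure ?e' B = emeasure N (A \<times> B)" by (simp add: N1)
  qed
  note [measurable] = P
  have R_meas: "ennreal \<in> R \<rightarrow>\<^sub>M borel"
    by measurable
  have inner_meas: "(\<lambda>x. \<integral>\<^sup>+y. indicator P (x, y) \<partial>?e') \<in> borel_measurable (distr R borel ennreal)"
    by measurable
  have "emeasure N P = (\<integral>\<^sup>+x. \<integral>\<^sup>+y. indicator P (x, y) \<partial>?e' \<partial>?R')"
    unfolding eq[symmetric] using P by (intro e'.emeasure_pair_measure) simp
  also have "\<dots> = c * (\<integral>\<^sup>+x. \<integral>\<^sup>+y. indicator P (x, y) \<partial>?e' \<partial>distr R borel ennreal)"
    by (intro nn_integral_scale_measure) measurable
  also have "\<dots> = c * (\<integral>\<^sup>+r. (\<integral>\<^sup>+y. indicator P (ennreal r, y) \<partial>?e') \<partial>R)"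
    by (subst nn_integral_distr[OF R_meas inner_meas], rule refl)
  also have "(\<lambda>r. \<integral>\<^sup>+y. indicator P (ennreal r, y) \<partial>?e') =
    (\<lambda>r. \<integral>\<^sup>+h. indicator P (ennreal r, ennreal h) * ennreal (exponential_density l h) \<partial>lborel)"
    by (intro ext, subst nn_integral_distr, measurable)
      (subst nn_integral_density, measurable, simp add: mult.commute)
  finally show ?thesis .
qed

text \<open>
  The sum of a time with law \<open>R\<close> and an independent exponential time has a density: \<open>l\<close> times the
  probability that a clock started at the first time has not yet rung.
\<close>

lemma nn_integral_exponential_shift:
  fixes R :: "real measure"
  assumes l: "0 < l" and sets: "sets R = sets borel" and fin: "finite_measure R"
    and nonneg: "AE r in R. 0 \<le> r" and B: "B \<in> sets borel"
  shows "(\<integral>\<^sup>+r. (\<integral>\<^sup>+h. indicator B (ennreal r + ennreal h) * ennreal (exponential_density l h) \<partial>lborel) \<partial>R)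
    = (\<integral>\<^sup>+t. indicator B (ennreal t) *
        (ennreal l * (\<integral>\<^sup>+r. ennreal (exp (- l * (t - r))) * indicator {0..t} r \<partial>R)) \<partial>lborel)"
proof -
  note [measurable] = B and [measurable_cong] = sets
  interpret R: finite_measure R by fact
  interpret P: pair_sigma_finite R lborel ..
  let ?f = "\<lambda>t r. indicator B (ennreal t) * (ennreal l * (ennreal (exp (- l * (t - r))) * indicator {0..t} r))"
  have "(\<integral>\<^sup>+r. (\<integral>\<^sup>+h. indicator B (ennreal r + ennreal h) * ennreal (exponential_density l h) \<partial>lborel) \<partial>R)
    = (\<integral>\<^sup>+r. (\<integral>\<^sup>+t. ?f t r \<partial>lborel) \<partial>R)"
  proof (rule nn_integral_cong_AE, use nonneg in eventually_elim)
    fix r :: real assume r: "0 \<le> r"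
    have "(\<integral>\<^sup>+h. indicator B (ennreal r + ennreal h) * ennreal (exponential_density l h) \<partial>lborel) =
      (\<integral>\<^sup>+t. indicator B (ennreal r + ennreal (- r + 1 * t)) * ennreal (exponential_density l (- r + 1 * t)) \<partial>lborel)"
      by (subst nn_integral_real_affine[where t = "- r" and c = 1]) auto
    also have "\<dots> = (\<integral>\<^sup>+t. ?f t r \<partial>lborel)"
      using r l by (intro nn_integral_cong)
        (auto simp: exponential_density_def algebra_simps ennreal_plus[symmetric] ennreal_mult'[symmetric] mult.commute
          split: split_indicator simp del: ennreal_plus)
    finally show "(\<integral>\<^sup>+h. indicator B (ennreal r + ennreal h) * ennreal (exponential_density l h) \<partial>lborel) =
      (\<integral>\<^sup>+t. ?f t r \<partial>lborel)" .
  qed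
  also have "\<dots> = (\<integral>\<^sup>+t. (\<integral>\<^sup>+r. ?f t r \<partial>R) \<partial>lborel)"
    by (rule P.Fubini'[symmetric]) (unfold atLeastAtMost_iff indicator_def, measurable)
  also have "\<dots> = (\<integral>\<^sup>+t. indicator B (ennreal t) *
        (ennreal l * (\<integral>\<^sup>+r. ennreal (exp (- l * (t - r))) * indicator {0..t} r \<partial>R)) \<partial>lborel)"
    by (intro nn_integral_cong) (simp add: nn_integral_cmult)
  finally show ?thesis .
qed

section \<open>Flow through paths that stay in a set\<close>

definition inflow :: "('s \<Rightarrow> 's \<Rightarrow> real) \<Rightarrow> 's set \<Rightarrow> ('s \<Rightarrow> ennreal) \<Rightarrow> 's \<Rightarrow> ennreal" where
  "inflow q A w y = (\<integral>\<^sup>+x. (if x = y then 0 else w x * ennreal (q x y)) \<partial>count_space A)"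

text \<open>
  For initial masses \<open>c\<close> this is the mass that is at \<open>y\<close> at time \<open>t\<close> after exactly \<open>k\<close> jumps between
  states of \<open>A\<close>.  The recursion splits at the last jump.  Values in \<open>[0, \<infinity>]\<close> avoid all questions of
  convergence until a finite bound is at hand.
\<close>

primrec jump_flow :: "('s \<Rightarrow> 's \<Rightarrow> real) \<Rightarrow> 's set \<Rightarrow> ('s \<Rightarrow> ennreal) \<Rightarrow> nat \<Rightarrow> real \<Rightarrow> 's \<Rightarrow> ennreal" where
  "jump_flow q A c 0 t y = c y * ennreal (exp (q y y * t))"
| "jump_flow q A c (Suc k) t y =
    (\<integral>\<^sup>+s\<in>{0..t}. inflow q A (jump_flow q A c k s) y * ennreal (exp (q y y * (t - s))) \<partial>lborel)"

lemma borel_measurable_inflow: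
  assumes "countable A" "\<And>x. x \<in> A \<Longrightarrow> (\<lambda>s. w s x) \<in> borel_measurable N"
  shows "(\<lambda>s. inflow q A (w s) y) \<in> borel_measurable N"
proof -
  interpret sigma_finite_measure "count_space A"
    by (rule sigma_finite_measure_count_space_countable) fact
  note [measurable] = assms(2)
  have "(\<lambda>p. (\<lambda>x p. if x = y then 0 else w (fst p) x * ennreal (q x y)) (snd p) p)
      \<in> borel_measurable (N \<Otimes>\<^sub>M count_space A)"
    by (rule measurable_compose_countable'[where I = A]) (measurable, fact assms(1))
  then show ?thesis
    unfolding inflow_def
    by (intro borel_measurable_nn_integral) (simp add: split_beta')
qed

lemma borel_measurable_jump_flow:
  assumes "countable A"
  shows "(\<lambda>t. jump_flow q A c k t y) \<in> borel_measurable borel"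
proof (induction k arbitrary: y)
  case (Suc k)
  note [measurable] = borel_measurable_inflow[OF assms Suc]
  show ?case
    unfolding jump_flow.simps atLeastAtMost_iff indicator_def by measurable
qed simp

text \<open>
  On the paths that stay in \<open>A\<close> up to the \<open>k\<close>-th jump and jump to \<open>y\<close>, this is the law of the time
  of that jump: an atom at \<open>0\<close> for \<open>k = 0\<close>, and a density for later jumps.
\<close>

definition entry :: "('s \<Rightarrow> 's \<Rightarrow> real) \<Rightarrow> 's set \<Rightarrow> ('s \<Rightarrow> ennreal) \<Rightarrow> nat \<Rightarrow> 's \<Rightarrow> real measure" where
  "entry q A c k y = (case k of 0 \<Rightarrow> scale_measure (c y) (return borel 0)
    | Suc k \<Rightarrow> density lborel (\<lambda>s. inflow q A (jump_flow q A c k s) y * indicator {0..} s))"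

lemma sets_entry[measurable_cong, simp]: "sets (entry q A c k y) = sets borel"
  by (simp add: entry_def split: nat.split)

lemma AE_entry_nonneg:
  assumes "countable A"
  shows "AE s in entry q A c k y. 0 \<le> s"
proof (cases k)
  case 0
  have "AE s in return borel (0::real). 0 \<le> s" by (subst AE_return) auto
  then show ?thesis
    using 0 by (auto simp: entry_def AE_iff_null intro!: null_setsI simp: null_sets_def space_scale_measure)
next
  case (Suc m)
  note [measurable] = borel_measurable_inflow[OF assms borel_measurable_jump_flow[OF assms]]
  show ?thesis
    unfolding Suc entry_def nat.case by (subst AE_density) (measurable, auto split: split_indicator)
qed

lemma jump_flow_eq_entry:
  assumes A: "countable A" and t: "0 \<le> t"
  shows "jump_flow q A c k t y = (\<integral>\<^sup>+s. ennreal (exp (q y y * (t - s))) * indicator {0..t} s \<partial>entry q A c k y)"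
proof (cases k)
  case 0
  then show ?thesis using t
    by (simp add: entry_def nn_integral_scale_measure nn_integral_return)
next
  case (Suc m)
  note [measurable] = borel_measurable_inflow[OF A borel_measurable_jump_flow[OF A]]
  show ?thesis
    using Suc by (simp add: entry_def nn_integral_density)
      (auto intro!: nn_integral_cong simp: mult_ac split: split_indicator)
qed

section \<open>Jump times of a chain that is killed outside a set\<close>

text \<open>
  The jump chain and the holding times of a chain observed from \<open>x0\<close> until it leaves \<open>A\<close>.
  The positive mass of \<open>x0\<close> makes the measures \<open>entry\<close> finite, see \<open>finite_entry\<close>.
\<close>

locale killed_chain = prob_space M
  for M :: "'w measure" +
  fixes Y :: "nat \<Rightarrow> 'w \<Rightarrow> 's" and H :: "nat \<Rightarrow> 'w \<Rightarrow> ennreal"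
    and S :: "'s set" and q :: "'s \<Rightarrow> 's \<Rightarrow> real" and \<mu> :: "'s pmf"
    and A :: "'s set" and x0 :: 's
  assumes Y_meas: "\<And>j. Y j \<in> M \<rightarrow>\<^sub>M count_space S"
    and H_meas[measurable]: "\<And>j. H j \<in> borel_measurable M"
    and law: "\<And>k y s. (\<And>j. j \<le> k \<Longrightarrow> y j \<in> S \<and> 0 \<le> s j) \<Longrightarrow>
      \<P>(\<omega> in M. \<forall>j\<le>k. Y j \<omega> = y j \<and> H j \<omega> > ennreal (s j)) =
        pmf \<mu> (y 0) * (\<Prod>j<k. jump_prob q (y j) (y (Suc j))) * (\<Prod>j\<le>k. exp (q (y j) (y j) * s j))"
    and A: "A \<subseteq> S" "countable A"
    and rate: "\<And>x. x \<in> A \<Longrightarrow> q x x < 0"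
    and offdiag: "\<And>x y. x \<in> A \<Longrightarrow> y \<in> S \<Longrightarrow> x \<noteq> y \<Longrightarrow> 0 \<le> q x y"
    and x0: "x0 \<in> A" "0 < pmf \<mu> x0"
begin

lemma Y_pred[measurable]: "Measurable.pred M (\<lambda>\<omega>. Y j \<omega> \<in> B)"
proof -
  have "Y j -` (B \<inter> S) \<inter> space M \<in> sets M"
    using Y_meas by (rule measurable_sets) auto
  moreover have "Y j -` (B \<inter> S) \<inter> space M = {\<omega> \<in> space M. Y j \<omega> \<in> B}"
    using measurable_space[OF Y_meas[of j]] by auto
  ultimately show ?thesis by (simp add: pred_def)
qed

lemma Y_pred_eq[measurable]: "Measurable.pred M (\<lambda>\<omega>. Y j \<omega> = y)"
  using Y_pred[of j "{y}"] by simp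

definition past :: "nat \<Rightarrow> 'w \<Rightarrow> bool" where
  "past m \<omega> \<longleftrightarrow> Y 0 \<omega> = x0 \<and> (\<forall>j<m. Y j \<omega> \<in> A \<and> 0 < H j \<omega>)"

definition future :: "nat \<Rightarrow> nat \<Rightarrow> (nat \<Rightarrow> 's) \<Rightarrow> (nat \<Rightarrow> real) \<Rightarrow> 'w \<Rightarrow> bool" where
  "future m k y s \<omega> \<longleftrightarrow> (\<forall>j\<in>{m..k}. Y j \<omega> = y j \<and> ennreal (s j) < H j \<omega>)"

definition weight :: "nat \<Rightarrow> nat \<Rightarrow> (nat \<Rightarrow> 's) \<Rightarrow> (nat \<Rightarrow> real) \<Rightarrow> real" where
  "weight m k y s = (\<Prod>j\<in>{m..<k}. jump_prob q (y j) (y (Suc j))) * (\<Prod>j\<in>{m..k}. exp (q (y j) (y j) * s j))"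

definition jump_time :: "nat \<Rightarrow> 'w \<Rightarrow> ennreal" where
  "jump_time m \<omega> = (\<Sum>j<m. H j \<omega>)"

abbreviation start :: "'s \<Rightarrow> ennreal" where
  "start \<equiv> indicator {x0}"

lemma past_pred[measurable]: "Measurable.pred M (past m)"
  unfolding past_def by measurable

lemma future_pred[measurable]: "Measurable.pred M (future m k y s)"
  unfolding future_def by measurable

lemma jump_time_measurable[measurable]: "jump_time m \<in> borel_measurable M"
  unfolding jump_time_def by measurable

lemma jump_time_Suc: "jump_time (Suc m) \<omega> = jump_time m \<omega> + H m \<omega>"
  by (simp add: jump_time_def)

text \<open>
  The jump times are identified one after the other.  The claim keeps an arbitrary finite
  prescription of the path after the \<open>m\<close>-th jump, because the Markov property is available only
  through finite-dimensional tails and has to be carried along.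
\<close>

definition entry_claim :: "nat \<Rightarrow> bool" where
  "entry_claim m \<longleftrightarrow> (\<forall>k y s B. m \<le> k \<longrightarrow> B \<in> sets borel \<longrightarrow> (\<forall>j\<in>{m..k}. y j \<in> S \<and> 0 \<le> s j) \<longrightarrow>
     emeasure M {\<omega> \<in> space M. past m \<omega> \<and> jump_time m \<omega> \<in> B \<and> future m k y s \<omega>} =
     ennreal (pmf \<mu> x0) * emeasure (entry q A start m (y m)) (ennreal -` B) * ennreal (weight m k y s))"

lemma entry_claimD:
  assumes "entry_claim m" "m \<le> k" "B \<in> sets borel" "\<And>j. j \<in> {m..k} \<Longrightarrow> y j \<in> S \<and> 0 \<le> s j"
  shows "emeasure M {\<omega> \<in> space M. past m \<omega> \<and> jump_time m \<omega> \<in> B \<and> future m k y s \<omega>} =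
     ennreal (pmf \<mu> x0) * emeasure (entry q A start m (y m)) (ennreal -` B) * ennreal (weight m k y s)"
  using assms unfolding entry_claim_def by blast

lemma jump_prob_nonneg: "x \<in> A \<Longrightarrow> y \<in> S \<Longrightarrow> 0 \<le> jump_prob q x y"
  using rate[of x] offdiag[of x y] by (auto simp: jump_prob_def divide_nonneg_neg)

lemma entry_claim_0: "entry_claim 0"
  unfolding entry_claim_def
proof (intro allI impI)
  fix k :: nat and y :: "nat \<Rightarrow> 's" and s :: "nat \<Rightarrow> real" and B
  assume B: "B \<in> sets (borel :: ennreal measure)" and ys: "\<forall>j\<in>{0..k}. y j \<in> S \<and> 0 \<le> s j"
  have eq: "{0..<k} = {..<k}" "{0..k} = {..k}" by auto
  have "emeasure M {\<omega> \<in> space M. \<forall>j\<le>k. Y j \<omega> = y j \<and> H j \<omega> > ennreal (s j)} =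
    ennreal (pmf \<mu> (y 0)) * ennreal (weight 0 k y s)"
    unfolding emeasure_eq_measure
    by (subst law) (use ys in \<open>auto simp: weight_def eq mult.assoc ennreal_mult'\<close>)
  moreover have "{\<omega> \<in> space M. past 0 \<omega> \<and> jump_time 0 \<omega> \<in> B \<and> future 0 k y s \<omega>} =
     (if y 0 = x0 \<and> 0 \<in> B then {\<omega> \<in> space M. \<forall>j\<le>k. Y j \<omega> = y j \<and> H j \<omega> > ennreal (s j)} else {})"
    by (auto simp: past_def jump_time_def future_def atMost_atLeast0[symmetric]) (rule bexI[of _ 0], auto)
  moreover have "emeasure (entry q A start 0 (y 0)) (ennreal -` B) = (if y 0 = x0 \<and> 0 \<in> B then 1 else 0)"
  proof -
    have "ennreal -` B \<in> sets borel"
      using measurable_sets_borel[OF measurable_ennreal B] by simp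
    then show ?thesis
      by (auto simp: entry_def)
  qed
  ultimately show "emeasure M {\<omega> \<in> space M. past 0 \<omega> \<and> jump_time 0 \<omega> \<in> B \<and> future 0 k y s \<omega>} =
     ennreal (pmf \<mu> x0) * emeasure (entry q A start 0 (y 0)) (ennreal -` B) * ennreal (weight 0 k y s)"
    by simp
qed

lemma finite_entry:
  assumes claim: "entry_claim m" and D: "D \<in> S"
  shows "finite_measure (entry q A start m D)"
proof (rule finite_measureI)
  have sp: "space (entry q A start m D) = UNIV"
    using sets_eq_imp_space_eq[OF sets_entry] by simp
  have "ennreal (pmf \<mu> x0) * emeasure (entry q A start m D) UNIV
    = emeasure M {\<omega> \<in> space M. past m \<omega> \<and> jump_time m \<omega> \<in> UNIV \<and> future m m (\<lambda>_. D) (\<lambda>_. 0) \<omega>}"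
    by (subst entry_claimD[OF claim]) (auto simp: D weight_def)
  also have "\<dots> < \<infinity>"
    by (simp add: emeasure_eq_measure)
  finally show "emeasure (entry q A start m D) (space (entry q A start m D)) \<noteq> \<infinity>"
    unfolding sp using x0(2) by (auto simp: ennreal_mult_eq_top_iff)
qed

text \<open>
  Given the states, the holding time at the \<open>m\<close>-th state is independent of the time of the \<open>m\<close>-th
  jump: varying the prescribed tail of that holding time in the claim for \<open>m\<close> gives exponential
  tails that factor out.
\<close>

lemma emeasure_jump_time_holding:
  assumes claim: "entry_claim m" and D: "D \<in> A" and k: "m \<le> k"
    and ys: "\<And>j. j \<in> {Suc m..k} \<Longrightarrow> y j \<in> S \<and> 0 \<le> s j"
    and P: "P \<in> sets (borel \<Otimes>\<^sub>M borel)"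
  shows "emeasure M {\<omega> \<in> space M. past m \<omega> \<and> Y m \<omega> = D \<and> 0 < H m \<omega> \<and> future (Suc m) k y s \<omega> \<and>
      (jump_time m \<omega>, H m \<omega>) \<in> P} =
    (ennreal (pmf \<mu> x0) * ennreal (if k = m then 1 else jump_prob q D (y (Suc m)) * weight (Suc m) k y s)) *
    (\<integral>\<^sup>+r. (\<integral>\<^sup>+h. indicator P (ennreal r, ennreal h) * ennreal (exponential_density (- q D D) h) \<partial>lborel)
       \<partial>entry q A start m D)"
proof -
  let ?S = "\<lambda>X. {\<omega> \<in> space M. past m \<omega> \<and> Y m \<omega> = D \<and> 0 < H m \<omega> \<and> future (Suc m) k y s \<omega> \<and> (jump_time m \<omega>, H m \<omega>) \<in> X}"
  define G where "G = {\<omega> \<in> space M. past m \<omega> \<and> Y m \<omega> = D \<and> 0 < H m \<omega> \<and> future (Suc m) k y s \<omega>}"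
  define N where "N = distr (density M (indicator G)) (borel \<Otimes>\<^sub>M borel) (\<lambda>\<omega>. (jump_time m \<omega>, H m \<omega>))"
  have G[measurable]: "G \<in> sets M" unfolding G_def by measurable
  have N: "emeasure N X = emeasure M (?S X)"
    if [measurable]: "X \<in> sets (borel \<Otimes>\<^sub>M borel)" for X
  proof -
    have "(\<lambda>\<omega>. (jump_time m \<omega>, H m \<omega>)) -` X \<inter> space M \<in> sets M" by measurable
    then have "emeasure N X = emeasure M (G \<inter> ((\<lambda>\<omega>. (jump_time m \<omega>, H m \<omega>)) -` X \<inter> space M))"
      unfolding N_def
      by (subst emeasure_distr)
        (auto simp: emeasure_density indicator_inter_arith[symmetric])
    also have "G \<inter> ((\<lambda>\<omega>. (jump_time m \<omega>, H m \<omega>)) -` X \<inter> space M) = (?S X)"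
      by (auto simp: G_def)
    finally show ?thesis .
  qed
  let ?c = "ennreal (pmf \<mu> x0) * ennreal (if k = m then 1 else jump_prob q D (y (Suc m)) * weight (Suc m) k y s)"
  have "emeasure N P = ?c *
    (\<integral>\<^sup>+r. (\<integral>\<^sup>+h. indicator P (ennreal r, ennreal h) * ennreal (exponential_density (- q D D) h) \<partial>lborel)
       \<partial>entry q A start m D)"
  proof (rule product_law_from_tails)
    show "finite_measure N"
    proof (rule finite_measureI)
      have "space N = UNIV" unfolding N_def by (simp add: space_pair_measure)
      moreover have "emeasure N UNIV < \<infinity>"
        by (subst N) (auto simp: emeasure_eq_measure space_pair_measure
            intro!: sets.top[of "borel \<Otimes>\<^sub>M borel", unfolded space_pair_measure, simplified])
      ultimately show "emeasure N (space N) \<noteq> \<infinity>" by simp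
    qed
    show "finite_measure (entry q A start m D)"
      using finite_entry[OF claim] D A by auto
    show "emeasure N (UNIV \<times> {0}) = 0"
    proof (subst N)
      have "(?S (UNIV \<times> {0})) = {}" by auto
      then show "emeasure M (?S (UNIV \<times> {0})) = 0" by (metis emeasure_empty)
    qed auto
    fix B :: "ennreal set" and s' :: real assume B: "B \<in> sets borel" and s': "0 \<le> s'"
    \<comment> \<open>The \<open>m\<close>-th state and the tail of its holding time are added to the prescription of the later ones.\<close>
    define y' s'' where "y' = y(m := D)" and "s'' = s(m := s')"
    have "emeasure N (B \<times> {ennreal s'<..}) =
      emeasure M {\<omega> \<in> space M. past m \<omega> \<and> jump_time m \<omega> \<in> B \<and> future m k y' s'' \<omega>}"
    proof (subst N)
      have "{m..k} = insert m {Suc m..k}" using k by auto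
      then show "emeasure M (?S (B \<times> {ennreal s'<..})) =
        emeasure M {\<omega> \<in> space M. past m \<omega> \<and> jump_time m \<omega> \<in> B \<and> future m k y' s'' \<omega>}"
        using s' by (intro arg_cong[where f = "emeasure M"])
          (auto simp: future_def y'_def s''_def intro: le_less_trans)
    qed (use B in auto)
    also have "\<dots> = ennreal (pmf \<mu> x0) * emeasure (entry q A start m (y' m)) (ennreal -` B) * ennreal (weight m k y' s'')"
      by (rule entry_claimD[OF claim k B]) (use ys D A s' in \<open>auto simp: y'_def s''_def\<close>)
    also have "weight m k y' s'' =
      (if k = m then 1 else jump_prob q D (y (Suc m)) * weight (Suc m) k y s) * exp (q D D * s')"
    proof (cases "k = m")
      case False
      then have "{m..<k} = insert m {Suc m..<k}" "{m..k} = insert m {Suc m..k}" using k by auto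
      then have "weight m k y' s'' = jump_prob q D (y (Suc m)) * (\<Prod>j\<in>{Suc m..<k}. jump_prob q (y' j) (y' (Suc j))) *
          (exp (q D D * s') * (\<Prod>j\<in>{Suc m..k}. exp (q (y' j) (y' j) * s'' j)))"
        unfolding weight_def by (simp add: y'_def s''_def)
      also have "(\<Prod>j\<in>{Suc m..<k}. jump_prob q (y' j) (y' (Suc j))) = (\<Prod>j\<in>{Suc m..<k}. jump_prob q (y j) (y (Suc j)))"
        by (rule prod.cong) (auto simp: y'_def)
      also have "(\<Prod>j\<in>{Suc m..k}. exp (q (y' j) (y' j) * s'' j)) = (\<Prod>j\<in>{Suc m..k}. exp (q (y j) (y j) * s j))"
        by (rule prod.cong) (auto simp: y'_def s''_def)
      finally show ?thesis using False by (simp add: weight_def)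
    qed (simp add: weight_def y'_def s''_def)
    finally show "emeasure N (B \<times> {ennreal s'<..}) =
        ?c * emeasure (entry q A start m D) (ennreal -` B) * ennreal (exp (- (- q D D) * s'))"
      by (simp only: ennreal_mult''[OF exp_ge_zero] y'_def fun_upd_same minus_minus) (simp only: mult_ac)
  qed (use rate[OF D] P in \<open>auto simp: N_def ennreal_mult_eq_top_iff\<close>)
  then show ?thesis by (simp add: N[OF P])
qed

end

context killed_chain begin

text \<open>
  The time of the next jump is the sum of two independent times.  Summing over the state \<open>D\<close>
  before the jump, \<open>jump_prob q D y'\<close> and the parameter \<open>- q D D\<close> of the holding time multiply to
  the rate \<open>q D y'\<close>; this is how the recursion of \<open>jump_flow\<close> arises.
\<close>

lemma entry_claim_Suc:
  assumes claim: "entry_claim m"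
  shows "entry_claim (Suc m)"
  unfolding entry_claim_def
proof (intro allI impI)
  fix k :: nat and y :: "nat \<Rightarrow> 's" and s :: "nat \<Rightarrow> real" and B
  assume k: "Suc m \<le> k" and B[measurable]: "B \<in> sets (borel :: ennreal measure)"
    and ys: "\<forall>j\<in>{Suc m..k}. y j \<in> S \<and> 0 \<le> s j"
  define w y' where "w = weight (Suc m) k y s" and "y' = y (Suc m)"
  have y': "y' \<in> S" using ys k by (auto simp: y'_def)
  define P where "P = {p :: ennreal \<times> ennreal. fst p + snd p \<in> B}"
  have P: "P \<in> sets (borel \<Otimes>\<^sub>M borel)"
  proof -
    have "{p \<in> space (borel \<Otimes>\<^sub>M borel). fst p + snd p \<in> B} \<in> sets (borel \<Otimes>\<^sub>M borel)" by measurable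
    then show ?thesis by (simp add: P_def space_pair_measure)
  qed
  define E where "E D = {\<omega> \<in> space M. past m \<omega> \<and> Y m \<omega> = D \<and> 0 < H m \<omega> \<and> future (Suc m) k y s \<omega> \<and>
      (jump_time m \<omega>, H m \<omega>) \<in> P}" for D
  have E_sets: "E D \<in> sets M" for D
  proof -
    have "{\<omega> \<in> space M. past m \<omega> \<and> Y m \<omega> = D \<and> 0 < H m \<omega> \<and> future (Suc m) k y s \<omega> \<and>
      jump_time m \<omega> + H m \<omega> \<in> B} \<in> sets M" by measurable
    then show ?thesis by (simp add: E_def P_def)
  qed
  note [measurable] = borel_measurable_jump_flow[OF A(2)] borel_measurable_inflow[OF A(2) borel_measurable_jump_flow[OF A(2)]]
  let ?g = "\<lambda>t D. indicator B (ennreal t) * indicator {0..} t *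
      (if D = y' then 0 else jump_flow q A start m t D * ennreal (q D y'))"
  have E: "emeasure M (E D) = ennreal (pmf \<mu> x0) * ennreal w * (\<integral>\<^sup>+t. ?g t D \<partial>lborel)" if D: "D \<in> A" for D
  proof -
    have DS: "D \<in> S" using D A by auto
    let ?l = "- q D D"
    have l: "0 < ?l" using rate[OF D] by simp
    let ?I = "\<lambda>t. indicator B (ennreal t) *
        (ennreal ?l * (\<integral>\<^sup>+r. ennreal (exp (- ?l * (t - r))) * indicator {0..t} r \<partial>entry q A start m D))"
    have "emeasure M (E D) = ennreal (pmf \<mu> x0) * ennreal (jump_prob q D y' * w) *
      (\<integral>\<^sup>+r. (\<integral>\<^sup>+h. indicator P (ennreal r, ennreal h) * ennreal (exponential_density ?l h) \<partial>lborel)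
       \<partial>entry q A start m D)"
      unfolding E_def using k ys
      by (subst emeasure_jump_time_holding[OF claim D _ _ P]) (auto simp: w_def y'_def)
    also have "(\<integral>\<^sup>+r. (\<integral>\<^sup>+h. indicator P (ennreal r, ennreal h) * ennreal (exponential_density ?l h) \<partial>lborel)
       \<partial>entry q A start m D) =
       (\<integral>\<^sup>+r. (\<integral>\<^sup>+h. indicator B (ennreal r + ennreal h) * ennreal (exponential_density ?l h) \<partial>lborel)
       \<partial>entry q A start m D)"
      by (simp add: P_def indicator_def)
    also have "\<dots> = (\<integral>\<^sup>+t. ?I t \<partial>lborel)"
      by (rule nn_integral_exponential_shift[OF l _ finite_entry[OF claim DS] AE_entry_nonneg[OF A(2)] B]) simp
    also have "ennreal (pmf \<mu> x0) * ennreal (jump_prob q D y' * w) * (\<integral>\<^sup>+t. ?I t \<partial>lborel) =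
      ennreal (pmf \<mu> x0) * ennreal w * (ennreal (jump_prob q D y') * (\<integral>\<^sup>+t. ?I t \<partial>lborel))"
      by (simp only: ennreal_mult'[OF jump_prob_nonneg[OF D y']]) (simp only: mult_ac)
    also have "ennreal (jump_prob q D y') * (\<integral>\<^sup>+t. ?I t \<partial>lborel) = (\<integral>\<^sup>+t. ?g t D \<partial>lborel)"
    proof -
      have I: "?I t = indicator B (ennreal t) * indicator {0..} t * (ennreal ?l * jump_flow q A start m t D)" for t
      proof (cases "0 \<le> t")
        case True
        then show ?thesis by (simp add: jump_flow_eq_entry[OF A(2)])
      next
        case False
        then have "{0..t} = {}" by auto
        with False show ?thesis by simp
      qed
      have "ennreal (jump_prob q D y') * (\<integral>\<^sup>+t. ?I t \<partial>lborel) =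
        (\<integral>\<^sup>+t. ennreal (jump_prob q D y') *
           (indicator B (ennreal t) * indicator {0..} t * (ennreal ?l * jump_flow q A start m t D)) \<partial>lborel)"
        unfolding I by (rule nn_integral_cmult[symmetric]) measurable
      also have "\<dots> = (\<integral>\<^sup>+t. ?g t D \<partial>lborel)"
      proof (rule nn_integral_cong)
        fix t :: real
        have "ennreal (jump_prob q D y') * ennreal ?l = (if D = y' then 0 else ennreal (q D y'))"
          using l jump_prob_nonneg[OF D y']
          by (auto simp: jump_prob_def ennreal_mult'[symmetric])
        then have "ennreal (jump_prob q D y') * ennreal ?l * jump_flow q A start m t D =
          (if D = y' then 0 else jump_flow q A start m t D * ennreal (q D y'))" by (auto simp: mult.commute)
        moreover have "u * (i * (l * k)) = i * (u * l * k)" for u i l k :: ennreal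
          by (simp only: mult_ac)
        ultimately show "ennreal (jump_prob q D y') *
           (indicator B (ennreal t) * indicator {0..} t * (ennreal ?l * jump_flow q A start m t D)) = ?g t D"
          by (simp only:)
      qed
      finally show ?thesis .
    qed
    finally show ?thesis .
  qed
  interpret cs: sigma_finite_measure "count_space A"
    by (rule sigma_finite_measure_count_space_countable) (rule A)
  interpret P: pair_sigma_finite "count_space A" lborel ..
  have "{\<omega> \<in> space M. past (Suc m) \<omega> \<and> jump_time (Suc m) \<omega> \<in> B \<and> future (Suc m) k y s \<omega>} = (\<Union>D\<in>A. E D)"
    by (auto simp: E_def P_def past_def jump_time_Suc less_Suc_eq)
  then have "emeasure M {\<omega> \<in> space M. past (Suc m) \<omega> \<and> jump_time (Suc m) \<omega> \<in> B \<and> future (Suc m) k y s \<omega>} =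
    emeasure M (\<Union>D\<in>A. E D)" by simp
  also have "\<dots> = (\<integral>\<^sup>+D. emeasure M (E D) \<partial>count_space A)"
    by (rule emeasure_UN_countable) (auto simp: E_sets A disjoint_family_on_def, auto simp: E_def)
  also have "\<dots> = (\<integral>\<^sup>+D. ennreal (pmf \<mu> x0) * ennreal w * (\<integral>\<^sup>+t. ?g t D \<partial>lborel) \<partial>count_space A)"
    by (rule nn_integral_cong) (simp add: E)
  also have "\<dots> = ennreal (pmf \<mu> x0) * ennreal w * (\<integral>\<^sup>+D. (\<integral>\<^sup>+t. ?g t D \<partial>lborel) \<partial>count_space A)"
    by (rule nn_integral_cmult) simp
  also have "(\<integral>\<^sup>+D. (\<integral>\<^sup>+t. ?g t D \<partial>lborel) \<partial>count_space A) = (\<integral>\<^sup>+t. (\<integral>\<^sup>+D. ?g t D \<partial>count_space A) \<partial>lborel)"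
    by (rule P.Fubini'[symmetric]) (rule measurable_pair_measure_countable1[OF A(2)], simp)
  also have "\<dots> = (\<integral>\<^sup>+t. (inflow q A (jump_flow q A start m t) y' * indicator {0..} t) * indicator (ennreal -` B) t \<partial>lborel)"
    by (intro nn_integral_cong, subst nn_integral_cmult)
      (auto simp: inflow_def split: split_indicator)
  also have "\<dots> = emeasure (entry q A start (Suc m) y') (ennreal -` B)"
  proof -
    have "ennreal -` B \<in> sets borel"
      using measurable_sets_borel[OF measurable_ennreal B] by simp
    then have *: "ennreal -` B \<in> sets lborel" by (simp only: sets_lborel)
    show ?thesis
      unfolding entry_def nat.case
      by (rule emeasure_density[OF _ *, symmetric]) measurable
  qed
  finally show "emeasure M {\<omega> \<in> space M. past (Suc m) \<omega> \<and> jump_time (Suc m) \<omega> \<in> B \<and> future (Suc m) k y s \<omega>} =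
     ennreal (pmf \<mu> x0) * emeasure (entry q A start (Suc m) (y (Suc m))) (ennreal -` B) *
     ennreal (weight (Suc m) k y s)"
    by (simp add: w_def y'_def mult_ac)
qed

lemma entry_claim: "entry_claim m"
  by (induction m) (auto intro: entry_claim_0 entry_claim_Suc)

lemma emeasure_occupied:
  assumes y: "y \<in> A" and t: "0 \<le> t"
  shows "emeasure M {\<omega> \<in> space M. past m \<omega> \<and> Y m \<omega> = y \<and> 0 < H m \<omega> \<and>
      jump_time m \<omega> \<le> ennreal t \<and> ennreal t < jump_time (Suc m) \<omega>} =
    ennreal (pmf \<mu> x0) * jump_flow q A start m t y"
proof -
  let ?l = "- q y y"
  have l: "0 < ?l" using rate[OF y] by simp
  define P where "P = {p :: ennreal \<times> ennreal. fst p \<le> ennreal t \<and> ennreal t < fst p + snd p}"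
  have P: "P \<in> sets (borel \<Otimes>\<^sub>M borel)"
  proof -
    have "{p \<in> space (borel \<Otimes>\<^sub>M borel). fst p \<le> ennreal t \<and> ennreal t < fst p + snd p} \<in> sets (borel \<Otimes>\<^sub>M borel)"
      by measurable
    then show ?thesis by (simp add: P_def space_pair_measure)
  qed
  have "{\<omega> \<in> space M. past m \<omega> \<and> Y m \<omega> = y \<and> 0 < H m \<omega> \<and>
      jump_time m \<omega> \<le> ennreal t \<and> ennreal t < jump_time (Suc m) \<omega>} =
    {\<omega> \<in> space M. past m \<omega> \<and> Y m \<omega> = y \<and> 0 < H m \<omega> \<and> future (Suc m) m (\<lambda>_. y) (\<lambda>_. 0) \<omega> \<and>
      (jump_time m \<omega>, H m \<omega>) \<in> P}"
    by (auto simp: P_def future_def jump_time_Suc)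
  then have "emeasure M {\<omega> \<in> space M. past m \<omega> \<and> Y m \<omega> = y \<and> 0 < H m \<omega> \<and>
      jump_time m \<omega> \<le> ennreal t \<and> ennreal t < jump_time (Suc m) \<omega>} =
    ennreal (pmf \<mu> x0) *
    (\<integral>\<^sup>+r. (\<integral>\<^sup>+h. indicator P (ennreal r, ennreal h) * ennreal (exponential_density ?l h) \<partial>lborel)
       \<partial>entry q A start m y)"
    using emeasure_jump_time_holding[OF entry_claim y order.refl _ P, where y = "\<lambda>_. y" and s = "\<lambda>_. 0"] by simp
  also have "(\<integral>\<^sup>+r. (\<integral>\<^sup>+h. indicator P (ennreal r, ennreal h) * ennreal (exponential_density ?l h) \<partial>lborel)
       \<partial>entry q A start m y) =
    (\<integral>\<^sup>+r. ennreal (exp (q y y * (t - r))) * indicator {0..t} r \<partial>entry q A start m y)"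
  proof (rule nn_integral_cong_AE, use AE_entry_nonneg[OF A(2)] in eventually_elim)
    fix r :: real assume r: "0 \<le> r"
    show "(\<integral>\<^sup>+h. indicator P (ennreal r, ennreal h) * ennreal (exponential_density ?l h) \<partial>lborel) =
      ennreal (exp (q y y * (t - r))) * indicator {0..t} r"
    proof (cases "r \<le> t")
      case True
      have "(\<integral>\<^sup>+h. indicator P (ennreal r, ennreal h) * ennreal (exponential_density ?l h) \<partial>lborel) =
        (\<integral>\<^sup>+h\<in>{h. t - r < h}. ennreal (exponential_density ?l h) \<partial>lborel)"
        using r t True
        by (intro nn_integral_cong)
          (auto simp: P_def exponential_density_def ennreal_plus[symmetric] ennreal_less_iff
            simp del: ennreal_plus split: split_indicator)
      also have "\<dots> = ennreal (exp (- ?l * (t - r)))"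
        using emeasure_exponential_tail[OF l, of "t - r"] True
        by (simp add: emeasure_density)
      finally show ?thesis using r True by simp
    next
      case False
      then have "\<not> ennreal r \<le> ennreal t" using r t by (simp add: ennreal_le_iff)
      then show ?thesis using False by (simp add: P_def)
    qed
  qed
  also have "\<dots> = jump_flow q A start m t y"
    by (rule jump_flow_eq_entry[OF A(2) t, symmetric])
  finally show ?thesis .
qed

lemma emeasure_left_at:
  assumes e: "e \<in> S" and t: "0 \<le> t"
  shows "emeasure M {\<omega> \<in> space M. past (Suc m) \<omega> \<and> Y (Suc m) \<omega> = e \<and> 0 < H (Suc m) \<omega> \<and>
      jump_time (Suc m) \<omega> \<le> ennreal t} =
    ennreal (pmf \<mu> x0) * (\<integral>\<^sup>+s\<in>{0..t}. inflow q A (jump_flow q A start m s) e \<partial>lborel)"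
proof -
  note [measurable] = borel_measurable_inflow[OF A(2) borel_measurable_jump_flow[OF A(2)]]
  have *: "ennreal -` {..ennreal t} = {..t}"
    using t by (auto simp: ennreal_le_iff)
  have "{\<omega> \<in> space M. past (Suc m) \<omega> \<and> Y (Suc m) \<omega> = e \<and> 0 < H (Suc m) \<omega> \<and> jump_time (Suc m) \<omega> \<le> ennreal t} =
    {\<omega> \<in> space M. past (Suc m) \<omega> \<and> jump_time (Suc m) \<omega> \<in> {..ennreal t} \<and>
       future (Suc m) (Suc m) (\<lambda>_. e) (\<lambda>_. 0) \<omega>}"
    by (auto simp: future_def)
  then have "emeasure M {\<omega> \<in> space M. past (Suc m) \<omega> \<and> Y (Suc m) \<omega> = e \<and> 0 < H (Suc m) \<omega> \<and>
      jump_time (Suc m) \<omega> \<le> ennreal t} = ennreal (pmf \<mu> x0) * emeasure (entry q A start (Suc m) e) {..t}"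
    using entry_claimD[OF entry_claim order.refl, of "{..ennreal t}" "Suc m" "\<lambda>_. e" "\<lambda>_. 0"] e
    by (simp add: weight_def *)
  also have "emeasure (entry q A start (Suc m) e) {..t} =
    (\<integral>\<^sup>+s\<in>{0..t}. inflow q A (jump_flow q A start m s) e \<partial>lborel)"
    unfolding entry_def nat.case
    by (subst emeasure_density, measurable)
      (auto intro!: nn_integral_cong split: split_indicator)
  finally show ?thesis .
qed

end

section \<open>Exit times\<close>

text \<open>
  A path that is in \<open>A\<close> at time \<open>t\<close> remains there for a while by right-continuity, so that its exit
  is strictly later than \<open>t\<close>.
\<close>

lemma exit_time_gt_iff:
  assumes rc: "\<forall>\<^sub>F s in at_right t. X s \<omega> = X t \<omega>" and t: "0 \<le> t"
  shows "ennreal t < exit_time X A \<omega> \<longleftrightarrow> (\<forall>s\<in>{0..t}. X s \<omega> \<in> A)"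
proof
  assume *: "ennreal t < exit_time X A \<omega>"
  show "\<forall>s\<in>{0..t}. X s \<omega> \<in> A"
  proof (rule ballI, rule ccontr)
    fix s assume s: "s \<in> {0..t}" "X s \<omega> \<notin> A"
    then have "exit_time X A \<omega> \<le> ennreal s"
      unfolding exit_time_def by (intro Inf_lower) auto
    also have "\<dots> \<le> ennreal t" using s by (simp add: ennreal_leI)
    finally show False using * by simp
  qed
next
  assume *: "\<forall>s\<in>{0..t}. X s \<omega> \<in> A"
  obtain u where u: "t < u" "\<And>s. t < s \<Longrightarrow> s < u \<Longrightarrow> X s \<omega> = X t \<omega>"
    using rc unfolding eventually_at_right_field by auto
  have "u \<le> s" if "0 \<le> s" "X s \<omega> \<notin> A" for s
    using that * u t by (metis atLeastAtMost_iff not_le order.refl)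
  then have "ennreal u \<le> exit_time X A \<omega>"
    unfolding exit_time_def by (intro Inf_greatest) (auto intro: ennreal_leI)
  moreover have "ennreal t < ennreal u" using u t by (simp add: ennreal_less_iff)
  ultimately show "ennreal t < exit_time X A \<omega>" by (rule less_le_trans[rotated])
qed

text \<open>
  A path that is outside \<open>A\<close> before time \<open>t\<close> is so on an interval, hence at a rational time.
\<close>

lemma sets_exit_time_gt:
  assumes X: "\<And>t. 0 \<le> t \<Longrightarrow> X t \<in> M \<rightarrow>\<^sub>M count_space S"
    and rc: "\<And>\<omega> t. \<omega> \<in> space M \<Longrightarrow> 0 \<le> t \<Longrightarrow> \<forall>\<^sub>F s in at_right t. X s \<omega> = X t \<omega>"
    and t: "0 \<le> t"
  shows "{\<omega> \<in> space M. ennreal t < exit_time X A \<omega>} \<in> sets M"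
proof -
  let ?I = "insert t (\<rat> \<inter> {0..t})"
  have I: "?I \<subseteq> {0..t}" using t by auto
  have "{\<omega> \<in> space M. ennreal t < exit_time X A \<omega>} = {\<omega> \<in> space M. \<forall>s\<in>?I. X s \<omega> \<in> A}"
  proof (rule Collect_cong, rule conj_cong[OF refl])
    fix \<omega> assume w: "\<omega> \<in> space M"
    have "(\<forall>s\<in>{0..t}. X s \<omega> \<in> A)" if *: "\<forall>s\<in>?I. X s \<omega> \<in> A"
    proof
      fix s assume s: "s \<in> {0..t}"
      show "X s \<omega> \<in> A"
      proof (cases "s = t")
        case False
        with s have st: "s < t" "0 \<le> s" by auto
        obtain u where u: "s < u" "\<And>r. s < r \<Longrightarrow> r < u \<Longrightarrow> X r \<omega> = X s \<omega>"
          using rc[OF w \<open>0 \<le> s\<close>] unfolding eventually_at_right_field by auto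
        obtain r where "r \<in> \<rat>" "s < r" "r < min u t"
          using Rats_dense_in_real[of s "min u t"] u st by auto
        then have "X r \<omega> = X s \<omega>" "X r \<omega> \<in> A"
          using u(2)[of r] bspec[OF *, of r] st by auto
        then show ?thesis by simp
      qed (use * in auto)
    qed
    then show "ennreal t < exit_time X A \<omega> \<longleftrightarrow> (\<forall>s\<in>?I. X s \<omega> \<in> A)"
      unfolding exit_time_gt_iff[where X = X and \<omega> = \<omega>, OF rc[OF w t] t] using I by blast
  qed
  also have "\<dots> = space M \<inter> (\<Inter>s\<in>?I. X s -` (A \<inter> S) \<inter> space M)"
  proof -
    have "X s \<omega> \<in> S" if "s \<in> ?I" "\<omega> \<in> space M" for s \<omega>
      using measurable_space[OF X[of s], of \<omega>] that t by auto
    then show ?thesis by blast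
  qed
  also have "\<dots> \<in> sets M"
  proof (intro sets.Int sets.top sets.countable_INT')
    show "countable ?I" using countable_rat by (intro countable_insert countable_Int1)
    show "(\<lambda>s. X s -` (A \<inter> S) \<inter> space M) ` ?I \<subseteq> sets M"
      using I by (intro image_subsetI measurable_sets[OF X]) auto
  qed auto
  finally show ?thesis .
qed

locale killed_chain_path = killed_chain +
  fixes X :: "real \<Rightarrow> 'a \<Rightarrow> 'b"
  assumes X_meas: "\<And>t. 0 \<le> t \<Longrightarrow> X t \<in> M \<rightarrow>\<^sub>M count_space S"
    and right_cont: "\<And>\<omega> t. \<omega> \<in> space M \<Longrightarrow> 0 \<le> t \<Longrightarrow> \<forall>\<^sub>F s in at_right t. X s \<omega> = X t \<omega>"
    and path: "AE \<omega> in M. \<forall>k. \<forall>t\<ge>0. (\<Sum>j<k. H j \<omega>) \<le> ennreal t \<and> ennreal t < (\<Sum>j\<le>k. H j \<omega>) \<longrightarrow> X t \<omega> = Y k \<omega>"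
begin

lemma X_pred: "0 \<le> t \<Longrightarrow> {\<omega> \<in> space M. X t \<omega> \<in> B} \<in> sets M"
proof -
  assume t: "0 \<le> t"
  have "X t -` (B \<inter> S) \<inter> space M \<in> sets M"
    using X_meas[OF t] by (rule measurable_sets) auto
  moreover have "X t -` (B \<inter> S) \<inter> space M = {\<omega> \<in> space M. X t \<omega> \<in> B}"
    using measurable_space[OF X_meas[OF t]] by auto
  ultimately show ?thesis by simp
qed

lemma jump_time_mono: "i \<le> j \<Longrightarrow> jump_time i \<omega> \<le> jump_time j \<omega>"
  unfolding jump_time_def by (rule sum_mono2) auto

lemma X_before_jump:
  assumes path: "\<And>k t. 0 \<le> t \<Longrightarrow> jump_time k \<omega> \<le> ennreal t \<Longrightarrow> ennreal t < jump_time (Suc k) \<omega> \<Longrightarrow> X t \<omega> = Y k \<omega>"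
    and s: "0 \<le> s" "ennreal s < jump_time m \<omega>"
  shows "\<exists>j<m. X s \<omega> = Y j \<omega>"
  using s(2)
proof (induction m)
  case 0
  then show ?case by (simp add: jump_time_def)
next
  case (Suc m)
  then show ?case
    using path[OF s(1), of m] less_Suc_eq not_le by metis
qed

lemma AE_path: "AE \<omega> in M. \<forall>k t. 0 \<le> t \<longrightarrow> jump_time k \<omega> \<le> ennreal t \<longrightarrow> ennreal t < jump_time (Suc k) \<omega> \<longrightarrow> X t \<omega> = Y k \<omega>"
  using path by eventually_elim (auto simp: jump_time_def lessThan_Suc_atMost)

text \<open>
  The right-hand side also contains the paths that make infinitely many jumps before time \<open>t\<close>, so
  that in general this is no equality.
\<close>

lemma jump_flow_le_prob:
  assumes y: "y \<in> A" and t: "0 \<le> t"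
  shows "ennreal (pmf \<mu> x0) * (\<Sum>k. jump_flow q A start k t y) \<le>
    emeasure M {\<omega> \<in> space M. X 0 \<omega> = x0 \<and> X t \<omega> = y \<and> ennreal t < exit_time X A \<omega>}"
proof -
  let ?T = "{\<omega> \<in> space M. X 0 \<omega> = x0 \<and> X t \<omega> = y \<and> ennreal t < exit_time X A \<omega>}"
  define E where "E m = {\<omega> \<in> space M. past m \<omega> \<and> Y m \<omega> = y \<and> 0 < H m \<omega> \<and>
      jump_time m \<omega> \<le> ennreal t \<and> ennreal t < jump_time (Suc m) \<omega>}" for m
  have E[measurable]: "E m \<in> sets M" for m unfolding E_def by measurable
  have disj: "disjoint_family E"
  proof -
    have *: "E i \<inter> E j = {}" if "i < j" for i j
    proof -
      have False if w: "\<omega> \<in> E i" "\<omega> \<in> E j" for \<omega>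
      proof -
        have "jump_time (Suc i) \<omega> \<le> jump_time j \<omega>"
          using \<open>i < j\<close> by (intro jump_time_mono) simp
        moreover have "ennreal t < jump_time (Suc i) \<omega>" "jump_time j \<omega> \<le> ennreal t"
          using w by (auto simp: E_def)
        ultimately show False by (meson leD order.trans)
      qed
      then show ?thesis by blast
    qed
    show ?thesis
      unfolding disjoint_family_on_def
    proof (intro ballI impI)
      fix i j :: nat assume "i \<noteq> j"
      then consider "i < j" | "j < i" by linarith
      then show "E i \<inter> E j = {}"
        by cases (use *[of i j] *[of j i] in blast)+
    qed
  qed
  have "ennreal (pmf \<mu> x0) * (\<Sum>k. jump_flow q A start k t y) = (\<Sum>k. emeasure M (E k))"
    unfolding E_def emeasure_occupied[OF y t] by simp
  also have "\<dots> = emeasure M (\<Union>k. E k)"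
    by (rule suminf_emeasure) (auto simp: disj)
  also have "\<dots> \<le> emeasure M ?T"
  proof (rule emeasure_mono_AE)
    show "AE \<omega> in M. \<omega> \<in> (\<Union>k. E k) \<longrightarrow>
      \<omega> \<in> ?T"
      using AE_path
    proof eventually_elim
      case (elim \<omega>)
      show ?case
      proof
        assume "\<omega> \<in> (\<Union>k. E k)"
        then obtain m where m: "\<omega> \<in> space M" "past m \<omega>" "Y m \<omega> = y" "0 < H m \<omega>"
          "jump_time m \<omega> \<le> ennreal t" "ennreal t < jump_time (Suc m) \<omega>"
          by (auto simp: E_def)
        have "X s \<omega> \<in> A" if "s \<in> {0..t}" for s
        proof -
          have "ennreal s < jump_time (Suc m) \<omega>"
            using that m(6) by (auto intro: le_less_trans ennreal_leI)
          then obtain j where "j < Suc m" "X s \<omega> = Y j \<omega>"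
            using X_before_jump[of \<omega> s "Suc m"] elim \<open>s \<in> _\<close> by auto
          then show ?thesis using m y by (auto simp: past_def less_Suc_eq)
        qed
        then have "ennreal t < exit_time X A \<omega>"
          unfolding exit_time_gt_iff[where X = X and \<omega> = \<omega>, OF right_cont[OF m(1) t] t] by blast
        moreover have "X t \<omega> = y" using elim m t by auto
        moreover have "0 < H 0 \<omega>" using m by (cases m) (auto simp: past_def)
        then have "X 0 \<omega> = Y 0 \<omega>" using elim[rule_format, of 0 0] by (simp add: jump_time_def)
        ultimately show "\<omega> \<in> ?T"
          using m by (auto simp: past_def)
      qed
    qed
    have "?T =
      {\<omega> \<in> space M. X 0 \<omega> \<in> {x0}} \<inter> {\<omega> \<in> space M. X t \<omega> \<in> {y}} \<inter> {\<omega> \<in> space M. ennreal t < exit_time X A \<omega>}"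
      by auto
    then show "?T \<in> sets M"
      using X_pred[OF t, of "{y}"] X_pred[of 0 "{x0}"] sets_exit_time_gt[where X = X, OF X_meas right_cont t] by auto
  qed
  finally show ?thesis .
qed

text \<open>
  The paths counted on the left leave \<open>A\<close> with their jump number \<open>k + 1\<close>, into the state \<open>e\<close>.
\<close>

lemma exit_flow_le_prob:
  assumes B: "B \<subseteq> S - A" "countable B" and t: "0 \<le> t"
  shows "ennreal (pmf \<mu> x0) *
      (\<Sum>k. \<integral>\<^sup>+e. (\<integral>\<^sup>+s\<in>{0..t}. inflow q A (jump_flow q A start k s) e \<partial>lborel) \<partial>count_space B) \<le>
    emeasure M {\<omega> \<in> space M. X 0 \<omega> = x0 \<and> \<not> ennreal t < exit_time X A \<omega>}"
proof -
  let ?T = "{\<omega> \<in> space M. X 0 \<omega> = x0 \<and> \<not> ennreal t < exit_time X A \<omega>}"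
  define E where "E m e = {\<omega> \<in> space M. past (Suc m) \<omega> \<and> Y (Suc m) \<omega> = e \<and> 0 < H (Suc m) \<omega> \<and>
      jump_time (Suc m) \<omega> \<le> ennreal t}" for m e
  have E[measurable]: "E m e \<in> sets M" for m e unfolding E_def by measurable
  have EB: "(\<Union>e\<in>B. E m e) \<in> sets M" for m by (rule sets.countable_UN'[OF B(2)]) auto
  have disj: "disjoint_family (\<lambda>m. \<Union>e\<in>B. E m e)"
  proof -
    have *: "(\<Union>e\<in>B. E i e) \<inter> (\<Union>e\<in>B. E j e) = {}" if "i < j" for i j
    proof -
      have False if "\<omega> \<in> E i e" "\<omega> \<in> E j e'" "e \<in> B" for \<omega> e e'
      proof -
        have "Y (Suc i) \<omega> = e" "Y (Suc i) \<omega> \<in> A"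
          using that \<open>i < j\<close> by (auto simp: E_def past_def)
        with B \<open>e \<in> B\<close> show False by auto
      qed
      then show ?thesis by blast
    qed
    show ?thesis
      unfolding disjoint_family_on_def
    proof (intro ballI impI)
      fix i j :: nat assume "i \<noteq> j"
      then consider "i < j" | "j < i" by linarith
      then show "(\<Union>e\<in>B. E i e) \<inter> (\<Union>e\<in>B. E j e) = {}"
        by cases (use *[of i j] *[of j i] in blast)+
    qed
  qed
  have "emeasure M (\<Union>e\<in>B. E k e) = ennreal (pmf \<mu> x0) *
      (\<integral>\<^sup>+e. (\<integral>\<^sup>+s\<in>{0..t}. inflow q A (jump_flow q A start k s) e \<partial>lborel) \<partial>count_space B)" for k
  proof -
    have "emeasure M (\<Union>e\<in>B. E k e) = (\<integral>\<^sup>+e. emeasure M (E k e) \<partial>count_space B)"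
      by (rule emeasure_UN_countable) (auto simp: B disjoint_family_on_def, auto simp: E_def)
    also have "\<dots> = (\<integral>\<^sup>+e. ennreal (pmf \<mu> x0) *
        (\<integral>\<^sup>+s\<in>{0..t}. inflow q A (jump_flow q A start k s) e \<partial>lborel) \<partial>count_space B)"
      unfolding E_def using B by (intro nn_integral_cong) (auto simp: emeasure_left_at t)
    also have "\<dots> = ennreal (pmf \<mu> x0) *
      (\<integral>\<^sup>+e. (\<integral>\<^sup>+s\<in>{0..t}. inflow q A (jump_flow q A start k s) e \<partial>lborel) \<partial>count_space B)"
      by (rule nn_integral_cmult) simp
    finally show ?thesis .
  qed
  then have "ennreal (pmf \<mu> x0) *
      (\<Sum>k. \<integral>\<^sup>+e. (\<integral>\<^sup>+s\<in>{0..t}. inflow q A (jump_flow q A start k s) e \<partial>lborel) \<partial>count_space B) =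
    (\<Sum>k. emeasure M (\<Union>e\<in>B. E k e))" by simp
  also have "\<dots> = emeasure M (\<Union>k. \<Union>e\<in>B. E k e)"
    by (rule suminf_emeasure) (auto simp: disj EB)
  also have "\<dots> \<le> emeasure M ?T"
  proof (rule emeasure_mono_AE)
    show "AE \<omega> in M. \<omega> \<in> (\<Union>k. \<Union>e\<in>B. E k e) \<longrightarrow>
      \<omega> \<in> ?T"
      using AE_path
    proof eventually_elim
      case (elim \<omega>)
      show ?case
      proof
        assume "\<omega> \<in> (\<Union>k. \<Union>e\<in>B. E k e)"
        then obtain m e where m: "\<omega> \<in> space M" "past (Suc m) \<omega>" "Y (Suc m) \<omega> = e" "0 < H (Suc m) \<omega>"
          "jump_time (Suc m) \<omega> \<le> ennreal t" and e: "e \<in> B"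
          by (auto simp: E_def)
        then obtain s where s: "jump_time (Suc m) \<omega> = ennreal s" "0 \<le> s"
          by (cases "jump_time (Suc m) \<omega>") (auto simp: top_unique)
        have "s \<le> t" using m(5) s t by (simp add: ennreal_le_iff)
        have "ennreal s < jump_time (Suc (Suc m)) \<omega>"
          unfolding jump_time_Suc[of "Suc m"] s(1) using m(4) by (simp add: ennreal_add_left_cancel_less[of _ 0, simplified])
        then have "X s \<omega> = e" using elim s m by auto
        then have "X s \<omega> \<notin> A" using e B by auto
        then have "\<not> ennreal t < exit_time X A \<omega>"
          unfolding exit_time_gt_iff[where X = X and \<omega> = \<omega>, OF right_cont[OF m(1) t] t]
          using s \<open>s \<le> t\<close> by auto
        moreover have "0 < H 0 \<omega>" using m by (auto simp: past_def)
        then have "X 0 \<omega> = Y 0 \<omega>" using elim[rule_format, of 0 0] by (simp add: jump_time_def)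
        ultimately show "\<omega> \<in> ?T"
          using m by (auto simp: past_def)
      qed
    qed
    have "?T =
      {\<omega> \<in> space M. X 0 \<omega> \<in> {x0}} - {\<omega> \<in> space M. ennreal t < exit_time X A \<omega>}"
      by auto
    then show "?T \<in> sets M"
      using X_pred[of 0 "{x0}"] sets_exit_time_gt[where X = X, OF X_meas right_cont t] by auto
  qed
  finally show ?thesis .
qed

end

section \<open>The minimal solution of the forward equation\<close>

text \<open>
  The sum over the number of jumps: the masses of an explosive chain killed outside \<open>A\<close> and at its
  explosion.
\<close>

definition minimal_flow :: "('s \<Rightarrow> 's \<Rightarrow> real) \<Rightarrow> 's set \<Rightarrow> ('s \<Rightarrow> ennreal) \<Rightarrow> real \<Rightarrow> 's \<Rightarrow> ennreal" where
  "minimal_flow q A c t y = (\<Sum>k. jump_flow q A c k t y)"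

lemma inflow_mono:
  assumes "\<And>x. x \<in> A \<Longrightarrow> w x \<le> w' x"
  shows "inflow q A w y \<le> inflow q A w' y"
  unfolding inflow_def using assms by (intro nn_integral_mono) (auto intro!: mult_right_mono)

lemma inflow_suminf: "inflow q A (\<lambda>x. \<Sum>k. w k x) y = (\<Sum>k. inflow q A (w k) y)"
  unfolding inflow_def
  by (subst nn_integral_suminf[symmetric]) (auto intro!: nn_integral_cong)

lemma inflow_sum: "inflow q A (\<lambda>x. \<Sum>k\<in>K. w k x) y = (\<Sum>k\<in>K. inflow q A (w k) y)"
  unfolding inflow_def
  by (subst nn_integral_sum[symmetric]) (auto intro!: nn_integral_cong simp: sum_distrib_right)

lemma inflow_cmult: "inflow q A (\<lambda>x. c * w x) y = c * inflow q A w y"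
  unfolding inflow_def
  by (subst nn_integral_cmult[symmetric]) (auto intro!: nn_integral_cong simp: mult.assoc)

lemma borel_measurable_minimal_flow:
  assumes "countable A"
  shows "(\<lambda>t. minimal_flow q A c t y) \<in> borel_measurable borel"
  unfolding minimal_flow_def using borel_measurable_jump_flow[OF assms] by measurable

lemma jump_flow_measurable_integrand:
  assumes "countable A"
  shows "(\<lambda>s. inflow q A (jump_flow q A c k s) y * ennreal (exp (q y y * (t - s))) * indicator {0..t} s) \<in> borel_measurable lborel"
proof -
  note [measurable] = borel_measurable_inflow[OF assms borel_measurable_jump_flow[OF assms]]
  show ?thesis by measurable
qed

lemma minimal_flow_eq:
  assumes A: "countable A"
  shows "minimal_flow q A c t y = c y * ennreal (exp (q y y * t)) +
    (\<integral>\<^sup>+s\<in>{0..t}. inflow q A (minimal_flow q A c s) y * ennreal (exp (q y y * (t - s))) \<partial>lborel)"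
proof -
  have "minimal_flow q A c t y = (\<Sum>k. jump_flow q A c (Suc k) t y) + jump_flow q A c 0 t y"
    unfolding minimal_flow_def
    using suminf_offset[of "\<lambda>k. jump_flow q A c k t y" 1] by simp
  also have "(\<Sum>k. jump_flow q A c (Suc k) t y) =
    (\<integral>\<^sup>+s. (\<Sum>k. inflow q A (jump_flow q A c k s) y * ennreal (exp (q y y * (t - s))) * indicator {0..t} s) \<partial>lborel)"
    using jump_flow_measurable_integrand[OF A] by (subst nn_integral_suminf) auto
  also have "\<dots> = (\<integral>\<^sup>+s\<in>{0..t}. inflow q A (minimal_flow q A c s) y * ennreal (exp (q y y * (t - s))) \<partial>lborel)"
    unfolding minimal_flow_def inflow_suminf by simp
  finally show ?thesis by (simp add: add.commute)
qed

text \<open>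
  Every supersolution dominates the contributions of at most \<open>K\<close> jumps, by induction on \<open>K\<close>.
\<close>

lemma minimal_flow_le:
  assumes A: "countable A"
    and V: "\<And>t y. 0 \<le> t \<Longrightarrow> y \<in> A \<Longrightarrow> c y * ennreal (exp (q y y * t)) +
      (\<integral>\<^sup>+s\<in>{0..t}. inflow q A (V s) y * ennreal (exp (q y y * (t - s))) \<partial>lborel) \<le> V t y"
    and ty: "0 \<le> t" "y \<in> A"
  shows "minimal_flow q A c t y \<le> V t y"
proof -
  have "(\<Sum>k<K. jump_flow q A c k t y) \<le> V t y" for K
    using ty
  proof (induction K arbitrary: t y)
    case (Suc K)
    have "(\<Sum>k<K. jump_flow q A c (Suc k) t y) =
      (\<integral>\<^sup>+s. (\<Sum>k<K. inflow q A (jump_flow q A c k s) y * ennreal (exp (q y y * (t - s))) * indicator {0..t} s) \<partial>lborel)"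
      using jump_flow_measurable_integrand[OF A] by (subst nn_integral_sum) auto
    also have "\<dots> = (\<integral>\<^sup>+s\<in>{0..t}. inflow q A (\<lambda>x. \<Sum>k<K. jump_flow q A c k s x) y *
        ennreal (exp (q y y * (t - s))) \<partial>lborel)"
      by (simp add: inflow_sum sum_distrib_right)
    also have "\<dots> \<le> (\<integral>\<^sup>+s\<in>{0..t}. inflow q A (V s) y * ennreal (exp (q y y * (t - s))) \<partial>lborel)"
      by (intro nn_integral_mono)
        (auto split: split_indicator intro!: mult_right_mono inflow_mono Suc.IH)
    finally have step: "(\<Sum>k<K. jump_flow q A c (Suc k) t y) \<le>
      (\<integral>\<^sup>+s\<in>{0..t}. inflow q A (V s) y * ennreal (exp (q y y * (t - s))) \<partial>lborel)" .
    have "(\<Sum>k<Suc K. jump_flow q A c k t y) = jump_flow q A c 0 t y + (\<Sum>k<K. jump_flow q A c (Suc k) t y)"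
      by (rule sum.lessThan_Suc_shift)
    also have "\<dots> \<le> c y * ennreal (exp (q y y * t)) +
      (\<integral>\<^sup>+s\<in>{0..t}. inflow q A (V s) y * ennreal (exp (q y y * (t - s))) \<partial>lborel)"
      unfolding jump_flow.simps(1) by (rule add_left_mono[OF step])
    also have "\<dots> \<le> V t y" by (rule V[OF Suc.prems])
    finally show ?case .
  qed simp
  then show ?thesis
    unfolding minimal_flow_def by (intro suminf_le_const summableI) auto
qed

lemma jump_flow_superposition:
  assumes A: "countable A" and I: "finite I"
  shows "jump_flow q A (\<lambda>y. \<Sum>i\<in>I. f i * c i y) k t y = (\<Sum>i\<in>I. f i * jump_flow q A (c i) k t y)"
proof (induction k arbitrary: t y)
  case 0
  then show ?case by (simp add: sum_distrib_right mult.assoc)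
next
  case (Suc k)
  have "jump_flow q A (\<lambda>y. \<Sum>i\<in>I. f i * c i y) (Suc k) t y = (\<integral>\<^sup>+s. (\<Sum>i\<in>I. f i *
     (inflow q A (jump_flow q A (c i) k s) y * ennreal (exp (q y y * (t - s))) * indicator {0..t} s)) \<partial>lborel)"
    unfolding jump_flow.simps Suc inflow_sum inflow_cmult by (simp add: sum_distrib_right mult.assoc)
  also have "\<dots> = (\<Sum>i\<in>I. f i * jump_flow q A (c i) (Suc k) t y)"
    unfolding jump_flow.simps
    using jump_flow_measurable_integrand[OF A, of q] by (subst nn_integral_sum) (auto simp: nn_integral_cmult)
  finally show ?case .
qed

lemma minimal_flow_superposition:
  assumes "countable A" "finite I"
  shows "minimal_flow q A (\<lambda>y. \<Sum>i\<in>I. f i * c i y) t y = (\<Sum>i\<in>I. f i * minimal_flow q A (c i) t y)"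
  unfolding minimal_flow_def jump_flow_superposition[OF assms]
  by (subst suminf_sum) (auto intro: summableI)

lemma ctmc_killed_chain_path:
  assumes C: "ctmc M X S q \<mu>" and A: "A \<subseteq> S" "countable A"
    and rate: "\<And>x. x \<in> A \<Longrightarrow> q x x < 0"
    and offdiag: "\<And>x y. x \<in> A \<Longrightarrow> y \<in> S \<Longrightarrow> x \<noteq> y \<Longrightarrow> 0 \<le> q x y"
    and x0: "x0 \<in> A" "0 < pmf \<mu> x0"
  shows "\<exists>Y H. killed_chain_path M Y H S q \<mu> A x0 X"
proof -
  from C have "prob_space M" unfolding ctmc_def by blast
  from C obtain Y H where YH: "(\<forall>j. Y j \<in> M \<rightarrow>\<^sub>M count_space S)" "(\<forall>j. H j \<in> borel_measurable M)"
    "(AE \<omega> in M. \<forall>k. \<forall>t\<ge>0.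
           (\<Sum>j<k. H j \<omega>) \<le> ennreal t \<and> ennreal t < (\<Sum>j\<le>k. H j \<omega>) \<longrightarrow> X t \<omega> = Y k \<omega>)"
    "(\<forall>k. \<forall>y :: nat \<Rightarrow> 'b. \<forall>s :: nat \<Rightarrow> real.
           (\<forall>j\<le>k. y j \<in> S \<and> 0 \<le> s j) \<longrightarrow>
           \<P>(\<omega> in M. \<forall>j\<le>k. Y j \<omega> = y j \<and> H j \<omega> > ennreal (s j)) =
             pmf \<mu> (y 0) * (\<Prod>j<k. jump_prob q (y j) (y (Suc j))) *
             (\<Prod>j\<le>k. exp (q (y j) (y j) * s j)))"
    unfolding ctmc_def by blast
  have "killed_chain M Y H S q \<mu> A x0"
    by (intro killed_chain.intro killed_chain_axioms.intro)
      (use YH A rate offdiag x0 \<open>prob_space M\<close> in blast)+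
  moreover have "killed_chain_path_axioms M Y H S X"
    by (intro killed_chain_path_axioms.intro) (use C YH in \<open>unfold ctmc_def, blast\<close>)+
  ultimately show ?thesis
    by (blast intro: killed_chain_path.intro)
qed

lemma ctmc_minimal_flow_le_prob:
  assumes C: "ctmc M X S q \<mu>" and A: "A \<subseteq> S" "countable A"
    and rate: "\<And>x. x \<in> A \<Longrightarrow> q x x < 0"
    and offdiag: "\<And>x y. x \<in> A \<Longrightarrow> y \<in> S \<Longrightarrow> x \<noteq> y \<Longrightarrow> 0 \<le> q x y"
    and x0: "x0 \<in> A" and y: "y \<in> A" and t: "0 \<le> t"
  shows "ennreal (pmf \<mu> x0) * minimal_flow q A (indicator {x0}) t y \<le>
    emeasure M {\<omega> \<in> space M. X 0 \<omega> = x0 \<and> X t \<omega> = y \<and> ennreal t < exit_time X A \<omega>}"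
proof (cases "pmf \<mu> x0 = 0")
  case False
  then have "0 < pmf \<mu> x0" by (simp add: order.strict_iff_order)
  from ctmc_killed_chain_path[OF C A rate offdiag x0 this]
  obtain Y H where "killed_chain_path M Y H S q \<mu> A x0 X" by blast
  from killed_chain_path.jump_flow_le_prob[OF this y t] show ?thesis
    by (simp add: minimal_flow_def)
qed simp

lemma ctmc_exit_flow_le_prob:
  assumes C: "ctmc M X S q \<mu>" and A: "A \<subseteq> S" "countable A"
    and rate: "\<And>x. x \<in> A \<Longrightarrow> q x x < 0"
    and offdiag: "\<And>x y. x \<in> A \<Longrightarrow> y \<in> S \<Longrightarrow> x \<noteq> y \<Longrightarrow> 0 \<le> q x y"
    and x0: "x0 \<in> A" and B: "B \<subseteq> S - A" "countable B" and t: "0 \<le> t"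
  shows "ennreal (pmf \<mu> x0) *
      (\<integral>\<^sup>+e. (\<integral>\<^sup>+s\<in>{0..t}. inflow q A (minimal_flow q A (indicator {x0}) s) e \<partial>lborel) \<partial>count_space B) \<le>
    emeasure M {\<omega> \<in> space M. X 0 \<omega> = x0 \<and> \<not> ennreal t < exit_time X A \<omega>}"
proof (cases "pmf \<mu> x0 = 0")
  case False
  then have "0 < pmf \<mu> x0" by (simp add: order.strict_iff_order)
  from ctmc_killed_chain_path[OF C A rate offdiag x0 this]
  obtain Y H where "killed_chain_path M Y H S q \<mu> A x0 X" by blast
  note le = killed_chain_path.exit_flow_le_prob[OF this B t]
  note [measurable] = borel_measurable_inflow[OF A(2) borel_measurable_jump_flow[OF A(2)]]
  have "(\<Sum>k. \<integral>\<^sup>+e. (\<integral>\<^sup>+s\<in>{0..t}. inflow q A (jump_flow q A (indicator {x0}) k s) e \<partial>lborel) \<partial>count_space B) =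
    (\<integral>\<^sup>+e. (\<Sum>k. \<integral>\<^sup>+s\<in>{0..t}. inflow q A (jump_flow q A (indicator {x0}) k s) e \<partial>lborel) \<partial>count_space B)"
    by (rule nn_integral_suminf[symmetric]) simp
  also have "\<dots> = (\<integral>\<^sup>+e. (\<integral>\<^sup>+s. (\<Sum>k. inflow q A (jump_flow q A (indicator {x0}) k s) e * indicator {0..t} s) \<partial>lborel) \<partial>count_space B)"
    by (intro nn_integral_cong nn_integral_suminf[symmetric]) measurable
  also have "\<dots> = (\<integral>\<^sup>+e. (\<integral>\<^sup>+s\<in>{0..t}. inflow q A (minimal_flow q A (indicator {x0}) s) e \<partial>lborel) \<partial>count_space B)"
    unfolding minimal_flow_def inflow_suminf by simp
  finally show ?thesis using le by simp
qed simp

lemma sets_ctmc_state: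
  assumes C: "ctmc M X S q \<mu>" and t: "0 \<le> t"
  shows "{\<omega> \<in> space M. X t \<omega> \<in> B} \<in> sets M"
proof -
  have X: "X t \<in> M \<rightarrow>\<^sub>M count_space S" using C t unfolding ctmc_def by blast
  have "X t -` (B \<inter> S) \<inter> space M \<in> sets M"
    using X by (rule measurable_sets) auto
  moreover have "X t -` (B \<inter> S) \<inter> space M = {\<omega> \<in> space M. X t \<omega> \<in> B}"
    using measurable_space[OF X] by auto
  ultimately show ?thesis by simp
qed

lemma sets_ctmc_exit_time_gt:
  assumes C: "ctmc M X S q \<mu>" and t: "0 \<le> t"
  shows "{\<omega> \<in> space M. ennreal t < exit_time X A \<omega>} \<in> sets M"
  using C t by (intro sets_exit_time_gt[where S = S and X = X]) (auto simp: ctmc_def)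

text \<open>
  Every initial state \<open>y\<close> has at least its mass \<open>pmf \<mu> y\<close>, by comparison with the first state of
  the jump chain.  These masses already add up to \<open>1\<close>.
\<close>

lemma ctmc_initial_le:
  assumes C: "ctmc M X S q \<mu>" and \<mu>: "set_pmf \<mu> \<subseteq> S"
  shows "emeasure M {\<omega> \<in> space M. X 0 \<omega> = x} \<le> ennreal (pmf \<mu> x)"
proof -
  let ?X = "\<lambda>y. {\<omega> \<in> space M. X 0 \<omega> = y}"
  interpret prob_space M using C unfolding ctmc_def by blast
  from C obtain Y H where Y: "(\<forall>j. Y j \<in> M \<rightarrow>\<^sub>M count_space S)" and H: "(\<forall>j. H j \<in> borel_measurable M)"
    and path: "(AE \<omega> in M. \<forall>k. \<forall>t\<ge>0.
           (\<Sum>j<k. H j \<omega>) \<le> ennreal t \<and> ennreal t < (\<Sum>j\<le>k. H j \<omega>) \<longrightarrow> X t \<omega> = Y k \<omega>)"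
    and law: "(\<forall>k. \<forall>y :: nat \<Rightarrow> 'b. \<forall>s :: nat \<Rightarrow> real.
           (\<forall>j\<le>k. y j \<in> S \<and> 0 \<le> s j) \<longrightarrow>
           \<P>(\<omega> in M. \<forall>j\<le>k. Y j \<omega> = y j \<and> H j \<omega> > ennreal (s j)) =
             pmf \<mu> (y 0) * (\<Prod>j<k. jump_prob q (y j) (y (Suc j))) *
             (\<Prod>j\<le>k. exp (q (y j) (y j) * s j)))"
    unfolding ctmc_def by blast
  have X0: "(?X y) \<in> sets M" for y
    using sets_ctmc_state[OF C, of 0 "{y}"] by simp
  have ge: "ennreal (pmf \<mu> y) \<le> emeasure M (?X y)" if y: "y \<in> S" for y
  proof -
    have "ennreal (pmf \<mu> y) = emeasure M {\<omega> \<in> space M. Y 0 \<omega> = y \<and> 0 < H 0 \<omega>}"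
      using law[rule_format, of 0 "\<lambda>_. y" "\<lambda>_. 0"] y by (simp add: emeasure_eq_measure)
    also have "\<dots> \<le> emeasure M (?X y)"
    proof (rule emeasure_mono_AE[OF _ X0])
      show "AE \<omega> in M. \<omega> \<in> {\<omega> \<in> space M. Y 0 \<omega> = y \<and> 0 < H 0 \<omega>} \<longrightarrow> \<omega> \<in> (?X y)"
        using path
      proof eventually_elim
        case (elim \<omega>)
        from elim[rule_format, of 0 0] show ?case by auto
      qed
    qed
    finally show ?thesis .
  qed
  let ?B = "set_pmf \<mu> - {x}"
  have "emeasure (measure_pmf \<mu>) ?B = (\<integral>\<^sup>+y. ennreal (pmf \<mu> y) \<partial>count_space ?B)"
    by (rule nn_integral_pmf[symmetric])
  also have "\<dots> \<le> (\<integral>\<^sup>+y. emeasure M (?X y) \<partial>count_space ?B)"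
    using \<mu> by (intro nn_integral_mono ge) auto
  also have "\<dots> = emeasure M (\<Union>y\<in>?B. (?X y))"
    by (rule emeasure_UN_countable[symmetric]) (auto simp: disjoint_family_on_def X0)
  finally have B: "emeasure (measure_pmf \<mu>) ?B \<le> emeasure M (\<Union>y\<in>?B. (?X y))" .
  have "emeasure M (?X x) + emeasure M (\<Union>y\<in>?B. (?X y)) =
    emeasure M ((?X x) \<union> (\<Union>y\<in>?B. (?X y)))"
    by (rule plus_emeasure[OF X0]) (auto intro!: sets.countable_UN' X0)
  also have "\<dots> \<le> 1" by (rule emeasure_le_1)
  also have "1 = emeasure (measure_pmf \<mu>) ({x} \<union> ?B)"
    by (subst measure_pmf.emeasure_eq_1_AE) (auto simp: AE_measure_pmf_iff)
  also have "\<dots> = emeasure (measure_pmf \<mu>) {x} + emeasure (measure_pmf \<mu>) ?B"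
    by (rule plus_emeasure[symmetric]) auto
  finally have "emeasure M (?X x) + emeasure M (\<Union>y\<in>?B. (?X y))
    \<le> ennreal (pmf \<mu> x) + emeasure (measure_pmf \<mu>) ?B"
    by (simp add: emeasure_pmf_single)
  also have "\<dots> \<le> ennreal (pmf \<mu> x) + emeasure M (\<Union>y\<in>?B. (?X y))"
    using B by (rule add_left_mono)
  finally show ?thesis
    by (simp add: add.commute[of _ "emeasure M (\<Union>y\<in>?B. _ y)"] emeasure_eq_measure ennreal_add_left_cancel_le)
qed

section \<open>Forward equations in integral and in differential form\<close>

lemma nn_integral_eq_integral_Icc:
  fixes h :: "real \<Rightarrow> real"
  assumes h: "set_integrable lborel {a..b} h" and nonneg: "\<And>s. s \<in> {a..b} \<Longrightarrow> 0 \<le> h s"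
  shows "(\<integral>\<^sup>+s\<in>{a..b}. ennreal (h s) \<partial>lborel) = ennreal (integral {a..b} h)"
proof -
  have "(\<integral>\<^sup>+s\<in>{a..b}. ennreal (h s) \<partial>lborel) =
    (\<integral>\<^sup>+s. ennreal (indicat_real {a..b} s *\<^sub>R h s) \<partial>lborel)"
    by (intro nn_integral_cong) (auto split: split_indicator)
  also have "\<dots> = ennreal (\<integral>s. indicat_real {a..b} s *\<^sub>R h s \<partial>lborel)"
    using h nonneg unfolding set_integrable_def
    by (intro nn_integral_eq_integral) (auto split: split_indicator)
  also have "(\<integral>s. indicat_real {a..b} s *\<^sub>R h s \<partial>lborel) = integral {a..b} h"
    using set_borel_integral_eq_integral(2)[OF h] by (simp add: set_lebesgue_integral_def)
  finally show ?thesis .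
qed

lemma at_within_Icc_eq_atLeast:
  fixes t T :: real
  assumes "t < T"
  shows "at t within {a..T} = at t within {a..}"
  by (rule at_within_nhd[where S = "{..<T}"]) (use assms in auto)

text \<open>
  The inflow \<open>g\<close> is only assumed to be bounded: for a system of such equations the continuity of
  the inflows is a consequence of this lemma, and it is needed for \<open>mild_imp_derivative\<close>.
\<close>

lemma mild_imp_continuous:
  fixes f g :: "real \<Rightarrow> real"
  assumes f: "\<And>t. 0 \<le> t \<Longrightarrow> 0 \<le> f t" and c: "0 \<le> c"
    and g: "g \<in> borel_measurable borel" "\<And>s. 0 \<le> s \<Longrightarrow> 0 \<le> g s" "\<And>s. 0 \<le> s \<Longrightarrow> g s \<le> B"
    and mild: "\<And>t. 0 \<le> t \<Longrightarrow> ennreal (f t) = ennreal (c * exp (- l * t)) +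
      (\<integral>\<^sup>+s\<in>{0..t}. ennreal (g s) * ennreal (exp (- l * (t - s))) \<partial>lborel)"
  shows "\<And>t. 0 \<le> t \<Longrightarrow> f t = exp (- l * t) * (c + integral {0..t} (\<lambda>s. g s * exp (l * s)))"
    and "continuous_on {0..} f"
proof -
  let ?h = "\<lambda>s. g s * exp (l * s)"
  have h: "set_integrable lborel {0..t} ?h" for t
    unfolding set_integrable_def
  proof (rule integrableI_bounded_set_indicator)
    show "AE s in lborel. s \<in> {0..t} \<longrightarrow> norm (?h s) \<le> B * exp (\<bar>l\<bar> * t)"
    proof (intro AE_I2 impI)
      fix s assume s: "s \<in> {0..t}"
      have "l * s \<le> \<bar>l\<bar> * t" using s by (intro mult_mono) auto
      then have "?h s \<le> B * exp (\<bar>l\<bar> * t)"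
        using s g(2,3)[of s] by (intro mult_mono) (auto intro: order.trans)
      then show "norm (?h s) \<le> B * exp (\<bar>l\<bar> * t)" using s g(2)[of s] by simp
    qed
  qed (use g in \<open>auto simp: emeasure_lborel_Icc_eq\<close>)
  show eq: "f t = exp (- l * t) * (c + integral {0..t} ?h)" if t: "0 \<le> t" for t
  proof -
    have I: "0 \<le> integral {0..t} ?h"
      using set_borel_integral_eq_integral(1)[OF h[of t]] g(2) by (intro integral_nonneg) auto
    have "(\<integral>\<^sup>+s\<in>{0..t}. ennreal (g s) * ennreal (exp (- l * (t - s))) \<partial>lborel) =
      (\<integral>\<^sup>+s. ennreal (exp (- l * t)) * (ennreal (?h s) * indicator {0..t} s) \<partial>lborel)"
    proof (intro nn_integral_cong)
      fix s
      have "exp (- l * (t - s)) = exp (- l * t) * exp (l * s)"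
        by (simp add: exp_add[symmetric] algebra_simps)
      then show "ennreal (g s) * ennreal (exp (- l * (t - s))) * indicator {0..t} s =
        ennreal (exp (- l * t)) * (ennreal (?h s) * indicator {0..t} s)"
        by (simp add: ennreal_mult'' mult_ac)
    qed
    also have "\<dots> = ennreal (exp (- l * t)) * ennreal (integral {0..t} ?h)"
      using g nn_integral_eq_integral_Icc[OF h[of t]] by (subst nn_integral_cmult) auto
    finally have "ennreal (f t) = ennreal (exp (- l * t) * (c + integral {0..t} ?h))"
      using mild[OF t] I c
      by (simp add: ennreal_mult'[symmetric] ennreal_plus[symmetric] distrib_left mult.commute del: ennreal_plus)
    then show ?thesis using f[OF t] I c by simp
  qed
  show "continuous_on {0..} f"
    unfolding continuous_on_eq_continuous_within
  proof
    fix t :: real assume t: "t \<in> {0..}"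
    have "continuous_on {0..t+1} (\<lambda>t. exp (- l * t) * (c + integral {0..t} ?h))"
      using set_borel_integral_eq_integral(1)[OF h[of "t+1"]]
      by (intro continuous_intros indefinite_integral_continuous_1)
    then have "continuous_on {0..t+1} f"
      by (rule continuous_on_eq) (simp add: eq)
    then have "continuous (at t within {0..t+1}) f"
      using t by (auto simp: continuous_on_eq_continuous_within)
    then show "continuous (at t within {0..}) f"
      by (simp add: at_within_Icc_eq_atLeast)
  qed
qed

lemma mild_imp_derivative:
  fixes f g :: "real \<Rightarrow> real"
  assumes f: "\<And>t. 0 \<le> t \<Longrightarrow> 0 \<le> f t" and c: "0 \<le> c"
    and g: "g \<in> borel_measurable borel" "\<And>s. 0 \<le> s \<Longrightarrow> 0 \<le> g s" "\<And>s. 0 \<le> s \<Longrightarrow> g s \<le> B"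
    and mild: "\<And>t. 0 \<le> t \<Longrightarrow> ennreal (f t) = ennreal (c * exp (- l * t)) +
      (\<integral>\<^sup>+s\<in>{0..t}. ennreal (g s) * ennreal (exp (- l * (t - s))) \<partial>lborel)"
    and gc: "continuous_on {0..} g" and t: "0 \<le> t"
  shows "(f has_real_derivative g t - l * f t) (at t within {0..})"
proof -
  let ?h = "\<lambda>s. g s * exp (l * s)"
  have eq: "f t = exp (- l * t) * (c + integral {0..t} ?h)" if "0 \<le> t" for t
    using f c g mild that by (intro mild_imp_continuous(1)[where f = f and g = g and l = l and c = c and B = B]) auto
  have "continuous_on {0..t+1} ?h"
    by (intro continuous_intros continuous_on_subset[OF gc]) auto
  then have "((\<lambda>t. integral {0..t} ?h) has_real_derivative ?h t) (at t within {0..t+1})"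
    using t by (intro integral_has_real_derivative) auto
  then have "((\<lambda>t. integral {0..t} ?h) has_real_derivative ?h t) (at t within {0..})"
    by (simp add: at_within_Icc_eq_atLeast)
  then have "((\<lambda>t. exp (- l * t) * (c + integral {0..t} ?h)) has_real_derivative
    exp (- l * t) * ?h t - l * (exp (- l * t) * (c + integral {0..t} ?h))) (at t within {0..})"
    by (auto intro!: derivative_eq_intros simp: algebra_simps)
  then have "((\<lambda>t. exp (- l * t) * (c + integral {0..t} ?h)) has_real_derivative
    g t - l * f t) (at t within {0..})"
  proof -
    have "exp (- l * t) * ?h t = g t" by (simp add: exp_minus)
    with \<open>(_ has_real_derivative exp (- l * t) * ?h t - _) _\<close> show ?thesis
      by (simp only: eq[OF t, symmetric])
  qed
  then show ?thesis
    by (rule has_field_derivative_transform_within[where d = 1]) (use eq t in auto)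
qed

lemma derivative_imp_mild:
  fixes v g :: "real \<Rightarrow> real"
  assumes v: "\<And>t. 0 \<le> t \<Longrightarrow> (v has_real_derivative g t - l * v t) (at t within {0..})"
    and g: "continuous_on {0..} g" "\<And>t. 0 \<le> t \<Longrightarrow> 0 \<le> g t"
    and v0: "0 \<le> v 0" and t: "0 \<le> t"
  shows "ennreal (v t) = ennreal (v 0) * ennreal (exp (- l * t)) +
    (\<integral>\<^sup>+s\<in>{0..t}. ennreal (g s) * ennreal (exp (- l * (t - s))) \<partial>lborel)"
proof -
  let ?h = "\<lambda>s. g s * exp (- l * (t - s))"
  have cont: "continuous_on {0..t} ?h"
    by (intro continuous_intros continuous_on_subset[OF g(1)]) auto
  have si: "set_integrable lborel {0..t} ?h"
    by (rule borel_integrable_atLeastAtMost'[OF cont])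
  have "(?h has_integral v t * exp (- l * (t - t)) - v 0 * exp (- l * (t - 0))) {0..t}"
  proof (rule fundamental_theorem_of_calculus[OF t])
    fix s assume s: "s \<in> {0..t}"
    then have "(v has_real_derivative g s - l * v s) (at s within {0..t})"
      using v[of s] by (auto intro: has_field_derivative_subset)
    then have "((\<lambda>s. v s * exp (- l * (t - s))) has_real_derivative ?h s) (at s within {0..t})"
      by (auto intro!: derivative_eq_intros simp: algebra_simps)
    then show "((\<lambda>s. v s * exp (- l * (t - s))) has_vector_derivative ?h s) (at s within {0..t})"
      by (simp add: has_real_derivative_iff_has_vector_derivative)
  qed
  then have I: "integral {0..t} ?h = v t - v 0 * exp (- l * t)"
    by (simp add: integral_unique)
  have "0 \<le> integral {0..t} ?h"
    using set_borel_integral_eq_integral(1)[OF si] g(2) by (intro integral_nonneg) auto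
  moreover have "(\<integral>\<^sup>+s\<in>{0..t}. ennreal (g s) * ennreal (exp (- l * (t - s))) \<partial>lborel) =
    (\<integral>\<^sup>+s\<in>{0..t}. ennreal (?h s) \<partial>lborel)"
    by (intro nn_integral_cong) (simp add: ennreal_mult'')
  moreover have "(\<integral>\<^sup>+s\<in>{0..t}. ennreal (?h s) \<partial>lborel) = ennreal (integral {0..t} ?h)"
    using g(2) by (intro nn_integral_eq_integral_Icc[OF si]) auto
  ultimately have "ennreal (v 0) * ennreal (exp (- l * t)) +
      (\<integral>\<^sup>+s\<in>{0..t}. ennreal (g s) * ennreal (exp (- l * (t - s))) \<partial>lborel) =
      ennreal (v 0 * exp (- l * t) + integral {0..t} ?h)"
    using v0 by (simp add: ennreal_plus ennreal_mult'')
  then show ?thesis by (simp only: I) simp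
qed

lemma nonincreasing_on_atLeast_0:
  fixes F :: "real \<Rightarrow> real"
  assumes F: "\<And>s. 0 \<le> s \<Longrightarrow> (F has_real_derivative F' s) (at s within {0..})"
    and F': "\<And>s. 0 \<le> s \<Longrightarrow> F' s \<le> 0" and t: "0 \<le> t"
  shows "F t \<le> F 0"
  using t
  proof (rule DERIV_nonpos_imp_decreasing_open)
    fix s :: real assume s: "0 < s" "s < t"
    then have "at s within {0..} = at s" by (intro at_within_interior) simp
    then show "\<exists>y. (F has_real_derivative y) (at s) \<and> y \<le> 0"
      using F[of s] F'[of s] s by auto
  next
    show "continuous_on {0..t} F"
      by (intro DERIV_continuous_on[where D = F'] has_field_derivative_subset[OF F]) auto
qed

section \<open>The stationary profile and the motion of one cluster\<close>

locale bd_parameters =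
  fixes a b :: "nat \<Rightarrow> real" and z :: real and n :: nat
  assumes z_pos: "0 < z" and a_pos: "\<And>i. 1 \<le> i \<Longrightarrow> 0 < a i" and b_pos: "\<And>i. 2 \<le> i \<Longrightarrow> 0 < b i"
    and n_ge: "2 \<le> n"
begin

abbreviation "rate \<equiv> cluster_rate a b z"
abbreviation "f \<equiv> bd_f a b z n"
abbreviation "J \<equiv> bd_J a b z n"
abbreviation "w i \<equiv> bd_Q a b i * z ^ i"
abbreviation "sizes \<equiv> {2..n}"

lemma Q_pos: "0 < bd_Q a b i"
  unfolding bd_Q_def using a_pos b_pos by (intro divide_pos_pos prod_pos) auto

lemma w_pos: "0 < w i"
  using Q_pos z_pos by simp

lemma Q_Suc: "1 \<le> i \<Longrightarrow> b (i + 1) * bd_Q a b (i + 1) = a i * bd_Q a b i"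
proof -
  assume i: "1 \<le> i"
  have "{1..<i+1} = insert i {1..<i}" "{2..i+1} = insert (i+1) {2..i}" using i by auto
  moreover have "b (i+1) \<noteq> 0" using b_pos[of "i+1"] i by auto
  ultimately show ?thesis by (simp add: bd_Q_def)
qed

lemma J_pos: "0 < J"
  unfolding bd_J_def using n_ge a_pos Q_pos z_pos
  by (intro positive_imp_inverse_positive sum_pos) auto

text \<open>
  The reason for the form of \<open>f\<close>: it is the profile through which, with size \<open>1\<close> held at \<open>z\<close> and
  size \<open>n + 1\<close> held at \<open>0\<close>, the same flux \<open>J\<close> passes from every size to the next.
\<close>

lemma flux_f: "i \<in> {1..n} \<Longrightarrow> a i * z * f i - b (i + 1) * f (i + 1) = J"
proof -
  assume i: "i \<in> {1..n}"
  have "{i..n} = insert i {i+1..n}" using i by auto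
  then have phi: "(\<Sum>k=i..n. 1 / (a k * bd_Q a b k * z ^ (k + 1))) =
    1 / (a i * bd_Q a b i * z ^ (i + 1)) + (\<Sum>k=i+1..n. 1 / (a k * bd_Q a b k * z ^ (k + 1)))"
    by simp
  define S where "S = (\<Sum>k=i+1..n. 1 / (a k * bd_Q a b k * z ^ (k + 1)))"
  have "b (i + 1) * f (i + 1) = J * (b (i + 1) * bd_Q a b (i + 1)) * z ^ (i + 1) * S"
    by (simp add: bd_f_def S_def)
  also have "b (i + 1) * bd_Q a b (i + 1) = a i * bd_Q a b i"
    using Q_Suc i by auto
  finally have "b (i + 1) * f (i + 1) = J * (a i * bd_Q a b i * z ^ (i + 1)) * S"
    by simp
  moreover have "f i = J * bd_Q a b i * z ^ i * (1 / (a i * bd_Q a b i * z ^ (i + 1)) + S)"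
    unfolding S_def phi[symmetric] by (simp add: bd_f_def)
  then have "a i * z * f i = J * (a i * bd_Q a b i * z ^ (i + 1)) * (1 / (a i * bd_Q a b i * z ^ (i + 1)) + S)"
    by simp
  ultimately have "a i * z * f i - b (i + 1) * f (i + 1) =
    J * (a i * bd_Q a b i * z ^ (i + 1)) * (1 / (a i * bd_Q a b i * z ^ (i + 1)))"
    by (simp add: ring_distribs)
  also have "\<dots> = J"
    using a_pos[of i] Q_pos[of i] z_pos i by simp
  finally show ?thesis .
qed

lemma f_1: "f 1 = z"
proof -
  have "(\<Sum>k=1..n. 1 / (a k * bd_Q a b k * z ^ (k + 1))) = 1 / J"
    by (simp add: bd_J_def inverse_eq_divide)
  then show ?thesis
    unfolding bd_f_def using J_pos by (simp add: bd_Q_def)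
qed

lemma f_pos: "i \<in> {1..n} \<Longrightarrow> 0 < f i"
  unfolding bd_f_def using J_pos a_pos Q_pos z_pos
  by (intro mult_pos_pos sum_pos) auto

lemma f_le_w: "1 \<le> i \<Longrightarrow> f i \<le> w i"
proof -
  assume i: "1 \<le> i"
  have "(\<Sum>k=i..n. 1 / (a k * bd_Q a b k * z ^ (k + 1))) \<le> (\<Sum>k=1..n. 1 / (a k * bd_Q a b k * z ^ (k + 1)))"
    using i a_pos Q_pos z_pos by (intro sum_mono2) (auto simp: less_imp_le)
  also have "\<dots> = 1 / J" by (simp add: bd_J_def inverse_eq_divide)
  finally have "J * (\<Sum>k=i..n. 1 / (a k * bd_Q a b k * z ^ (k + 1))) \<le> 1"
    using J_pos by (simp add: field_simps)
  then show ?thesis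
    using mult_left_mono[of "J * (\<Sum>k=i..n. 1 / (a k * bd_Q a b k * z ^ (k + 1)))" 1 "w i"] w_pos[of i]
    by (simp add: bd_f_def mult_ac)
qed

lemma f_Suc_n: "f (Suc n) = 0"
  by (simp add: bd_f_def)

lemma sum_rate_column:
  assumes "j \<in> {1..n}"
  shows "(\<Sum>l\<in>sizes. u l * rate l j) =
    (if 3 \<le> j then u (j - 1) * (a (j - 1) * z) else 0) + (if j < n then u (j + 1) * b (j + 1) else 0)
     - (if 2 \<le> j then u j * (a j * z + b j) else 0)"
proof -
  have "(\<Sum>l\<in>sizes. u l * rate l j) = (\<Sum>l\<in>sizes. (if l = j - 1 then (if 3 \<le> j then u l * (a l * z) else 0) else 0)
    + (if l = j + 1 then u l * b l else 0) - (if l = j then u l * (a l * z + b l) else 0))"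
    using assms by (intro sum.cong) (auto simp: cluster_rate_def algebra_simps)
  then show ?thesis
    using assms by (auto simp: sum.distrib sum_subtractf sum.delta algebra_simps)
qed

lemma sum_rate_row:
  assumes "l \<in> sizes"
  shows "(\<Sum>j=1..n. rate l j * u j) =
    b l * u (l - 1) - (a l * z + b l) * u l + (if l < n then a l * z * u (l + 1) else 0)"
proof -
  have "(\<Sum>j=1..n. rate l j * u j) = (\<Sum>j=1..n. (if j = l - 1 then b l * u j else 0)
     - (if j = l then (a l * z + b l) * u j else 0) + (if j = l + 1 then a l * z * u j else 0))"
    using assms by (intro sum.cong) (auto simp: cluster_rate_def algebra_simps)
  then show ?thesis
    using assms by (auto simp: sum.distrib sum_subtractf sum.delta algebra_simps)
qed

lemma f_stationary:
  assumes "j \<in> sizes"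
  shows "(\<Sum>l\<in>sizes. f l * rate l j) = - (if j = 2 then a 1 * z * z else 0)"
proof -
  have j1: "a (j - 1) * z * f (j - 1) - b j * f j = J"
  proof -
    have "j - 1 \<in> {1..n}" "j - 1 + 1 = j" using assms by auto
    with flux_f[of "j - 1"] show ?thesis by simp
  qed
  have j2: "a j * z * f j - (if j < n then b (j + 1) * f (j + 1) else 0) = J"
    using flux_f[of j] assms f_Suc_n by (cases "j = n") auto
  show ?thesis
  proof (cases "j = 2")
    case True
    then show ?thesis
      using j1 j2 assms f_1 by (subst sum_rate_column) (auto simp: algebra_simps)
  next
    case False
    then show ?thesis
      using j1 j2 assms by (subst sum_rate_column) (auto simp: algebra_simps)
  qed
qed

lemma inflow_cluster:
  assumes "j \<in> sizes" and "\<And>l. l \<in> sizes \<Longrightarrow> 0 \<le> u l"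
  shows "inflow rate sizes (\<lambda>l. ennreal (u l)) j = ennreal (\<Sum>l\<in>sizes. if l = j then 0 else u l * rate l j)"
proof -
  have "inflow rate sizes (\<lambda>l. ennreal (u l)) j = (\<Sum>l\<in>sizes. if l = j then 0 else ennreal (u l) * ennreal (rate l j))"
    unfolding inflow_def by (simp add: nn_integral_count_space_finite)
  also have "\<dots> = (\<Sum>l\<in>sizes. ennreal (if l = j then 0 else u l * rate l j))"
    using assms by (intro sum.cong) (auto simp: ennreal_mult')
  also have "\<dots> = ennreal (\<Sum>l\<in>sizes. if l = j then 0 else u l * rate l j)"
    using assms a_pos b_pos z_pos
    by (intro sum_ennreal) (auto simp: cluster_rate_def less_imp_le)
  finally show ?thesis .
qed

lemma rate_diag: "j \<in> sizes \<Longrightarrow> rate j j = - (a j * z + b j)"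
  by (auto simp: cluster_rate_def)

lemma rate_diag_neg:
  assumes "j \<in> sizes"
  shows "rate j j < 0"
proof -
  have "0 < a j * z" "0 < b j" using assms a_pos[of j] b_pos[of j] z_pos by auto
  then show ?thesis using assms by (simp add: rate_diag)
qed

lemma rate_offdiag: "l \<noteq> j \<Longrightarrow> 0 \<le> rate l j"
  using a_pos[of l] b_pos[of l] z_pos by (auto simp: cluster_rate_def)

lemma sum_rate_split:
  assumes "j \<in> sizes"
  shows "(\<Sum>l\<in>sizes. u l * rate l j) = (\<Sum>l\<in>sizes. if l = j then 0 else u l * rate l j) - (- rate j j) * u j"
proof -
  have "(\<Sum>l\<in>sizes. u l * rate l j) =
    (\<Sum>l\<in>sizes. (if l = j then 0 else u l * rate l j) + (if l = j then u l * rate l j else 0))"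
    by (intro sum.cong) auto
  also have "\<dots> = (\<Sum>l\<in>sizes. if l = j then 0 else u l * rate l j) + u j * rate j j"
    using assms by (simp add: sum.distrib sum.delta)
  finally show ?thesis by (simp add: mult.commute)
qed

text \<open>
  The profile \<open>f\<close> is stationary in the presence of immigration, hence a supersolution without it.
  This bounds the flow of one cluster and makes it finite.
\<close>

lemma f_supersolution:
  assumes c: "\<And>j. j \<in> sizes \<Longrightarrow> c j \<le> ennreal (K * f j)" and K: "0 \<le> K" and j: "j \<in> sizes" and t: "0 \<le> t"
  shows "minimal_flow rate sizes c t j \<le> ennreal (K * f j)"
proof (rule minimal_flow_le[where V = "\<lambda>_ j. ennreal (K * f j)"])
  fix t :: real and j assume t: "0 \<le> t" and j: "j \<in> sizes"
  let ?l = "- rate j j" and ?g = "\<Sum>l\<in>sizes. if l = j then 0 else (K * f l) * rate l j"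
  have l: "0 < ?l" using rate_diag_neg[OF j] by simp
  have fnn: "0 \<le> K * f l" if "l \<in> sizes" for l using f_pos[of l] K that by (auto simp: less_imp_le)
  have "?g - ?l * (K * f j) = K * (\<Sum>l\<in>sizes. f l * rate l j)"
    using sum_rate_split[OF j, of "\<lambda>l. K * f l"] by (simp add: sum_distrib_left mult.assoc)
  also have "\<dots> \<le> 0"
    unfolding f_stationary[OF j] using K a_pos[of 1] z_pos by (auto simp: mult_nonneg_nonneg)
  finally have g: "?g \<le> ?l * (K * f j)" by simp
  have inflow: "inflow rate sizes (\<lambda>j. ennreal (K * f j)) j = ennreal ?g"
    by (rule inflow_cluster) (use j fnn in auto)
  have "c j * ennreal (exp (rate j j * t)) +
      (\<integral>\<^sup>+s\<in>{0..t}. inflow rate sizes (\<lambda>j. ennreal (K * f j)) j * ennreal (exp (rate j j * (t - s))) \<partial>lborel)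
    \<le> ennreal (K * f j) * ennreal (exp (- ?l * t)) +
      (\<integral>\<^sup>+s\<in>{0..t}. ennreal (?l * (K * f j)) * ennreal (exp (- ?l * (t - s))) \<partial>lborel)"
    unfolding inflow
    unfolding minus_minus using c[OF j] g
    by (intro add_mono mult_right_mono nn_integral_mono) (auto intro: ennreal_leI)
  also have "\<dots> = ennreal (K * f j)"
    using l fnn[OF j] t
    by (intro derivative_imp_mild[symmetric, where v = "\<lambda>_. K * f j" and g = "\<lambda>_. ?l * (K * f j)"])
      (auto simp: mult_nonpos_nonneg)
  finally show "c j * ennreal (exp (rate j j * t)) +
      (\<integral>\<^sup>+s\<in>{0..t}. inflow rate sizes (\<lambda>j. ennreal (K * f j)) j * ennreal (exp (rate j j * (t - s))) \<partial>lborel)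
    \<le> ennreal (K * f j)" .
qed (use j t in auto)

text \<open>
  The probability that a cluster of initial size \<open>i\<close> has size \<open>j\<close> at time \<open>t\<close> and has been in
  \<open>{2..n}\<close> until then.
\<close>

definition p :: "nat \<Rightarrow> nat \<Rightarrow> real \<Rightarrow> real" where
  "p i j t = enn2real (minimal_flow rate sizes (indicator {i}) t j)"

lemma p_flow:
  assumes "i \<in> sizes" "j \<in> sizes" "0 \<le> t"
  shows "ennreal (p i j t) = minimal_flow rate sizes (indicator {i}) t j" "p i j t \<le> f j / f i"
proof -
  have "minimal_flow rate sizes (indicator {i}) t j \<le> ennreal (1 / f i * f j)"
    by (rule f_supersolution)
      (use assms f_pos[of i] in \<open>auto split: split_indicator\<close>)
  then show "p i j t \<le> f j / f i" "ennreal (p i j t) = minimal_flow rate sizes (indicator {i}) t j"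
    using f_pos[of i] f_pos[of j] assms unfolding p_def
    by (auto simp: ennreal_enn2real_if top_unique enn2real_leI less_imp_le)
qed

lemma p_nonneg: "0 \<le> p i j t"
  by (simp add: p_def)

lemma p_mild:
  assumes i: "i \<in> sizes" and j: "j \<in> sizes" and t: "0 \<le> t"
  shows "ennreal (p i j t) = ennreal ((if i = j then 1 else 0) * exp (- (- rate j j) * t)) +
    (\<integral>\<^sup>+s\<in>{0..t}. ennreal (\<Sum>l\<in>sizes. if l = j then 0 else p i l s * rate l j) *
       ennreal (exp (- (- rate j j) * (t - s))) \<partial>lborel)"
proof -
  have "ennreal (p i j t) = indicator {i} j * ennreal (exp (rate j j * t)) +
    (\<integral>\<^sup>+s\<in>{0..t}. inflow rate sizes (minimal_flow rate sizes (indicator {i}) s) j *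
       ennreal (exp (rate j j * (t - s))) \<partial>lborel)"
    unfolding p_flow(1)[OF assms] by (rule minimal_flow_eq) simp
  also have "(\<integral>\<^sup>+s\<in>{0..t}. inflow rate sizes (minimal_flow rate sizes (indicator {i}) s) j *
       ennreal (exp (rate j j * (t - s))) \<partial>lborel) =
    (\<integral>\<^sup>+s\<in>{0..t}. ennreal (\<Sum>l\<in>sizes. if l = j then 0 else p i l s * rate l j) *
       ennreal (exp (rate j j * (t - s))) \<partial>lborel)"
  proof (intro nn_integral_cong)
    fix s
    have "inflow rate sizes (minimal_flow rate sizes (indicator {i}) s) j =
      inflow rate sizes (\<lambda>l. ennreal (p i l s)) j" if "0 \<le> s"
      unfolding inflow_def using i that by (intro nn_integral_cong) (auto simp: p_flow(1))
    then show "inflow rate sizes (minimal_flow rate sizes (indicator {i}) s) j *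
       ennreal (exp (rate j j * (t - s))) * indicator {0..t} s =
      ennreal (\<Sum>l\<in>sizes. if l = j then 0 else p i l s * rate l j) *
       ennreal (exp (rate j j * (t - s))) * indicator {0..t} s"
      using j by (auto simp: inflow_cluster p_nonneg split: split_indicator)
  qed
  finally show ?thesis by (simp split: split_indicator)
qed

lemma p_derivative_sizes:
  assumes i: "i \<in> sizes" and j: "j \<in> sizes" and t: "0 \<le> t"
  shows "(p i j has_real_derivative (\<Sum>l\<in>sizes. p i l t * rate l j)) (at t within {0..})"
    and "continuous_on {0..} (p i j)"
proof -
  define g where "g j s = (\<Sum>l\<in>sizes. if l = j then 0 else p i l s * rate l j)" for j s
  have meas: "(\<lambda>s. p i l s) \<in> borel_measurable borel" for l
    unfolding p_def using borel_measurable_minimal_flow[of sizes rate "indicator {i}"] by measurable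
  have g1: "(\<lambda>s. g j s) \<in> borel_measurable borel" for j
    unfolding g_def using meas by (intro borel_measurable_sum) auto
  have g2: "0 \<le> g j s" for j s
    unfolding g_def using rate_offdiag by (intro sum_nonneg) (auto simp: p_nonneg)
  have g3: "g j s \<le> (\<Sum>l\<in>sizes. if l = j then 0 else f l / f i * rate l j)" if "0 \<le> s" for j s
    unfolding g_def using p_flow(2)[OF i _ that] rate_offdiag by (intro sum_mono) (auto intro!: mult_right_mono simp del: times_divide_eq_left)
  have mild: "ennreal (p i j t) = ennreal ((if i = j then 1 else 0) * exp (- (- rate j j) * t)) +
    (\<integral>\<^sup>+s\<in>{0..t}. ennreal (g j s) * ennreal (exp (- (- rate j j) * (t - s))) \<partial>lborel)"
    if "j \<in> sizes" "0 \<le> t" for j t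
    unfolding g_def by (rule p_mild[OF i that])
  have cont: "continuous_on {0..} (p i j)" if "j \<in> sizes" for j
    by (rule mild_imp_continuous(2)[OF p_nonneg _ g1 g2 g3 mild[OF that]]) auto
  then show "continuous_on {0..} (p i j)" using j .
  have "continuous_on {0..} (\<lambda>s. if l = j then 0 else p i l s * rate l j)" if "l \<in> sizes" for l
    by (cases "l = j") (use cont[OF that] in \<open>auto intro!: continuous_intros\<close>)
  then have "continuous_on {0..} (g j)"
    unfolding g_def by (intro continuous_on_sum)
  then have "(p i j has_real_derivative g j t - (- rate j j) * p i j t) (at t within {0..})"
    by (intro mild_imp_derivative[OF p_nonneg _ g1 g2 g3 mild[OF j] _ t]) auto
  then show "(p i j has_real_derivative (\<Sum>l\<in>sizes. p i l t * rate l j)) (at t within {0..})"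
    unfolding g_def sum_rate_split[OF j] .
qed

text \<open>
  Here the absorbing size \<open>1\<close>, which is fed by size \<open>2\<close> only, is included.
\<close>

definition P :: "nat \<Rightarrow> nat \<Rightarrow> real \<Rightarrow> real" where
  "P i j t = (if j = 1 then integral {0..t} (\<lambda>s. b 2 * p i 2 s) else p i j t)"

lemma P_sizes: "j \<in> sizes \<Longrightarrow> P i j = p i j"
  by (auto simp: P_def fun_eq_iff)

lemma P_derivative:
  assumes i: "i \<in> sizes" and j: "j \<in> {1..n}" and t: "0 \<le> t"
  shows "(P i j has_real_derivative (\<Sum>l\<in>sizes. P i l t * rate l j)) (at t within {0..})"
proof (cases "j = 1")
  case False
  then have "j \<in> sizes" using j by auto
  then show ?thesis using p_derivative_sizes(1)[OF i _ t, of j] by (simp add: P_sizes)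
next
  case True
  have "continuous_on {0..t+1} (\<lambda>s. b 2 * p i 2 s)"
    using n_ge by (intro continuous_intros continuous_on_subset[OF p_derivative_sizes(2)[OF i]]) auto
  then have "((\<lambda>t. integral {0..t} (\<lambda>s. b 2 * p i 2 s)) has_real_derivative b 2 * p i 2 t) (at t within {0..t+1})"
    using t by (intro integral_has_real_derivative) auto
  then have "(P i 1 has_real_derivative b 2 * p i 2 t) (at t within {0..})"
    unfolding P_def by (simp add: at_within_Icc_eq_atLeast)
  moreover have "(\<Sum>l\<in>sizes. P i l t * rate l 1) = b 2 * p i 2 t"
    using n_ge by (subst sum_rate_column) (auto simp: P_def numeral_2_eq_2 mult.commute)
  ultimately show ?thesis using True by simp
qed

lemma P_0: "i \<in> sizes \<Longrightarrow> j \<in> {1..n} \<Longrightarrow> P i j 0 = (if i = j then 1 else 0)"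
proof -
  assume i: "i \<in> sizes" and j: "j \<in> {1..n}"
  show ?thesis
  proof (cases "j = 1")
    case False
    then have js: "j \<in> sizes" using j by auto
    have null: "AE s in lborel. s \<noteq> (0::real)" by (rule AE_lborel_singleton)
    have "(\<integral>\<^sup>+s\<in>{0..0}. ennreal (\<Sum>l\<in>sizes. if l = j then 0 else p i l s * rate l j) *
       ennreal (exp (- (- rate j j) * (0 - s))) \<partial>lborel) = (\<integral>\<^sup>+s. 0 \<partial>(lborel :: real measure))"
      by (rule nn_integral_cong_AE) (use null in eventually_elim, auto)
    then show ?thesis
      using p_mild[OF i js order.refl] p_nonneg[of i j 0] js by (auto simp: P_sizes split: if_splits)
  qed (use i in \<open>auto simp: P_def\<close>)
qed

lemma P_nonneg: "i \<in> sizes \<Longrightarrow> 0 \<le> t \<Longrightarrow> 0 \<le> P i j t"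
proof -
  assume i: "i \<in> sizes" and t: "0 \<le> t"
  have "continuous_on {0..t} (\<lambda>s. b 2 * p i 2 s)"
    using n_ge by (intro continuous_intros continuous_on_subset[OF p_derivative_sizes(2)[OF i]]) auto
  then have "0 \<le> integral {0..t} (\<lambda>s. b 2 * p i 2 s)"
    using b_pos[of 2] by (intro integral_nonneg integrable_continuous_real) (auto simp: p_nonneg)
  then show ?thesis by (simp add: P_def p_nonneg)
qed

lemma P_sum_le_1:
  assumes i: "i \<in> sizes" and t: "0 \<le> t"
  shows "(\<Sum>j=1..n. P i j t) \<le> 1"
proof -
  have D: "((\<lambda>t. \<Sum>j=1..n. P i j t) has_real_derivative - (a n * z * P i n s)) (at s within {0..})"
    if "0 \<le> s" for s
  proof -
    have "((\<lambda>t. \<Sum>j=1..n. P i j t) has_real_derivative (\<Sum>j=1..n. \<Sum>l\<in>sizes. P i l s * rate l j)) (at s within {0..})"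
      by (intro DERIV_sum P_derivative[OF i _ that]) auto
    moreover have "(\<Sum>j=1..n. \<Sum>l\<in>sizes. P i l s * rate l j) = (\<Sum>l\<in>sizes. P i l s * (\<Sum>j=1..n. rate l j * 1))"
      by (subst sum.swap) (simp add: sum_distrib_left)
    moreover have "\<dots> = (\<Sum>l\<in>sizes. if l = n then - (a n * z * P i n s) else 0)"
      by (intro sum.cong refl, subst sum_rate_row) auto
    moreover have "\<dots> = - (a n * z * P i n s)"
      using n_ge by (subst sum.delta) auto
    ultimately show ?thesis by simp
  qed
  have "(\<Sum>j=1..n. P i j t) \<le> (\<Sum>j=1..n. P i j 0)"
    by (rule nonincreasing_on_atLeast_0[OF D _ t])
      (use a_pos[of n] z_pos P_nonneg[OF i] n_ge in auto)
  also have "\<dots> = 1"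
    using i by (simp add: P_0 sum.delta)
  finally show ?thesis .
qed

end

context bd_parameters begin

section \<open>Creation and annihilation of clusters\<close>

abbreviation "A \<equiv> bd_trunc n"

lemma bd_trunc_iff: "D \<in> A \<longleftrightarrow> (\<forall>k. k \<notin> sizes \<longrightarrow> D k = 0)"
proof
  assume D: "\<forall>k. k \<notin> sizes \<longrightarrow> D k = 0"
  have "summable (\<lambda>i. real (D i))"
    by (rule summable_finite[of sizes]) (use D in auto)
  then show "D \<in> A" using D by (auto simp: bd_trunc_def bd_states_def)
next
  assume D: "D \<in> A"
  show "\<forall>k. k \<notin> sizes \<longrightarrow> D k = 0"
  proof (intro allI impI)
    fix k assume "k \<notin> sizes"
    then consider "k = 0" | "k = 1" | "n + 1 \<le> k" by fastforce
    then show "D k = 0" using D by cases (auto simp: bd_trunc_def bd_states_def)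
  qed
qed

text \<open>
  Adding a cluster of size \<open>j\<close> to a random configuration changes the masses \<open>v\<close> of the configurations
  to \<open>create j v\<close>.  A cluster of size \<open>1\<close> leaves no trace, and one of size \<open>n + 1\<close> kills the process;
  hence \<open>create 1\<close> is the identity and \<open>create (n + 1)\<close> is zero.
\<close>

definition create :: "nat \<Rightarrow> ((nat \<Rightarrow> nat) \<Rightarrow> real) \<Rightarrow> (nat \<Rightarrow> nat) \<Rightarrow> real" where
  "create j v D = (if j = 1 then v D else if j \<in> sizes \<and> 0 < D j then v (D(j := D j - 1)) else 0)"

text \<open>
  The counterpart of \<open>create\<close>: the factor counts the clusters that may be removed, so that
  \<open>create j (annihilate i v)\<close> turns each of the clusters of size \<open>i\<close> into one of size \<open>j\<close>.
\<close>

definition annihilate :: "nat \<Rightarrow> ((nat \<Rightarrow> nat) \<Rightarrow> real) \<Rightarrow> (nat \<Rightarrow> nat) \<Rightarrow> real" where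
  "annihilate i v D = real (D i + 1) * v (D(i := D i + 1))"

text \<open>
  The right-hand side of the forward equation.  The diagonal entries \<open>rate i i\<close> account for the
  losses, see \<open>create_annihilate\<close>.
\<close>

definition forward :: "((nat \<Rightarrow> nat) \<Rightarrow> real) \<Rightarrow> (nat \<Rightarrow> nat) \<Rightarrow> real" where
  "forward v D = a 1 * z * z * (create 2 v D - v D) +
     (\<Sum>i\<in>sizes. \<Sum>j=1..n. rate i j * create j (annihilate i v) D)"

lemma create_1 [simp]: "create (Suc 0) v = v"
  by (simp add: create_def fun_eq_iff)

lemma create_annihilate: "i \<in> sizes \<Longrightarrow> create i (annihilate i v) D = real (D i) * v D"
  by (auto simp: create_def annihilate_def)

lemma create_sum: "create j (\<lambda>D. \<Sum>k\<in>K. c k * v k D) D = (\<Sum>k\<in>K. c k * create j (v k) D)"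
  by (cases "j = 1"; cases "j \<in> sizes \<and> 0 < D j")
    (simp_all only: create_def if_True if_False simp_thms mult_zero_right sum.neutral_const)

lemma create_zero: "create j (\<lambda>D. 0) D = 0"
  by (simp add: create_def)

lemma create_add: "create j (\<lambda>D. u D + v D) D = create j u D + create j v D"
  by (simp add: create_def)

lemma create_diff: "create j (\<lambda>D. u D - v D) D = create j u D - create j v D"
  by (simp add: create_def)

lemma create_cmult: "create j (\<lambda>D. c * v D) D = c * create j v D"
  by (simp add: create_def)

lemma create_commute: "create j (create k v) D = create k (create j v) D"
  by (cases "j = k") (auto simp: create_def fun_upd_twist)

lemma annihilate_sum: "annihilate i (\<lambda>D. \<Sum>k\<in>K. c k * v k D) D = (\<Sum>k\<in>K. c k * annihilate i (v k) D)"
  by (simp add: annihilate_def sum_distrib_left mult_ac)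

text \<open>
  The commutation relation of creation and annihilation: the removed cluster is either an old one
  or the one that has just been added.
\<close>

lemma annihilate_create:
  "i \<in> sizes \<Longrightarrow> annihilate i (create k v) D = create k (annihilate i v) D + (if i = k then v D else 0)"
  by (cases "i = k") (auto simp: create_def annihilate_def fun_upd_twist algebra_simps of_nat_diff)

lemma create_nonneg: "(\<And>D. 0 \<le> v D) \<Longrightarrow> 0 \<le> create j v D"
  by (simp add: create_def)

text \<open>
  An additional cluster moves on its own: the commutator of \<open>forward\<close> and \<open>create k\<close> is the generator
  of the motion of one cluster of size \<open>k\<close>.
\<close>

lemma forward_create:
  assumes k: "k \<in> {1..n}"
  shows "forward (create k v) D = create k (forward v) D +
    (if k \<in> sizes then \<Sum>j=1..n. rate k j * create j v D else 0)"
proof -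
  have an: "annihilate i (create k v) = (\<lambda>D. create k (annihilate i v) D + (if i = k then v D else 0))"
    if "i \<in> sizes" for i
    using that by (simp add: annihilate_create fun_eq_iff)
  have cr: "create j (\<lambda>D. create k (annihilate i v) D + (if i = k then v D else 0)) D =
    create k (create j (annihilate i v)) D + (if i = k then create j v D else 0)" for i j
    by (auto simp: create_add create_zero create_commute[of j k])
  have "(\<Sum>i\<in>sizes. \<Sum>j=1..n. rate i j * create j (annihilate i (create k v)) D) =
    (\<Sum>i\<in>sizes. (\<Sum>j=1..n. rate i j * create k (create j (annihilate i v)) D) +
      (if i = k then \<Sum>j=1..n. rate k j * create j v D else 0))"
    by (intro sum.cong refl) (simp add: an cr ring_distribs sum.distrib)
  also have "\<dots> = (\<Sum>i\<in>sizes. \<Sum>j=1..n. rate i j * create k (create j (annihilate i v)) D) +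
    (if k \<in> sizes then \<Sum>j=1..n. rate k j * create j v D else 0)"
    by (simp add: sum.distrib sum.delta)
  also have "(\<Sum>i\<in>sizes. \<Sum>j=1..n. rate i j * create k (create j (annihilate i v)) D) =
     create k (\<lambda>D. \<Sum>i\<in>sizes. 1 * (\<Sum>j=1..n. rate i j * create j (annihilate i v) D)) D"
    unfolding create_sum by simp
  finally have "(\<Sum>i\<in>sizes. \<Sum>j=1..n. rate i j * create j (annihilate i (create k v)) D) =
     create k (\<lambda>D. \<Sum>i\<in>sizes. 1 * (\<Sum>j=1..n. rate i j * create j (annihilate i v) D)) D +
    (if k \<in> sizes then \<Sum>j=1..n. rate k j * create j v D else 0)" .
  then show ?thesis
    unfolding forward_def
    by (simp add: create_add create_diff create_cmult create_commute[of 2 k])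
qed

lemma forward_sum:
  fixes K :: "'a set"
  shows "forward (\<lambda>D. \<Sum>k\<in>K. c k * v k D) D = (\<Sum>k\<in>K. c k * forward (v k) D)"
proof -
  have an: "annihilate i (\<lambda>D. \<Sum>k\<in>K. c k * v k D) = (\<lambda>D. \<Sum>k\<in>K. c k * annihilate i (v k) D)" for i
    by (simp add: annihilate_sum fun_eq_iff)
  have swap: "(\<Sum>i\<in>sizes. \<Sum>j=1..n. \<Sum>k\<in>K. g k i j) = (\<Sum>k\<in>K. \<Sum>i\<in>sizes. \<Sum>j=1..n. g k i j)" for g :: "'a \<Rightarrow> nat \<Rightarrow> nat \<Rightarrow> real"
  proof -
    have "(\<Sum>i\<in>sizes. \<Sum>j=1..n. \<Sum>k\<in>K. g k i j) = (\<Sum>i\<in>sizes. \<Sum>k\<in>K. \<Sum>j=1..n. g k i j)"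
      by (intro sum.cong refl sum.swap)
    also have "\<dots> = (\<Sum>k\<in>K. \<Sum>i\<in>sizes. \<Sum>j=1..n. g k i j)" by (rule sum.swap)
    finally show ?thesis .
  qed
  have "(\<Sum>i\<in>sizes. \<Sum>j=1..n. rate i j * create j (annihilate i (\<lambda>D. \<Sum>k\<in>K. c k * v k D)) D) =
    (\<Sum>i\<in>sizes. \<Sum>j=1..n. \<Sum>k\<in>K. c k * (rate i j * create j (annihilate i (v k)) D))"
    unfolding an create_sum sum_distrib_left by (simp add: mult_ac)
  also have "\<dots> = (\<Sum>k\<in>K. c k * (\<Sum>i\<in>sizes. \<Sum>j=1..n. rate i j * create j (annihilate i (v k)) D))"
    unfolding swap sum_distrib_left ..
  finally have "(\<Sum>i\<in>sizes. \<Sum>j=1..n. rate i j * create j (annihilate i (\<lambda>D. \<Sum>k\<in>K. c k * v k D)) D) =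
    (\<Sum>k\<in>K. c k * (\<Sum>i\<in>sizes. \<Sum>j=1..n. rate i j * create j (annihilate i (v k)) D))" .
  then show ?thesis
    unfolding forward_def create_sum
    by (simp add: sum_distrib_left sum_subtractf sum.distrib algebra_simps)
qed

section \<open>Superposition of immigrants and initial clusters\<close>

text \<open>
  The expected number of clusters of size \<open>j\<close> among the immigrants at time \<open>t\<close>.  If the initial
  clusters are Poisson with intensities \<open>f\<close>, then initial clusters and immigrants together have
  the intensities \<open>f\<close> at all times; the subtracted sum is the share of the initial clusters.
\<close>

definition m :: "nat \<Rightarrow> real \<Rightarrow> real" where
  "m j t = f j - (\<Sum>i\<in>sizes. f i * P i j t)"

lemma m_derivative:
  assumes j: "j \<in> sizes" and t: "0 \<le> t"
  shows "(m j has_real_derivative (if j = 2 then a 1 * z * z else 0) + (\<Sum>l\<in>sizes. m l t * rate l j)) (at t within {0..})"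
proof -
  have "(m j has_real_derivative 0 - (\<Sum>i\<in>sizes. f i * (\<Sum>l\<in>sizes. P i l t * rate l j))) (at t within {0..})"
    unfolding m_def using j by (intro DERIV_diff DERIV_const DERIV_sum DERIV_cmult P_derivative t) auto
  moreover have e1: "(\<Sum>i\<in>sizes. f i * (\<Sum>l\<in>sizes. P i l t * rate l j)) = (\<Sum>l\<in>sizes. (\<Sum>i\<in>sizes. f i * P i l t) * rate l j)"
    unfolding sum_distrib_left sum_distrib_right by (subst sum.swap) (simp add: mult_ac)
  have e2: "(\<Sum>l\<in>sizes. m l t * rate l j) = (\<Sum>l\<in>sizes. f l * rate l j) - (\<Sum>l\<in>sizes. (\<Sum>i\<in>sizes. f i * P i l t) * rate l j)"
    unfolding m_def by (simp add: left_diff_distrib sum_subtractf)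
  have "0 - (\<Sum>i\<in>sizes. f i * (\<Sum>l\<in>sizes. P i l t * rate l j)) =
    (if j = 2 then a 1 * z * z else 0) + (\<Sum>l\<in>sizes. m l t * rate l j)"
    unfolding e1 e2 f_stationary[OF j] by simp
  ultimately show ?thesis by (simp only:)
qed

lemma m_0: "j \<in> sizes \<Longrightarrow> m j 0 = 0"
  by (simp add: m_def P_0 if_distrib[of "\<lambda>x. _ * x"] sum.delta cong: if_cong)

text \<open>
  The share of the initial clusters is the minimal flow started from \<open>f\<close>, and \<open>f\<close> is a supersolution.
\<close>

lemma m_nonneg:
  assumes j: "j \<in> sizes" and t: "0 \<le> t"
  shows "0 \<le> m j t"
proof -
  have fnn: "0 \<le> f i" if "i \<in> sizes" for i using f_pos[of i] that by auto
  have "ennreal (\<Sum>i\<in>sizes. f i * P i j t) = (\<Sum>i\<in>sizes. ennreal (f i) * minimal_flow rate sizes (indicator {i}) t j)"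
    using j t fnn
    by (subst sum_ennreal[symmetric])
      (auto simp: P_sizes p_nonneg ennreal_mult p_flow(1)[symmetric] intro!: sum.cong)
  also have "\<dots> = minimal_flow rate sizes (\<lambda>y. \<Sum>i\<in>sizes. ennreal (f i) * indicator {i} y) t j"
    by (rule minimal_flow_superposition[symmetric]) auto
  also have "\<dots> \<le> ennreal (1 * f j)"
  proof (rule f_supersolution)
    fix j assume "j \<in> sizes"
    then show "(\<Sum>i\<in>sizes. ennreal (f i) * indicator {i} j) \<le> ennreal (1 * f j)"
      by (subst sum.mono_neutral_right[of _ "{j}"]) auto
  qed (use j t in auto)
  finally show ?thesis using fnn[OF j] by (simp add: m_def)
qed

text \<open>
  The probability that no immigrant is present and none has left through size \<open>n + 1\<close>.
\<close>

definition F :: "real \<Rightarrow> real" where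
  "F t = exp (integral {0..t} (\<lambda>s. b 2 * m 2 s) - a 1 * z * z * t)"

text \<open>
  The law, on the event that no cluster has reached size \<open>n + 1\<close>, of the immigrants together with
  initial clusters whose sizes are listed in \<open>L\<close>; every initial cluster acts as a creation operator
  with random size.
\<close>

primrec law :: "nat list \<Rightarrow> real \<Rightarrow> (nat \<Rightarrow> nat) \<Rightarrow> real" where
  "law [] t D = F t * (\<Prod>j\<in>sizes. m j t ^ D j / fact (D j))"
| "law (i # L) t D = (\<Sum>k=1..n. P i k t * create k (law L t) D)"

lemma m_continuous: "j \<in> sizes \<Longrightarrow> continuous_on {0..} (m j)"
  by (rule DERIV_continuous_on[OF m_derivative]) auto

lemma F_derivative:
  assumes t: "0 \<le> t"
  shows "(F has_real_derivative (b 2 * m 2 t - a 1 * z * z) * F t) (at t within {0..})"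
proof -
  have "continuous_on {0..t+1} (\<lambda>s. b 2 * m 2 s)"
    using n_ge by (intro continuous_intros continuous_on_subset[OF m_continuous]) auto
  then have "((\<lambda>t. integral {0..t} (\<lambda>s. b 2 * m 2 s)) has_real_derivative b 2 * m 2 t) (at t within {0..t+1})"
    using t by (intro integral_has_real_derivative) auto
  then have "((\<lambda>t. integral {0..t} (\<lambda>s. b 2 * m 2 s)) has_real_derivative b 2 * m 2 t) (at t within {0..})"
    by (simp only: at_within_Icc_eq_atLeast less_add_one)
  from DERIV_chain2[OF DERIV_exp DERIV_diff[OF this DERIV_cmult_Id[of "a 1 * z * z"]]] show ?thesis
    unfolding F_def by (simp only: mult.commute)
qed

lemma F_pos: "0 < F t" by (simp add: F_def)

lemma F_0: "F 0 = 1" by (simp add: F_def)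

lemma law_nonneg: "set L \<subseteq> sizes \<Longrightarrow> 0 \<le> t \<Longrightarrow> 0 \<le> law L t D"
  by (induction L arbitrary: D)
    (auto intro!: sum_nonneg mult_nonneg_nonneg prod_nonneg create_nonneg P_nonneg less_imp_le[OF F_pos]
      divide_nonneg_nonneg zero_le_power m_nonneg)

lemma law_0:
  "set L \<subseteq> sizes \<Longrightarrow> law L 0 D = (if \<forall>j\<in>sizes. D j = count_list L j then 1 else 0)"
proof (induction L arbitrary: D)
  case Nil
  have "(\<Prod>j\<in>sizes. m j 0 ^ D j / fact (D j)) = (\<Prod>j\<in>sizes. if D j = 0 then 1 else 0)"
    by (intro prod.cong) (auto simp: m_0)
  then show ?case by (auto simp: F_0 intro!: prod_zero)
next
  case (Cons i L)
  then have i: "i \<in> sizes" by simp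
  have "law (i # L) 0 D = (\<Sum>k=1..n. if k = i then create k (law L 0) D else 0)"
    unfolding law.simps using P_0[OF i] by (intro sum.cong) auto
  also have "\<dots> = create i (law L 0) D" using i by (subst sum.delta) auto
  also have "\<dots> = (if \<forall>j\<in>sizes. D j = count_list (i # L) j then 1 else 0)"
  proof -
    have "0 < D i \<and> (\<forall>j\<in>sizes. (D(i := D i - 1)) j = count_list L j) \<longleftrightarrow>
      (\<forall>j\<in>sizes. D j = count_list (i # L) j)" (is "?l \<longleftrightarrow> ?r")
    proof
      assume l: ?l
      show ?r
      proof
        fix j assume "j \<in> sizes"
        then have "(D(i := D i - 1)) j = count_list L j" using l by blast
        then show "D j = count_list (i # L) j" using l by (cases "j = i") auto
      qed
    next
      assume r: ?r
      then have "D i = Suc (count_list L i)" using i by auto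
      with r show ?l by auto
    qed
    moreover have "create i (law L 0) D = (if 0 < D i \<and> (\<forall>j\<in>sizes. (D(i := D i - 1)) j = count_list L j) then 1 else 0)"
    proof -
      have "create i (law L 0) D = (if 0 < D i then law L 0 (D(i := D i - 1)) else 0)"
        using i by (auto simp: create_def)
      also have "law L 0 (D(i := D i - 1)) = (if \<forall>j\<in>sizes. (D(i := D i - 1)) j = count_list L j then 1 else 0)"
        using Cons by simp
      finally show ?thesis by (cases "0 < D i") (simp_all only: if_True if_False simp_thms)
    qed
    ultimately show ?thesis by simp
  qed
  finally show ?case .
qed

text \<open>
  Poisson weights are eigenvectors of annihilation, so that on them \<open>forward\<close> reduces to first order
  in the creation operators.
\<close>

lemma annihilate_law_Nil:
  assumes "i \<in> sizes"
  shows "annihilate i (law [] t) D = m i t * law [] t D"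
proof -
  define R where "R = (\<Prod>j\<in>sizes - {i}. m j t ^ D j / fact (D j))"
  have e1: "(\<Prod>j\<in>sizes. m j t ^ (D(i := D i + 1)) j / fact ((D(i := D i + 1)) j)) =
    (m i t ^ (D i + 1) / fact (D i + 1)) * R"
    unfolding R_def using assms by (subst prod.remove[of _ i]) (auto intro!: prod.cong)
  have e2: "(\<Prod>j\<in>sizes. m j t ^ D j / fact (D j)) = (m i t ^ D i / fact (D i)) * R"
    unfolding R_def using assms by (subst prod.remove[of _ i]) auto
  have e3: "real (D i + 1) * (m i t ^ (D i + 1) / fact (D i + 1)) = m i t * (m i t ^ D i / fact (D i))"
    by simp
  have "annihilate i (law [] t) D = (real (D i + 1) * (m i t ^ (D i + 1) / fact (D i + 1))) * (F t * R)"
    unfolding annihilate_def law.simps e1 by (simp only: mult_ac)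
  also have "\<dots> = m i t * law [] t D"
    unfolding e3 law.simps e2 by (simp only: mult_ac)
  finally show ?thesis .
qed

lemma law_Nil_derivative:
  assumes t: "0 \<le> t"
  shows "((\<lambda>t. law [] t D) has_real_derivative forward (law [] t) D) (at t within {0..})"
proof -
  let ?X = "\<lambda>j t. m j t ^ D j / fact (D j)"
  let ?m' = "\<lambda>j. (if j = 2 then a 1 * z * z else 0) + (\<Sum>l\<in>sizes. m l t * rate l j)"
  let ?X' = "\<lambda>j. ?m' j * (if 0 < D j then m j t ^ (D j - 1) / fact (D j - 1) else 0)"
  have X: "(?X j has_real_derivative ?X' j) (at t within {0..})" if j: "j \<in> sizes" for j
  proof (cases "D j")
    case (Suc d)
    have "(?X j has_real_derivative real (Suc d) * ?m' j * m j t ^ d / fact (Suc d)) (at t within {0..})"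
      unfolding Suc using DERIV_cdivide[OF DERIV_power[OF m_derivative[OF j t], of "Suc d"], of "fact (Suc d)"]
      by (simp only: diff_Suc_Suc diff_zero mult.assoc One_nat_def)
    moreover have "real (Suc d) * ?m' j * m j t ^ d / fact (Suc d) = ?X' j"
    proof -
      have "real (Suc d) * (x * y) / fact (Suc d) = x * (y / fact d)" for x y :: real
        by (simp add: fact_Suc del: of_nat_Suc)
      then show ?thesis by (simp only: Suc zero_less_Suc if_True diff_Suc_1 mult.assoc)
    qed
    ultimately show ?thesis by simp
  qed simp
  have pr: "((\<lambda>t. \<Prod>j\<in>sizes. ?X j t) has_real_derivative (\<Sum>j\<in>sizes. ?X' j * (\<Prod>k\<in>sizes-{j}. ?X k t))) (at t within {0..})"
    unfolding has_field_derivative_def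
    by (rule has_derivative_eq_rhs, rule has_derivative_prod[OF X[unfolded has_field_derivative_def]])
      (auto simp: fun_eq_iff sum_distrib_left mult_ac)
  have cr: "create j (law [] t) D = F t * ((if 0 < D j then m j t ^ (D j - 1) / fact (D j - 1) else 0) * (\<Prod>k\<in>sizes-{j}. ?X k t))"
    if "j \<in> sizes" for j
  proof -
    have "(\<Prod>k\<in>sizes. m k t ^ (D(j := D j - 1)) k / fact ((D(j := D j - 1)) k)) =
      (m j t ^ (D j - 1) / fact (D j - 1)) * (\<Prod>k\<in>sizes-{j}. ?X k t)"
      using that by (subst prod.remove[of _ j]) (auto intro!: prod.cong)
    then show ?thesis using that by (auto simp: create_def)
  qed
  have "((\<lambda>t. law [] t D) has_real_derivative
    (b 2 * m 2 t - a 1 * z * z) * F t * (\<Prod>j\<in>sizes. ?X j t) +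
    (\<Sum>j\<in>sizes. ?X' j * (\<Prod>k\<in>sizes-{j}. ?X k t)) * F t) (at t within {0..})"
    unfolding law.simps by (rule DERIV_mult'[OF F_derivative[OF t] pr, THEN DERIV_cong]) simp
  moreover have "(\<Sum>j\<in>sizes. ?X' j * (\<Prod>k\<in>sizes-{j}. ?X k t)) * F t = (\<Sum>j\<in>sizes. ?m' j * create j (law [] t) D)"
    unfolding sum_distrib_right by (intro sum.cong refl) (simp add: cr)
  moreover have "forward (law [] t) D = (b 2 * m 2 t - a 1 * z * z) * law [] t D + (\<Sum>j\<in>sizes. ?m' j * create j (law [] t) D)"
  proof -
    have an: "annihilate i (law [] t) = (\<lambda>D. m i t * law [] t D)" if "i \<in> sizes" for i
      using annihilate_law_Nil[OF that] by blast
    have "(\<Sum>i\<in>sizes. \<Sum>j=1..n. rate i j * create j (annihilate i (law [] t)) D) =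
      (\<Sum>i\<in>sizes. \<Sum>j=1..n. m i t * rate i j * create j (law [] t) D)"
      by (intro sum.cong refl) (simp only: an create_cmult mult_ac)
    also have "\<dots> = (\<Sum>j=1..n. (\<Sum>i\<in>sizes. m i t * rate i j) * create j (law [] t) D)"
      by (subst sum.swap) (simp add: sum_distrib_right)
    also have "\<dots> =
      (\<Sum>i\<in>sizes. m i t * rate i 1) * law [] t D + (\<Sum>j\<in>sizes. (\<Sum>i\<in>sizes. m i t * rate i j) * create j (law [] t) D)"
    proof -
      have "{1..n} = insert 1 sizes" using n_ge by auto
      then show ?thesis by simp
    qed
    also have "(\<Sum>i\<in>sizes. m i t * rate i 1) = b 2 * m 2 t"
      using n_ge by (subst sum_rate_column) (auto simp: numeral_2_eq_2 mult.commute)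
    finally have e: "(\<Sum>i\<in>sizes. \<Sum>j=1..n. rate i j * create j (annihilate i (law [] t)) D) =
      b 2 * m 2 t * law [] t D + (\<Sum>j\<in>sizes. (\<Sum>i\<in>sizes. m i t * rate i j) * create j (law [] t) D)" .
    have "(\<Sum>j\<in>sizes. ?m' j * create j (law [] t) D) =
      (\<Sum>j\<in>sizes. (if j = 2 then a 1 * z * z * create j (law [] t) D else 0)) +
      (\<Sum>j\<in>sizes. (\<Sum>i\<in>sizes. m i t * rate i j) * create j (law [] t) D)"
      by (simp add: distrib_right sum.distrib if_distrib[of "\<lambda>x. x * _"] cong: if_cong)
    also have "(\<Sum>j\<in>sizes. (if j = 2 then a 1 * z * z * create j (law [] t) D else 0)) = a 1 * z * z * create 2 (law [] t) D"
      using n_ge by (subst sum.delta) auto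
    finally show ?thesis
      unfolding forward_def e by (simp add: algebra_simps del: law.simps)
  qed
  ultimately show ?thesis by (simp add: mult.assoc)
qed

text \<open>
  One more initial cluster is handled by the commutator \<open>forward_create\<close>, which matches the
  evolution equation of \<open>P\<close>.
\<close>

lemma law_derivative:
  assumes "set L \<subseteq> sizes" and t: "0 \<le> t"
  shows "((\<lambda>t. law L t D) has_real_derivative forward (law L t) D) (at t within {0..})"
  using assms(1)
proof (induction L arbitrary: D)
  case Nil
  show ?case by (rule law_Nil_derivative[OF t])
next
  case (Cons i L)
  then have i: "i \<in> sizes" and L: "set L \<subseteq> sizes" by auto
  let ?v = "law L t"
  have cr: "((\<lambda>t. create k (law L t) D) has_real_derivative create k (forward ?v) D) (at t within {0..})" for k
    unfolding create_def using Cons.IH[OF L] by auto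
  have "((\<lambda>t. law (i # L) t D) has_real_derivative
    (\<Sum>k=1..n. P i k t * create k (forward ?v) D + (\<Sum>l\<in>sizes. P i l t * rate l k) * create k ?v D)) (at t within {0..})"
    unfolding law.simps
    by (intro DERIV_sum) (auto intro!: DERIV_mult'[OF P_derivative[OF i _ t] cr])
  moreover have "forward (law (i # L) t) D =
    (\<Sum>k=1..n. P i k t * create k (forward ?v) D + (\<Sum>l\<in>sizes. P i l t * rate l k) * create k ?v D)"
  proof -
    have "law (i # L) t = (\<lambda>D. \<Sum>k=1..n. P i k t * create k ?v D)" by (simp add: fun_eq_iff)
    then have "forward (law (i # L) t) D = (\<Sum>k=1..n. P i k t * forward (create k ?v) D)"
      by (simp only: forward_sum)
    also have "\<dots> = (\<Sum>k=1..n. P i k t * create k (forward ?v) D +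
      (if k \<in> sizes then P i k t * (\<Sum>j=1..n. rate k j * create j ?v D) else 0))"
      by (intro sum.cong refl) (simp add: forward_create distrib_left del: law.simps)
    also have "\<dots> = (\<Sum>k=1..n. P i k t * create k (forward ?v) D) +
      (\<Sum>k=1..n. (if k \<in> sizes then P i k t * (\<Sum>j=1..n. rate k j * create j ?v D) else 0))"
      by (rule sum.distrib)
    also have "(\<Sum>k=1..n. (if k \<in> sizes then P i k t * (\<Sum>j=1..n. rate k j * create j ?v D) else 0)) =
      (\<Sum>k\<in>sizes. P i k t * (\<Sum>j=1..n. rate k j * create j ?v D))"
      by (rule sum.mono_neutral_cong_right) auto
    also have "\<dots> = (\<Sum>j=1..n. (\<Sum>k\<in>sizes. P i k t * rate k j) * create j ?v D)"
      unfolding sum_distrib_left sum_distrib_right by (subst sum.swap) (simp add: mult_ac)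
    finally show ?thesis by (simp only: sum.distrib)
  qed
  ultimately show ?case by (simp only:)
qed

end

section \<open>Total mass of the superposition\<close>

lemma has_sum_sum_finite:
  fixes g :: "'i \<Rightarrow> 'a \<Rightarrow> 'b :: topological_comm_monoid_add"
  assumes "finite K" "\<And>k. k \<in> K \<Longrightarrow> (g k has_sum S k) X"
  shows "((\<lambda>x. \<Sum>k\<in>K. g k x) has_sum (\<Sum>k\<in>K. S k)) X"
  using assms by (induction K) (auto intro!: has_sum_add)

context bd_parameters begin

text \<open>
  The probability that no immigrant has reached size \<open>n + 1\<close> before time \<open>t\<close>.
\<close>

definition survival :: "real \<Rightarrow> real" where
  "survival t = F t * exp (\<Sum>j\<in>sizes. m j t)"

text \<open>
  The probability that a cluster of initial size \<open>i\<close> has not reached size \<open>n + 1\<close> before time \<open>t\<close>.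
\<close>

definition inside :: "nat \<Rightarrow> real \<Rightarrow> real" where
  "inside i t = (\<Sum>k=1..n. P i k t)"

lemma upd_in_A: "k \<in> sizes \<Longrightarrow> D \<in> A \<Longrightarrow> D(k := x) \<in> A"
  by (auto simp: bd_trunc_iff)

lemma add_one_image: "k \<in> sizes \<Longrightarrow> (\<lambda>D. D(k := D k + 1)) ` A = {D \<in> A. 0 < D k}"
proof (intro equalityI subsetI)
  fix D assume k: "k \<in> sizes" and D: "D \<in> {D \<in> A. 0 < D k}"
  then show "D \<in> (\<lambda>D. D(k := D k + 1)) ` A"
    by (intro image_eqI[of _ _ "D(k := D k - 1)"]) (auto intro: upd_in_A simp del: fun_upd_apply simp: fun_upd_same)
qed (auto intro: upd_in_A)

lemma add_one_inj: "inj_on (\<lambda>D. D(k := D k + 1 :: nat)) B"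
proof (rule inj_onI)
  fix x y :: "'a \<Rightarrow> nat" assume e: "x(k := x k + 1) = y(k := y k + 1)"
  show "x = y"
  proof
    fix j show "x j = y j" using fun_cong[OF e, of j] by (cases "j = k") auto
  qed
qed

lemma create_add_one: "k \<in> sizes \<Longrightarrow> create k v (D(k := Suc (D k))) = v D"
  by (auto simp: create_def)

lemma create_eq_0: "k \<in> sizes \<Longrightarrow> D k = 0 \<Longrightarrow> create k v D = 0"
  by (auto simp: create_def)

lemma has_sum_create:
  assumes k: "k \<in> {1..n}" and v: "(v has_sum S) A"
  shows "((create k v) has_sum S) A"
proof (cases "k = 1")
  case False
  then have k: "k \<in> sizes" using k by auto
  have "((create k v) has_sum S) ((\<lambda>D. D(k := D k + 1)) ` A)"
    unfolding has_sum_reindex[OF add_one_inj] using v by (simp add: o_def create_add_one[OF k])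
  then show ?thesis
    unfolding add_one_image[OF k]
    by (rule has_sum_cong_neutral[THEN iffD1, rotated -1]) (auto simp: create_eq_0[OF k])
qed (use v in simp)

lemma has_sum_prod_A:
  fixes X :: "nat \<Rightarrow> nat \<Rightarrow> real"
  assumes X: "\<And>j. j \<in> sizes \<Longrightarrow> (X j has_sum S j) UNIV"
    and nonneg: "\<And>j k. j \<in> sizes \<Longrightarrow> 0 \<le> X j k" and S: "\<And>j. j \<in> sizes \<Longrightarrow> S j \<noteq> 0"
  shows "((\<lambda>D. \<Prod>j\<in>sizes. X j (D j)) has_sum (\<Prod>j\<in>sizes. S j)) A"
proof -
  let ?PiE = "PiE sizes (\<lambda>_. UNIV) :: (nat \<Rightarrow> nat) set"
  let ?h = "\<lambda>D. restrict D sizes"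
  have abs: "(\<lambda>k. norm (X j k)) summable_on UNIV" if "j \<in> sizes" for j
    using X[OF that] nonneg[OF that] by (simp add: has_sum_imp_summable)
  have I: "(\<Sum>\<^sub>\<infinity>g\<in>?PiE. \<Prod>j\<in>sizes. X j (g j)) = (\<Prod>j\<in>sizes. S j)"
    by (subst infsum_prod_PiE_abs) (use X abs in \<open>auto intro!: prod.cong infsumI\<close>)
  moreover have "(\<Prod>j\<in>sizes. S j) \<noteq> 0" using S by auto
  ultimately have "(\<lambda>g. \<Prod>j\<in>sizes. X j (g j)) summable_on ?PiE"
    using infsum_not_exists by force
  then have sum: "((\<lambda>g. \<Prod>j\<in>sizes. X j (g j)) has_sum (\<Prod>j\<in>sizes. S j)) ?PiE"
    using I has_sum_infsum by fastforce
  have img: "?h ` A = ?PiE"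
  proof (intro equalityI subsetI)
    fix g assume g: "g \<in> ?PiE"
    have "(\<lambda>k. if k \<in> sizes then g k else 0) \<in> A" by (auto simp: bd_trunc_iff)
    moreover have "g = ?h (\<lambda>k. if k \<in> sizes then g k else 0)"
      using g by (auto simp: fun_eq_iff restrict_def PiE_def extensional_def)
    ultimately show "g \<in> ?h ` A" by blast
  qed auto
  have inj: "inj_on ?h A"
  proof (rule inj_onI)
    fix x y assume x: "x \<in> A" and y: "y \<in> A" and e: "?h x = ?h y"
    show "x = y"
    proof
      fix k show "x k = y k"
        using fun_cong[OF e, of k] x y by (cases "k \<in> sizes") (auto simp: bd_trunc_iff)
    qed
  qed
  have "((\<lambda>g. \<Prod>j\<in>sizes. X j (g j)) \<circ> ?h has_sum (\<Prod>j\<in>sizes. S j)) A"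
    using sum unfolding img[symmetric] has_sum_reindex[OF inj] .
  then show ?thesis by (simp add: o_def)
qed

lemma has_sum_poisson:
  fixes x :: real
  assumes "0 \<le> x"
  shows "((\<lambda>k. x ^ k / fact k) has_sum exp x) UNIV"
proof (rule norm_summable_imp_has_sum)
  have "(\<lambda>k. x ^ k / fact k) sums exp x"
    using exp_converges[of x] by (simp add: field_simps)
  then show "(\<lambda>k. x ^ k / fact k) sums exp x" "summable (\<lambda>k. norm (x ^ k / fact k))"
    using assms by (auto simp: sums_iff)
qed

lemma has_sum_law:
  assumes "set L \<subseteq> sizes" and t: "0 \<le> t"
  shows "(law L t has_sum survival t * (\<Prod>i\<leftarrow>L. inside i t)) A"
  using assms(1)
proof (induction L)
  case Nil
  have "((\<lambda>D. F t * (\<Prod>j\<in>sizes. m j t ^ D j / fact (D j))) has_sum F t * (\<Prod>j\<in>sizes. exp (m j t))) A"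
    using m_nonneg[OF _ t] by (intro has_sum_cmult_right has_sum_prod_A has_sum_poisson) auto
  then show ?case by (simp add: survival_def exp_sum)
next
  case (Cons i L)
  have "((\<lambda>D. \<Sum>k=1..n. P i k t * create k (law L t) D) has_sum
    (\<Sum>k=1..n. P i k t * (survival t * (\<Prod>i\<leftarrow>L. inside i t)))) A"
    using Cons by (intro has_sum_sum_finite has_sum_cmult_right has_sum_create) auto
  moreover have "(\<Sum>k=1..n. P i k t * (S * Q)) = S * (inside i t * Q)" for S Q
    unfolding inside_def sum_distrib_right sum_distrib_left by (intro sum.cong) auto
  ultimately show ?case by simp
qed

lemma survival_pos: "0 < survival t"
  by (simp add: survival_def F_pos)

lemma sum_rate_row_total:
  assumes "l \<in> sizes"
  shows "(\<Sum>j=1..n. rate l j) = (if l = n then - (a n * z) else 0)"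
  using sum_rate_row[OF assms, of "\<lambda>_. 1"] assms by auto

lemma survival_le_1:
  assumes t: "0 \<le> t"
  shows "survival t \<le> 1"
proof -
  have D: "(survival has_real_derivative - (a n * z * m n s * survival s)) (at s within {0..})" if s: "0 \<le> s" for s
  proof -
    let ?m' = "\<lambda>j. (if j = 2 then a 1 * z * z else 0) + (\<Sum>l\<in>sizes. m l s * rate l j)"
    have "((\<lambda>s. \<Sum>j\<in>sizes. m j s) has_real_derivative (\<Sum>j\<in>sizes. ?m' j)) (at s within {0..})"
      by (intro DERIV_sum m_derivative s)
    from DERIV_mult'[OF F_derivative[OF s] DERIV_chain2[OF DERIV_exp this]]
    have "(survival has_real_derivative F s * (exp (\<Sum>j\<in>sizes. m j s) * (\<Sum>j\<in>sizes. ?m' j)) +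
      (b 2 * m 2 s - a 1 * z * z) * F s * exp (\<Sum>j\<in>sizes. m j s)) (at s within {0..})"
      unfolding survival_def .
    moreover have V: "(\<Sum>j\<in>sizes. ?m' j) = a 1 * z * z - a n * z * m n s - b 2 * m 2 s"
    proof -
      have "(\<Sum>j\<in>sizes. \<Sum>l\<in>sizes. m l s * rate l j) + (\<Sum>l\<in>sizes. m l s * rate l 1) =
        (\<Sum>j\<in>insert 1 sizes. \<Sum>l\<in>sizes. m l s * rate l j)" by simp
      also have "insert 1 sizes = {1..n}" using n_ge by auto
      also have "(\<Sum>j\<in>{1..n}. \<Sum>l\<in>sizes. m l s * rate l j) = (\<Sum>l\<in>sizes. m l s * (\<Sum>j=1..n. rate l j))"
        by (subst sum.swap) (simp add: sum_distrib_left)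
      also have "\<dots> = (\<Sum>l\<in>sizes. if l = n then - (m n s * (a n * z)) else 0)"
        by (intro sum.cong refl) (simp add: sum_rate_row_total[unfolded One_nat_def])
      also have "\<dots> = - (m n s * (a n * z))"
        using n_ge by (subst sum.delta) auto
      also have "(\<Sum>l\<in>sizes. m l s * rate l 1) = b 2 * m 2 s"
        using n_ge by (subst sum_rate_column) (auto simp: numeral_2_eq_2 mult.commute)
      finally show ?thesis
        using n_ge by (simp add: sum.distrib sum.delta algebra_simps)
    qed
    have "F s * (exp (\<Sum>j\<in>sizes. m j s) * (\<Sum>j\<in>sizes. ?m' j)) +
      (b 2 * m 2 s - a 1 * z * z) * F s * exp (\<Sum>j\<in>sizes. m j s) = - (a n * z * m n s * survival s)"
      unfolding V survival_def by (simp add: algebra_simps)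
    ultimately show ?thesis by (simp only:)
  qed
  have "survival t \<le> survival 0"
    by (rule nonincreasing_on_atLeast_0[OF D _ t])
      (use a_pos[of n] z_pos n_ge m_nonneg survival_pos in \<open>auto simp: less_imp_le\<close>)
  also have "survival 0 = 1" by (simp add: survival_def F_0 m_0)
  finally show ?thesis .
qed

lemma inside_bounds: "i \<in> sizes \<Longrightarrow> 0 \<le> t \<Longrightarrow> 0 \<le> inside i t" "i \<in> sizes \<Longrightarrow> 0 \<le> t \<Longrightarrow> inside i t \<le> 1"
  using P_sum_le_1 P_nonneg by (auto simp: inside_def intro!: sum_nonneg)

lemma law_mass_le_1:
  assumes "set L \<subseteq> sizes" and t: "0 \<le> t"
  shows "survival t * (\<Prod>i\<leftarrow>L. inside i t) \<le> 1"
proof -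
  have "(\<Prod>i\<leftarrow>L. inside i t) \<le> 1 \<and> 0 \<le> (\<Prod>i\<leftarrow>L. inside i t)"
    using assms(1) by (induction L) (use inside_bounds t in \<open>auto intro!: mult_le_one\<close>)
  then show ?thesis
    using survival_le_1[OF t] survival_pos[of t] by (intro mult_le_one) auto
qed

section \<open>Conservation of mass\<close>

definition cluster_count :: "(nat \<Rightarrow> nat) \<Rightarrow> nat" where
  "cluster_count D = (\<Sum>j\<in>sizes. D j)"

definition level :: "nat \<Rightarrow> (nat \<Rightarrow> nat) set" where
  "level R = {D \<in> A. cluster_count D < R}"

lemma finite_level: "finite (level R)"
proof (rule finite_subset)
  show "level R \<subseteq> {D. \<forall>k. (k \<in> sizes \<longrightarrow> D k \<in> {..R}) \<and> (k \<notin> sizes \<longrightarrow> D k = 0)}"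
  proof
    fix D assume D: "D \<in> level R"
    have "D k \<le> cluster_count D" if "k \<in> sizes" for k
      unfolding cluster_count_def using that by (intro member_le_sum) auto
    then show "D \<in> {D. \<forall>k. (k \<in> sizes \<longrightarrow> D k \<in> {..R}) \<and> (k \<notin> sizes \<longrightarrow> D k = 0)}"
      using D by (fastforce simp: level_def bd_trunc_iff)
  qed
qed (rule finite_set_of_finite_funs, auto)

lemma level_mono: "R \<le> R' \<Longrightarrow> level R \<subseteq> level R'"
  by (auto simp: level_def)

lemma Union_level: "(\<Union>R. level R) = A"
  by (auto simp: level_def)

lemma countable_A: "countable A"
  unfolding Union_level[symmetric] by (intro countable_UN) (auto intro: countable_finite finite_level)

lemma cluster_count_add_one: "k \<in> sizes \<Longrightarrow> cluster_count (D(k := D k + 1)) = cluster_count D + 1"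
  unfolding cluster_count_def by (subst (1 2) sum.remove[of _ k]) (auto intro!: sum.cong)

lemma level_add_one: "k \<in> sizes \<Longrightarrow> (\<lambda>D. D(k := D k + 1)) ` level R = {D \<in> level (Suc R). 0 < D k}"
proof (intro equalityI subsetI)
  fix D assume k: "k \<in> sizes" and D: "D \<in> {D \<in> level (Suc R). 0 < D k}"
  then have "D \<in> (\<lambda>D. D(k := D k + 1)) ` A" unfolding add_one_image[OF k] by (simp add: level_def)
  then obtain D' where D': "D' \<in> A" "D = D'(k := D' k + 1)" by blast
  have "cluster_count D' < R" using D cluster_count_add_one[OF k, of D'] unfolding D'(2) by (simp add: level_def)
  then have "D' \<in> level R" using D'(1) by (simp add: level_def)
  then show "D \<in> (\<lambda>D. D(k := D k + 1)) ` level R" unfolding D'(2) by (rule imageI)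
next
  fix D assume k: "k \<in> sizes" and "D \<in> (\<lambda>D. D(k := D k + 1)) ` level R"
  then obtain D' where D': "D' \<in> A" "cluster_count D' < R" "D = D'(k := D' k + 1)"
    by (auto simp: level_def)
  have "cluster_count D < Suc R" unfolding D'(3) cluster_count_add_one[OF k] using D'(2) by simp
  moreover have "D \<in> A" unfolding D'(3) by (rule upd_in_A[OF k D'(1)])
  moreover have "0 < D k" by (simp add: D'(3))
  ultimately show "D \<in> {D \<in> level (Suc R). 0 < D k}" by (simp add: level_def)
qed

lemma sum_create_level:
  assumes k: "k \<in> sizes"
  shows "(\<Sum>D\<in>level (Suc R). create k v D) = (\<Sum>D\<in>level R. v D)"
proof -
  have "(\<Sum>D\<in>level (Suc R). create k v D) = (\<Sum>D\<in>{D \<in> level (Suc R). 0 < D k}. create k v D)"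
    by (rule sum.mono_neutral_right) (auto simp: finite_level create_eq_0[OF k])
  also have "\<dots> = (\<Sum>D\<in>level R. v D)"
    unfolding level_add_one[OF k, symmetric]
    by (subst sum.reindex[OF add_one_inj]) (simp add: create_add_one[OF k])
  finally show ?thesis .
qed

lemma sum_annihilate_level:
  assumes k: "k \<in> sizes"
  shows "(\<Sum>D\<in>level R. annihilate k v D) = (\<Sum>D\<in>level (Suc R). real (D k) * v D)"
proof -
  have "(\<Sum>D\<in>level (Suc R). real (D k) * v D) = (\<Sum>D\<in>{D \<in> level (Suc R). 0 < D k}. real (D k) * v D)"
    by (rule sum.mono_neutral_right) (auto simp: finite_level)
  also have "\<dots> = (\<Sum>D\<in>level R. annihilate k v D)"
    unfolding level_add_one[OF k, symmetric]
    by (subst sum.reindex[OF add_one_inj]) (simp add: annihilate_def)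
  finally show ?thesis by simp
qed

text \<open>
  Summed over all configurations with at most \<open>R\<close> clusters, the changes of size cancel.  What remains
  is the immigration into configurations with \<open>R + 1\<close> clusters, the killing, and the dissolution of
  clusters in configurations with \<open>R + 1\<close> clusters.
\<close>

lemma sum_forward_level:
  "(\<Sum>D\<in>level (Suc R). forward v D) =
    - a 1 * z * z * ((\<Sum>D\<in>level (Suc R). v D) - (\<Sum>D\<in>level R. v D))
    - a n * z * (\<Sum>D\<in>level (Suc R). real (D n) * v D)
    + b 2 * ((\<Sum>D\<in>level (Suc (Suc R)). real (D 2) * v D) - (\<Sum>D\<in>level (Suc R). real (D 2) * v D))"
proof -
  let ?N = "\<lambda>i R. \<Sum>D\<in>level R. real (D i) * v D"
  have s2: "2 \<in> sizes" using n_ge by auto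
  have ins: "{1..n} = insert 1 sizes" using n_ge by auto
  have "(\<Sum>D\<in>level (Suc R). \<Sum>i\<in>sizes. \<Sum>j=1..n. rate i j * create j (annihilate i v) D) =
    (\<Sum>i\<in>sizes. \<Sum>j=1..n. \<Sum>D\<in>level (Suc R). rate i j * create j (annihilate i v) D)"
    by (subst sum.swap, intro sum.cong refl, rule sum.swap)
  also have "\<dots> = (\<Sum>i\<in>sizes. rate i 1 * ?N i (Suc (Suc R)) + (\<Sum>j\<in>sizes. rate i j * ?N i (Suc R)))"
    unfolding ins
    by (intro sum.cong refl)
      (simp add: sum_distrib_left[symmetric] sum_create_level sum_annihilate_level)
  also have "\<dots> = (\<Sum>i\<in>sizes. ?N i (Suc R) * (\<Sum>j=1..n. rate i j)) +
    (\<Sum>i\<in>sizes. (?N i (Suc (Suc R)) - ?N i (Suc R)) * rate i 1)"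
  proof -
    have "r 1 * N' + (\<Sum>j\<in>sizes. r j * N) = N * (\<Sum>j\<in>insert 1 sizes. r j) + (N' - N) * r 1"
      for r :: "nat \<Rightarrow> real" and N N' :: real
      by (simp add: sum_distrib_left algebra_simps)
    then show ?thesis unfolding ins sum.distrib[symmetric] by (intro sum.cong refl)
  qed
  also have "(\<Sum>i\<in>sizes. ?N i (Suc R) * (\<Sum>j=1..n. rate i j)) = (\<Sum>i\<in>sizes. if i = n then - (a n * z) * ?N n (Suc R) else 0)"
    by (intro sum.cong refl) (simp add: sum_rate_row_total[unfolded One_nat_def])
  also have "\<dots> = - (a n * z) * ?N n (Suc R)" using n_ge by (subst sum.delta) auto
  also have "(\<Sum>i\<in>sizes. (?N i (Suc (Suc R)) - ?N i (Suc R)) * rate i 1) = b 2 * (?N 2 (Suc (Suc R)) - ?N 2 (Suc R))"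
    using n_ge by (subst sum_rate_column) (auto simp: eval_nat_numeral)
  finally have e: "(\<Sum>D\<in>level (Suc R). \<Sum>i\<in>sizes. \<Sum>j=1..n. rate i j * create j (annihilate i v) D) =
    - (a n * z) * ?N n (Suc R) + b 2 * (?N 2 (Suc (Suc R)) - ?N 2 (Suc R))" .
  have "(\<Sum>D\<in>level (Suc R). a 1 * z * z * (create 2 v D - v D)) =
    a 1 * z * z * ((\<Sum>D\<in>level R. v D) - (\<Sum>D\<in>level (Suc R). v D))"
    by (simp add: sum_distrib_left[symmetric] sum_subtractf sum_create_level[OF s2])
  then show ?thesis
    unfolding forward_def sum.distrib e by (simp add: algebra_simps)
qed

end

lemma no_harmonic_minorant:
  fixes O' :: "nat \<Rightarrow> real"
  assumes O': "summable O'" and c: "0 < c" and le: "\<And>R. R0 \<le> R \<Longrightarrow> c / real (Suc R) \<le> O' R"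
  shows False
proof -
  have "summable (\<lambda>R. c / real (Suc R))"
    by (rule summable_comparison_test'[OF O', of R0]) (use c le in auto)
  then have "summable (\<lambda>R. inverse c * (c / real (Suc R)))" by (rule summable_mult)
  then have "summable (\<lambda>R. inverse (real (Suc R)))"
    using c by (simp add: field_simps)
  then have "summable (\<lambda>R. inverse (real R))" by (rule summable_Suc_iff[THEN iffD1])
  then show False using not_summable_harmonic[where 'a = real] by (simp add: inverse_eq_divide)
qed

context bd_parameters begin

text \<open>
  Let \<open>out R\<close> be the time that the solution spends in configurations with exactly \<open>R\<close> clusters.  In
  the balance for at most \<open>R\<close> clusters the loss by immigration is a multiple of \<open>out R\<close>, which tends
  to \<open>0\<close> because \<open>out\<close> is summable, and the gain by dissolution is at most a multiple of
  \<open>(R + 1) * out (R + 1)\<close>.  If some mass were gained in the limit, then \<open>out\<close> would dominate a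
  multiple of the harmonic series.
\<close>

lemma conservation:
  fixes x :: "real \<Rightarrow> (nat \<Rightarrow> nat) \<Rightarrow> real"
  assumes C: "C \<in> A"
    and deriv: "\<And>D t. D \<in> A \<Longrightarrow> 0 \<le> t \<Longrightarrow> ((\<lambda>t. x t D) has_real_derivative forward (x t) D) (at t within {0..})"
    and nonneg: "\<And>D t. D \<in> A \<Longrightarrow> 0 \<le> t \<Longrightarrow> 0 \<le> x t D"
    and mass: "\<And>R t. 0 \<le> t \<Longrightarrow> (\<Sum>D\<in>level R. x t D) \<le> 1"
    and init: "\<And>D. D \<in> A \<Longrightarrow> x 0 D = (if D = C then 1 else 0)"
    and t: "0 \<le> t"
  shows "(\<integral>\<^sup>+D. (ennreal (x t D) +
     (\<integral>\<^sup>+s\<in>{0..t}. ennreal (a n * z * real (D n) * x s D) \<partial>lborel)) \<partial>count_space A) = 1"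
proof -
  let ?\<alpha> = "a 1 * z * z" and ?\<kappa> = "a n * z" and ?\<beta> = "b 2"
  have pos: "0 < ?\<alpha>" "0 < ?\<kappa>" "0 < ?\<beta>"
    using a_pos[of 1] a_pos[of n] b_pos[of 2] z_pos n_ge by auto
  define W where "W R s = (\<Sum>D\<in>level R. x s D)" for R s
  define N where "N i R s = (\<Sum>D\<in>level R. real (D i) * x s D)" for i R s
  define IW where "IW R = integral {0..t} (W R)" for R
  define IN where "IN i R = integral {0..t} (N i R)" for i R
  have levelA: "D \<in> A" if "D \<in> level R" for D R using that by (simp add: level_def)
  have cont: "continuous_on {0..t} (\<lambda>s. x s D)" if "D \<in> A" for D
    by (rule continuous_on_subset[of "{0..}"], rule DERIV_continuous_on[OF deriv[OF that]]) auto
  have W_int: "W R integrable_on {0..t}" and N_int: "N i R integrable_on {0..t}" for i R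
    unfolding W_def N_def
    by (auto intro!: integrable_continuous_real continuous_on_sum continuous_on_mult continuous_on_const cont levelA)
  have W_I: "(W R has_integral IW R) {0..t}" and N_I: "(N i R has_integral IN i R) {0..t}" for i R
    using W_int N_int by (auto simp: IW_def IN_def integrable_integral)
  have shell: "(\<Sum>D\<in>level (Suc R). h D) - (\<Sum>D\<in>level R. h D) = (\<Sum>D\<in>level (Suc R) - level R. h D)"
    for R and h :: "_ \<Rightarrow> real"
    by (rule sum_diff[symmetric, OF finite_level level_mono]) simp
  define out where "out R = IW (Suc R) - IW R" for R
  have out_nonneg: "0 \<le> out R" for R
  proof -
    have "W R s \<le> W (Suc R) s" if "s \<in> {0..t}" for s
      unfolding W_def using that
      by (intro sum_mono2 finite_level level_mono) (auto intro: nonneg levelA)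
    then show ?thesis
      unfolding out_def using has_integral_le[OF W_I W_I] by auto
  qed
  have IW_le: "IW R \<le> t" for R
  proof -
    have "((\<lambda>_. 1) has_integral t) {0..t}" using has_integral_const_real[of "1::real" 0 t] t by simp
    from has_integral_le[OF W_I this] show ?thesis using mass by (auto simp: W_def)
  qed
  have "IW 0 = 0" unfolding IW_def W_def by (simp add: level_def)
  then have tele: "(\<Sum>R<K. out R) = IW K" for K
    unfolding out_def by (simp add: sum_lessThan_telescope)
  have out_summable: "summable out"
    by (rule summableI_nonneg_bounded[of _ t]) (simp_all add: out_nonneg tele IW_le)
  have in_bounds: "0 \<le> IN 2 (Suc (Suc R)) - IN 2 (Suc R)"
    "IN 2 (Suc (Suc R)) - IN 2 (Suc R) \<le> real (Suc R) * out (Suc R)" for R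
  proof -
    have D: "((\<lambda>s. N 2 (Suc (Suc R)) s - N 2 (Suc R) s) has_integral (IN 2 (Suc (Suc R)) - IN 2 (Suc R))) {0..t}"
      by (intro has_integral_diff N_I)
    have E: "((\<lambda>s. real (Suc R) * (W (Suc (Suc R)) s - W (Suc R) s)) has_integral (real (Suc R) * out (Suc R))) {0..t}"
      unfolding out_def by (intro has_integral_mult_right has_integral_diff W_I)
    have s: "0 \<le> N 2 (Suc (Suc R)) s - N 2 (Suc R) s \<and>
       N 2 (Suc (Suc R)) s - N 2 (Suc R) s \<le> real (Suc R) * (W (Suc (Suc R)) s - W (Suc R) s)"
      if s: "s \<in> {0..t}" for s
    proof -
      have "real (D 2) \<le> real (Suc R)" if "D \<in> level (Suc (Suc R))" for D
      proof -
        have "D 2 \<le> cluster_count D" unfolding cluster_count_def using n_ge by (intro member_le_sum) auto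
        then show ?thesis using that by (simp add: level_def)
      qed
      then show ?thesis
        unfolding N_def W_def shell sum_distrib_left using s
        by (auto intro!: sum_nonneg sum_mono mult_nonneg_nonneg mult_right_mono nonneg levelA)
    qed
    show "0 \<le> IN 2 (Suc (Suc R)) - IN 2 (Suc R)"
      by (rule has_integral_nonneg[OF D]) (use s in auto)
    show "IN 2 (Suc (Suc R)) - IN 2 (Suc R) \<le> real (Suc R) * out (Suc R)"
      by (rule has_integral_le[OF D E]) (use s in auto)
  qed
  \<comment> \<open>The forward equation, summed over a level and integrated over \<open>{0..t}\<close>.\<close>
  have balance: "W (Suc R) t + ?\<kappa> * IN n (Suc R) =
    W (Suc R) 0 - ?\<alpha> * out R + ?\<beta> * (IN 2 (Suc (Suc R)) - IN 2 (Suc R))" for R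
  proof -
    let ?g = "\<lambda>s. - ?\<alpha> * (W (Suc R) s - W R s) - ?\<kappa> * N n (Suc R) s + ?\<beta> * (N 2 (Suc (Suc R)) s - N 2 (Suc R) s)"
    have "(?g has_integral (W (Suc R) t - W (Suc R) 0)) {0..t}"
    proof (rule fundamental_theorem_of_calculus[OF t])
      fix s assume s: "s \<in> {0..t}"
      have "(W (Suc R) has_real_derivative (\<Sum>D\<in>level (Suc R). forward (x s) D)) (at s within {0..})"
        unfolding W_def using s by (intro DERIV_sum deriv levelA) auto
      also have "(\<Sum>D\<in>level (Suc R). forward (x s) D) = ?g s"
        unfolding sum_forward_level W_def N_def by simp
      finally have "(W (Suc R) has_real_derivative ?g s) (at s within {0..t})"
        by (rule has_field_derivative_subset) auto
      then show "(W (Suc R) has_vector_derivative ?g s) (at s within {0..t})"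
        by (simp only: has_real_derivative_iff_has_vector_derivative)
    qed
    moreover have "(?g has_integral (- ?\<alpha> * (IW (Suc R) - IW R) - ?\<kappa> * IN n (Suc R) +
       ?\<beta> * (IN 2 (Suc (Suc R)) - IN 2 (Suc R)))) {0..t}"
      by (intro has_integral_add has_integral_diff has_integral_mult_right W_I N_I)
    ultimately have "W (Suc R) t - W (Suc R) 0 = - ?\<alpha> * (IW (Suc R) - IW R) - ?\<kappa> * IN n (Suc R) +
       ?\<beta> * (IN 2 (Suc (Suc R)) - IN 2 (Suc R))"
      by (rule has_integral_unique)
    then show ?thesis by (simp add: out_def algebra_simps)
  qed
  \<comment> \<open>The mass present at time \<open>t\<close>, and the mass lost until then, from configurations in \<open>level R\<close>.\<close>
  define B where "B R = W R t + ?\<kappa> * IN n R" for R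
  define h where "h D = ennreal (x t D) +
     (\<integral>\<^sup>+s\<in>{0..t}. ennreal (a n * z * real (D n) * x s D) \<partial>lborel)" for D
  have h: "h D = ennreal (x t D + integral {0..t} (\<lambda>s. ?\<kappa> * (real (D n) * x s D)))" if D: "D \<in> A" for D
  proof -
    have nn: "0 \<le> ?\<kappa> * (real (D n) * x s D)" if "s \<in> {0..t}" for s
      using that pos nonneg[OF D] by auto
    have c: "continuous_on {0..t} (\<lambda>s. ?\<kappa> * (real (D n) * x s D))"
      by (intro continuous_intros cont D)
    have "(\<integral>\<^sup>+s\<in>{0..t}. ennreal (?\<kappa> * (real (D n) * x s D)) \<partial>lborel) =
      ennreal (integral {0..t} (\<lambda>s. ?\<kappa> * (real (D n) * x s D)))"
      by (rule nn_integral_eq_integral_Icc[OF borel_integrable_atLeastAtMost'[OF c] nn])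
    moreover have "0 \<le> integral {0..t} (\<lambda>s. ?\<kappa> * (real (D n) * x s D))"
      by (rule integral_nonneg[OF integrable_continuous_real[OF c] nn])
    ultimately show ?thesis
      unfolding h_def using nonneg[OF D t] by (simp add: ennreal_plus mult.assoc)
  qed
  have hB: "(\<Sum>D\<in>level R. h D) = ennreal (B R)" and B_nonneg: "0 \<le> B R" for R
  proof -
    have nn: "0 \<le> x t D + integral {0..t} (\<lambda>s. ?\<kappa> * (real (D n) * x s D))" if "D \<in> A" for D
      using pos nonneg[OF that] t
      by (intro add_nonneg_nonneg integral_nonneg integrable_continuous_real continuous_intros cont that) auto
    have "(\<Sum>D\<in>level R. h D) = (\<Sum>D\<in>level R. ennreal (x t D + integral {0..t} (\<lambda>s. ?\<kappa> * (real (D n) * x s D))))"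
      by (intro sum.cong refl h levelA)
    also have "\<dots> = ennreal (\<Sum>D\<in>level R. x t D + integral {0..t} (\<lambda>s. ?\<kappa> * (real (D n) * x s D)))"
      by (intro sum_ennreal nn levelA)
    also have "(\<Sum>D\<in>level R. x t D + integral {0..t} (\<lambda>s. ?\<kappa> * (real (D n) * x s D))) = B R"
    proof -
      have "IN n R = (\<Sum>D\<in>level R. integral {0..t} (\<lambda>s. real (D n) * x s D))"
        unfolding IN_def N_def
        by (intro integral_sum finite_level integrable_continuous_real continuous_intros cont levelA)
      then show ?thesis
        by (simp add: B_def W_def sum.distrib sum_distrib_left)
    qed
    finally show "(\<Sum>D\<in>level R. h D) = ennreal (B R)" .
    show "0 \<le> B R"
      unfolding \<open>_ = B R\<close>[symmetric] by (intro sum_nonneg nn levelA)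
  qed
  have B_mono: "incseq B"
  proof (rule incseq_SucI)
    fix R
    have "(\<Sum>D\<in>level R. h D) \<le> (\<Sum>D\<in>level (Suc R). h D)"
      by (intro sum_mono2 finite_level level_mono) auto
    then show "B R \<le> B (Suc R)" using B_nonneg by (simp add: hB)
  qed
  have W0: "W R 0 \<le> 1" for R using mass[of 0 R] by (simp add: W_def)
  have W0_eq: "W (Suc R) 0 = 1" if "cluster_count C \<le> R" for R
  proof -
    have "W (Suc R) 0 = (\<Sum>D\<in>level (Suc R). if D = C then 1 else 0)"
      unfolding W_def by (intro sum.cong refl) (simp add: init levelA)
    moreover have "C \<in> level (Suc R)" using C that by (simp add: level_def)
    ultimately show ?thesis by (simp add: sum.delta finite_level)
  qed
  \<comment> \<open>Here the excess over \<open>1\<close> would give \<open>out\<close> a harmonic minorant.\<close>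
  have B_le: "B R \<le> 1" for R
  proof (rule ccontr)
    assume "\<not> B R \<le> 1"
    then have e: "0 < (B R - 1) / ?\<beta>" using pos by simp
    have "(B R - 1) / ?\<beta> / real (Suc R') \<le> out R'" if "Suc R \<le> R'" for R'
    proof -
      have "R' \<noteq> 0" using that by simp
      then obtain r where r: "R' = Suc r" using not0_implies_Suc by blast
      have "B R \<le> B (Suc r)" using B_mono that r by (auto simp: incseq_def)
      also have "\<dots> \<le> 1 + ?\<beta> * (real (Suc r) * out (Suc r))"
        unfolding B_def balance
        using W0[of "Suc r"] mult_nonneg_nonneg[OF less_imp_le[OF pos(1)] out_nonneg[of r]]
          mult_left_mono[OF in_bounds(2)[of r] less_imp_le[OF pos(3)]]
        by linarith
      finally have "(B R - 1) / ?\<beta> \<le> real (Suc r) * out (Suc r)"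
        using pos by (simp add: field_simps)
      also have "\<dots> \<le> real (Suc R') * out R'"
        using r out_nonneg by (intro mult_mono) auto
      finally have "(B R - 1) / ?\<beta> \<le> out R' * real (Suc R')" by (simp only: mult.commute)
      then show ?thesis
        by (rule pos_divide_le_eq[THEN iffD2, rotated]) simp
    qed
    from no_harmonic_minorant[OF out_summable e this] show False .
  qed
  have "B \<longlonglongrightarrow> 1"
  proof (rule LIMSEQ_imp_Suc, rule tendsto_sandwich)
    show "\<forall>\<^sub>F R in sequentially. 1 - ?\<alpha> * out R \<le> B (Suc R)"
      using eventually_ge_at_top[of "cluster_count C"]
    proof eventually_elim
      case (elim R)
      show ?case
        unfolding B_def balance W0_eq[OF elim]
        using mult_nonneg_nonneg[OF less_imp_le[OF pos(3)] in_bounds(1)[of R]] by linarith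
    qed
    show "\<forall>\<^sub>F R in sequentially. B (Suc R) \<le> 1" by (simp add: B_le)
    have "(\<lambda>R. 1 - ?\<alpha> * out R) \<longlonglongrightarrow> 1 - ?\<alpha> * 0"
      by (intro tendsto_intros summable_LIMSEQ_zero out_summable)
    then show "(\<lambda>R. 1 - ?\<alpha> * out R) \<longlonglongrightarrow> 1" by simp
  qed simp
  then have lim: "(\<lambda>R. ennreal (B R)) \<longlonglongrightarrow> 1"
    using tendsto_ennrealI[of B 1 sequentially] by simp
  have "(\<integral>\<^sup>+D. h D \<partial>count_space A) = (\<integral>\<^sup>+D. (SUP R. h D * indicator (level R) D) \<partial>count_space A)"
  proof (intro nn_integral_cong)
    fix D assume "D \<in> space (count_space A)"
    then have "D \<in> level (Suc (cluster_count D))" by (simp add: level_def)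
    then have "h D \<le> (SUP R. h D * indicator (level R) D)"
      by (intro SUP_upper2[of "Suc (cluster_count D)"]) auto
    moreover have "(SUP R. h D * indicator (level R) D) \<le> h D"
      by (intro SUP_least) (auto split: split_indicator)
    ultimately show "h D = (SUP R. h D * indicator (level R) D)" by (rule order.antisym)
  qed
  also have "\<dots> = (SUP R. \<integral>\<^sup>+D. h D * indicator (level R) D \<partial>count_space A)"
    by (rule nn_integral_monotone_convergence_SUP)
      (use level_mono in \<open>auto simp: incseq_def le_fun_def split: split_indicator\<close>)
  also have "(\<lambda>R. \<integral>\<^sup>+D. h D * indicator (level R) D \<partial>count_space A) = (\<lambda>R. ennreal (B R))"
  proof
    fix R
    have "(\<integral>\<^sup>+D. h D * indicator (level R) D \<partial>count_space A) = (\<Sum>D\<in>level R. h D * indicator (level R) D)"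
      by (rule nn_integral_count_space') (auto simp: finite_level levelA)
    then show "(\<integral>\<^sup>+D. h D * indicator (level R) D \<partial>count_space A) = ennreal (B R)"
      by (simp add: hB)
  qed
  also have "(SUP R. ennreal (B R)) = 1"
  proof (rule LIMSEQ_unique[OF LIMSEQ_SUP lim])
    show "incseq (\<lambda>R. ennreal (B R))" using B_mono by (auto simp: incseq_def intro!: ennreal_leI)
  qed
  finally show ?thesis by (simp add: h_def)
qed

end

context bd_parameters begin

section \<open>The rates of the Becker--Doering process\<close>

text \<open>
  One cluster of size \<open>i\<close> becomes one of size \<open>j\<close>; for \<open>j = 1\<close> it dissolves.
\<close>

definition move :: "nat \<Rightarrow> nat \<Rightarrow> (nat \<Rightarrow> nat) \<Rightarrow> nat \<Rightarrow> nat" where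
  "move i j D = (let D' = D(i := D i - 1) in if j = 1 then D' else D'(j := D' j + 1))"

definition neighbours :: "nat \<Rightarrow> nat set" where
  "neighbours i = {i - 1, i + 1}"

lemma neighbours: "i \<in> sizes \<Longrightarrow> j \<in> neighbours i \<Longrightarrow> 1 \<le> j \<and> j \<noteq> i \<and> 0 \<le> rate i j"
  using rate_offdiag[of i j] by (auto simp: neighbours_def)

lemma sum_neighbours:
  assumes "i \<in> sizes"
  shows "(\<Sum>j\<in>neighbours i. rate i j * u j) = a i * z * u (i + 1) + b i * u (i - 1)"
  using assms by (auto simp: neighbours_def cluster_rate_def)

lemma bd_rate_eq:
  assumes C: "C \<in> A"
  shows "bd_rate a b z C D =
    a 1 * z * z * (of_bool (C(2 := C 2 + 1) = D) - of_bool (C = D)) +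
    (\<Sum>i\<in>sizes. \<Sum>j\<in>neighbours i. rate i j * (real (C i) * (of_bool (move i j C = D) - of_bool (C = D))))"
proof -
  let ?\<psi> = "indicator {D} :: _ \<Rightarrow> real"
  let ?up = "\<lambda>i. a i * z * bd_conc z C i * (?\<psi> (bd_add C (bd_Delta i)) - ?\<psi> C)"
  let ?dn = "\<lambda>i. b i * bd_conc z C i * (?\<psi> (bd_sub C (bd_Delta (i - 1))) - ?\<psi> C)"
  have C0: "C k = 0" if "k \<notin> sizes" for k using C that by (simp add: bd_trunc_iff)
  have "bd_rate a b z C D = (\<Sum>\<^sub>\<infinity>i\<in>{1..}. ?up i + ?dn (i + 1))"
    unfolding bd_rate_def bd_gen_def by simp
  also have "\<dots> = (\<Sum>\<^sub>\<infinity>i\<in>{1..n}. ?up i + ?dn (i + 1))"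
    by (rule infsum_cong_neutral) (use n_ge in \<open>auto simp: bd_conc_def C0\<close>)
  also have "\<dots> = (\<Sum>i\<in>{1..n}. ?up i) + (\<Sum>i\<in>{1..n}. ?dn (i + 1))"
    by (simp add: sum.distrib)
  also have "(\<Sum>i\<in>{1..n}. ?up i) = ?up 1 + (\<Sum>i\<in>sizes. ?up i)"
  proof -
    have "{1..n} = insert 1 sizes" using n_ge by auto
    then show ?thesis by simp
  qed
  also have "(\<Sum>i\<in>{1..n}. ?dn (i + 1)) = (\<Sum>i\<in>{2..n+1}. ?dn i)"
    by (rule sum.reindex_bij_witness[of _ "\<lambda>i. i - 1" "\<lambda>i. i + 1"]) auto
  also have "\<dots> = (\<Sum>i\<in>sizes. ?dn i)"
    by (rule sum.mono_neutral_right) (auto simp: bd_conc_def C0)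
  also have "?up 1 = a 1 * z * z * (of_bool (C(2 := C 2 + 1) = D) - of_bool (C = D))"
  proof -
    have "bd_add C (bd_Delta 1) = C(2 := C 2 + 1)"
      by (auto simp: bd_add_def bd_Delta_def bd_unit_def fun_eq_iff)
    then show ?thesis by (simp add: bd_conc_def indicator_def)
  qed
  also have "(\<Sum>i\<in>sizes. ?up i) = (\<Sum>i\<in>sizes. a i * z * real (C i) * (of_bool (move i (i + 1) C = D) - of_bool (C = D)))"
  proof (intro sum.cong refl)
    fix i assume i: "i \<in> sizes"
    show "?up i = a i * z * real (C i) * (of_bool (move i (i + 1) C = D) - of_bool (C = D))"
    proof (cases "C i = 0")
      case False
      then have "bd_add C (bd_Delta i) = move i (i + 1) C"
        using i by (auto simp: bd_add_def bd_Delta_def bd_unit_def move_def fun_eq_iff nat_diff_distrib nat_add_distrib)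
      then show ?thesis using i by (simp add: bd_conc_def indicator_def)
    qed (use i in \<open>simp add: bd_conc_def\<close>)
  qed
  also have "(\<Sum>i\<in>sizes. ?dn i) = (\<Sum>i\<in>sizes. b i * real (C i) * (of_bool (move i (i - 1) C = D) - of_bool (C = D)))"
  proof (intro sum.cong refl)
    fix i assume i: "i \<in> sizes"
    show "?dn i = b i * real (C i) * (of_bool (move i (i - 1) C = D) - of_bool (C = D))"
    proof (cases "C i = 0")
      case False
      then have "bd_sub C (bd_Delta (i - 1)) = move i (i - 1) C"
        using i by (cases "i = 2")
          (auto simp: bd_sub_def bd_Delta_def bd_unit_def move_def fun_eq_iff nat_diff_distrib nat_add_distrib)
      then show ?thesis using i by (simp add: bd_conc_def indicator_def)
    qed (use i in \<open>simp add: bd_conc_def\<close>)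
  qed
  finally show ?thesis
    by (simp add: sum_neighbours sum.distrib mult.assoc add.assoc del: fun_upd_apply)
qed

definition leave :: "(nat \<Rightarrow> nat) \<Rightarrow> real" where
  "leave D = a 1 * z * z + (\<Sum>i\<in>sizes. (a i * z + b i) * real (D i))"

lemma move_neq: "i \<in> sizes \<Longrightarrow> 0 < C i \<Longrightarrow> j \<noteq> i \<Longrightarrow> move i j C \<noteq> C"
  by (auto simp: move_def Let_def dest!: fun_cong[of _ _ i])

lemma move_eq_self: "i \<in> sizes \<Longrightarrow> j \<in> neighbours i \<Longrightarrow> real (C i) * of_bool (move i j C = C) = 0"
  using move_neq[of i C j] neighbours[of i j] by (cases "C i = 0") auto

lemma bd_rate_diag:
  assumes C: "C \<in> A"
  shows "bd_rate a b z C C = - leave C"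
proof -
  have "C(2 := C 2 + 1) \<noteq> C" by (auto dest!: fun_cong[of _ _ 2])
  moreover have "(\<Sum>i\<in>sizes. \<Sum>j\<in>neighbours i. rate i j * (real (C i) * (of_bool (move i j C = C) - 1))) =
    (\<Sum>i\<in>sizes. - ((a i * z + b i) * real (C i)))"
  proof (rule sum.cong[OF refl])
    fix i assume i: "i \<in> sizes"
    have "(\<Sum>j\<in>neighbours i. rate i j * (real (C i) * (of_bool (move i j C = C) - 1))) = (\<Sum>j\<in>neighbours i. rate i j * - real (C i))"
      using move_eq_self[OF i] by (intro sum.cong refl) (simp add: right_diff_distrib)
    then show "(\<Sum>j\<in>neighbours i. rate i j * (real (C i) * (of_bool (move i j C = C) - 1))) = - ((a i * z + b i) * real (C i))"
      unfolding sum_neighbours[OF i] by (simp add: algebra_simps)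
  qed
  ultimately show ?thesis
    by (simp add: bd_rate_eq[OF C] leave_def sum_negf)
qed

lemma leave_pos: "0 < leave D"
  unfolding leave_def using a_pos b_pos z_pos
  by (intro add_pos_nonneg sum_nonneg) (auto simp: less_imp_le add_nonneg_nonneg)

lemma bd_rate_offdiag:
  assumes C: "C \<in> A" and D: "C \<noteq> D"
  shows "bd_rate a b z C D = a 1 * z * z * of_bool (C(2 := C 2 + 1) = D) +
    (\<Sum>i\<in>sizes. \<Sum>j\<in>neighbours i. rate i j * (real (C i) * of_bool (move i j C = D)))"
  using D by (simp add: bd_rate_eq[OF C])

lemma immigration_nonneg: "0 \<le> a 1 * z * z"
  using a_pos[of 1] z_pos by simp

lemma bd_rate_nonneg: "C \<in> A \<Longrightarrow> C \<noteq> D \<Longrightarrow> 0 \<le> bd_rate a b z C D"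
  unfolding bd_rate_offdiag
  by (intro add_nonneg_nonneg mult_nonneg_nonneg[OF immigration_nonneg] sum_nonneg mult_nonneg_nonneg)
    (auto simp: neighbours)

lemma create_ennreal_immigration:
  assumes D: "D \<in> A" and v: "\<And>C. 0 \<le> v C"
  shows "(\<integral>\<^sup>+C. ennreal (v C * of_bool (C(2 := C 2 + 1) = D)) \<partial>count_space A) = ennreal (create 2 v D)"
proof -
  have two: "2 \<in> sizes" using n_ge by simp
  let ?C = "D(2 := D 2 - 1)"
  have eq: "C(2 := C 2 + 1) = D \<longleftrightarrow> 0 < D 2 \<and> C = ?C" for C
    by (auto simp: fun_eq_iff)
  have "(\<integral>\<^sup>+C. ennreal (v C * of_bool (C(2 := C 2 + 1) = D)) \<partial>count_space A) =
    (\<Sum>C\<in>{?C}. ennreal (v C * of_bool (0 < D 2 \<and> C = ?C)))"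
    unfolding eq using D two
    by (intro nn_integral_count_space') (auto intro: upd_in_A)
  also have "\<dots> = ennreal (create 2 v D)" using two by (simp add: create_def)
  finally show ?thesis .
qed

text \<open>
  A configuration has exactly one predecessor under a given change of size, unless it contains no
  cluster of the new size.
\<close>

lemma create_ennreal_move:
  assumes D: "D \<in> A" and v: "\<And>C. 0 \<le> v C" and i: "i \<in> sizes" and j: "1 \<le> j" "j \<noteq> i"
  shows "(\<integral>\<^sup>+C. ennreal (v C * (real (C i) * of_bool (move i j C = D))) \<partial>count_space A) =
    ennreal (create j (annihilate i v) D)"
proof -
  let ?D' = "if j = 1 then D else D(j := D j - 1)"
  let ?C = "?D'(i := D i + 1)"
  have i1: "i \<noteq> 1" using i by auto
  have eq: "0 < C i \<and> move i j C = D \<longleftrightarrow> (j = 1 \<or> 0 < D j) \<and> C = ?C" for C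
  proof -
    have mv: "move i j C = (if j = 1 then C(i := C i - 1) else C(i := C i - 1, j := C j + 1))"
      using j by (simp add: move_def Let_def)
    show ?thesis
    proof (cases "j = 1")
      case True
      have "0 < C i \<and> C(i := C i - 1) = D \<longleftrightarrow> C = D(i := D i + 1)" (is "?l \<longleftrightarrow> ?r")
      proof
        assume l: ?l
        then have D: "D = C(i := C i - 1)" by simp
        show ?r using l by (simp add: D)
      next
        assume C: ?r
        show ?l by (simp add: C)
      qed
      moreover have "move i 1 C = C(i := C i - 1)" by (simp add: move_def)
      ultimately show ?thesis by (simp only: True simp_thms if_True)
    next
      case False
      have "0 < C i \<and> C(i := C i - 1, j := C j + 1) = D \<longleftrightarrow> 0 < D j \<and> C = D(j := D j - 1, i := D i + 1)" (is "?l \<longleftrightarrow> ?r")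
      proof
        assume l: ?l
        then have D: "D = C(i := C i - 1, j := C j + 1)" by simp
        show ?r using l j by (simp add: D fun_upd_twist)
      next
        assume r: ?r
        then have C: "C = D(j := D j - 1, i := D i + 1)" by simp
        show ?l using r j by (simp add: C fun_upd_twist)
      qed
      with False show ?thesis by (simp add: mv)
    qed
  qed
  have val: "v C * (real (C i) * of_bool (move i j C = D)) =
    (if (j = 1 \<or> 0 < D j) \<and> C = ?C then v ?C * real (D i + 1) else 0)" for C
  proof (cases "0 < C i \<and> move i j C = D")
    case True
    then have C: "(j = 1 \<or> 0 < D j) \<and> C = ?C" by (rule eq[THEN iffD1])
    have m: "move i j C = D" using True by (rule conjunct2)
    have c: "C = ?C" using C by (rule conjunct2)
    have vC: "v C = v ?C" by (rule arg_cong[OF c])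
    have rC: "real (C i) = real (D i + 1)" by (subst c) simp
    show ?thesis unfolding eqTrueI[OF C] eqTrueI[OF m] if_True of_bool_eq mult_1_right by (rule arg_cong2[where f = "(*)", OF vC rC])
  next
    case False
    then have n: "((j = 1 \<or> 0 < D j) \<and> C = ?C) = False" unfolding eq by (rule eq_False[THEN iffD2])
    have "real (C i) * of_bool (move i j C = D) = 0" using False by auto
    then show ?thesis unfolding n by simp
  qed
  show ?thesis
  proof (cases "j = 1 \<or> j \<in> sizes")
    case True
    then have CA: "?C \<in> A" using D i by (auto intro!: upd_in_A)
    have "(\<integral>\<^sup>+C. ennreal (v C * (real (C i) * of_bool (move i j C = D))) \<partial>count_space A) =
      (\<Sum>C\<in>{?C}. ennreal (if (j = 1 \<or> 0 < D j) \<and> C = ?C then v ?C * real (D i + 1) else 0))"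
      unfolding val using CA by (intro nn_integral_count_space') auto
    also have "\<dots> = ennreal (create j (annihilate i v) D)"
      using True j by (auto simp: create_def annihilate_def mult.commute)
    finally show ?thesis .
  next
    case False
    then have "D j = 0" using D by (auto simp: bd_trunc_iff)
    then have "(\<integral>\<^sup>+C. ennreal (v C * (real (C i) * of_bool (move i j C = D))) \<partial>count_space A) = 0"
      unfolding val using False by simp
    then show ?thesis using False by (auto simp: create_def)
  qed
qed

definition gain :: "((nat \<Rightarrow> nat) \<Rightarrow> real) \<Rightarrow> (nat \<Rightarrow> nat) \<Rightarrow> real" where
  "gain v D = a 1 * z * z * create 2 v D +
     (\<Sum>i\<in>sizes. \<Sum>j\<in>neighbours i. rate i j * create j (annihilate i v) D)"

lemma forward_gain_leave: "forward v D = gain v D - leave D * v D"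
proof -
  have "(\<Sum>i\<in>sizes. \<Sum>j=1..n. rate i j * create j (annihilate i v) D) =
    (\<Sum>i\<in>sizes. (\<Sum>j\<in>neighbours i. rate i j * create j (annihilate i v) D) - (a i * z + b i) * (real (D i) * v D))"
  proof (intro sum.cong refl)
    fix i assume i: "i \<in> sizes"
    have "create (i + 1) (annihilate i v) D = 0" if "\<not> i < n" using i that by (auto simp: create_def)
    then show "(\<Sum>j=1..n. rate i j * create j (annihilate i v) D) =
      (\<Sum>j\<in>neighbours i. rate i j * create j (annihilate i v) D) - (a i * z + b i) * (real (D i) * v D)"
      unfolding sum_rate_row[OF i] create_annihilate[OF i] sum_neighbours[OF i] by auto
  qed
  then show ?thesis
    unfolding forward_def gain_def leave_def
    by (simp add: sum_subtractf sum_distrib_left sum_distrib_right algebra_simps)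
qed

lemma annihilate_nonneg: "(\<And>C. 0 \<le> v C) \<Longrightarrow> 0 \<le> annihilate i v D"
  by (simp add: annihilate_def)

lemma gain_nonneg:
  assumes "\<And>C. 0 \<le> v C"
  shows "0 \<le> gain v D"
  unfolding gain_def
  by (intro add_nonneg_nonneg mult_nonneg_nonneg[OF immigration_nonneg] sum_nonneg mult_nonneg_nonneg
      create_nonneg annihilate_nonneg assms) (auto simp: neighbours)

text \<open>
  This identifies the forward equation of the Q-matrix with the operator calculus: moves with
  positive rate never fix a configuration, so the diagonal may be added to the inflow.
\<close>

lemma inflow_bd:
  assumes D: "D \<in> A" and v: "\<And>C. 0 \<le> v C"
  shows "inflow (bd_rate a b z) A (\<lambda>C. ennreal (v C)) D = ennreal (gain v D)"
proof -
  let ?I = "\<lambda>C. v C * of_bool (C(2 := C 2 + 1) = D)"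
    and ?X = "\<lambda>i j C. v C * (real (C i) * of_bool (move i j C = D))"
    and ?Y = "\<lambda>i j. create j (annihilate i v) D"
  have r: "0 \<le> rate i j" if "i \<in> sizes" "j \<in> neighbours i" for i j
    using neighbours[OF that] by simp
  have I: "0 \<le> ?I C" and X: "0 \<le> ?X i j C" and Y: "0 \<le> ?Y i j" and Y2: "0 \<le> create 2 v D" for C i j
    using v by (auto intro!: create_nonneg annihilate_nonneg)
  have linear: "ennreal (a 1 * z * z * x + (\<Sum>i\<in>sizes. \<Sum>j\<in>neighbours i. rate i j * y i j)) =
      ennreal (a 1 * z * z) * ennreal x + (\<Sum>i\<in>sizes. \<Sum>j\<in>neighbours i. ennreal (rate i j) * ennreal (y i j))"
    if "0 \<le> x" "\<And>i j. 0 \<le> y i j" for x :: real and y :: "nat \<Rightarrow> nat \<Rightarrow> real"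
  proof -
    have nn: "0 \<le> rate i j * y i j" if "i \<in> sizes" "j \<in> neighbours i" for i j
      using r[OF that] \<open>\<And>i j. 0 \<le> y i j\<close> by simp
    have "(\<Sum>i\<in>sizes. \<Sum>j\<in>neighbours i. ennreal (rate i j) * ennreal (y i j)) =
      (\<Sum>i\<in>sizes. \<Sum>j\<in>neighbours i. ennreal (rate i j * y i j))"
      by (intro sum.cong refl ennreal_mult'[symmetric] r)
    also have "\<dots> = (\<Sum>i\<in>sizes. ennreal (\<Sum>j\<in>neighbours i. rate i j * y i j))"
      by (intro sum.cong refl sum_ennreal nn)
    also have "\<dots> = ennreal (\<Sum>i\<in>sizes. \<Sum>j\<in>neighbours i. rate i j * y i j)"
      by (intro sum_ennreal sum_nonneg nn)
    finally show ?thesis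
      using mult_nonneg_nonneg[OF immigration_nonneg \<open>0 \<le> x\<close>]
      by (simp only: ennreal_plus sum_nonneg nn ennreal_mult'[OF immigration_nonneg])
  qed
  have "inflow (bd_rate a b z) A (\<lambda>C. ennreal (v C)) D =
    (\<integral>\<^sup>+C. ennreal (a 1 * z * z * ?I C + (\<Sum>i\<in>sizes. \<Sum>j\<in>neighbours i. rate i j * ?X i j C)) \<partial>count_space A)"
    unfolding inflow_def
  proof (intro nn_integral_cong)
    fix C assume "C \<in> space (count_space A)"
    then have C: "C \<in> A" by simp
    show "(if C = D then 0 else ennreal (v C) * ennreal (bd_rate a b z C D)) =
      ennreal (a 1 * z * z * ?I C + (\<Sum>i\<in>sizes. \<Sum>j\<in>neighbours i. rate i j * ?X i j C))"
    proof (cases "C = D")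
      case False
      then have "v C * bd_rate a b z C D = a 1 * z * z * ?I C + (\<Sum>i\<in>sizes. \<Sum>j\<in>neighbours i. rate i j * ?X i j C)"
        unfolding bd_rate_offdiag[OF C False]
        by (simp only: distrib_left sum_distrib_left mult.left_commute[of "v C"])
      then show ?thesis using False by (simp only: if_False ennreal_mult'[symmetric] v)
    next
      case True
      have "?I D = 0" by (auto dest!: fun_cong[of _ _ 2])
      moreover have "?X i j D = 0" if "i \<in> sizes" "j \<in> neighbours i" for i j
        by (simp only: move_eq_self[OF that] mult_zero_right)
      ultimately show ?thesis
        using True by (simp only: if_True simp_thms mult_zero_right sum.neutral_const add_0_right ennreal_0 cong: sum.cong)
    qed
  qed
  also have "\<dots> = (\<integral>\<^sup>+C. (ennreal (a 1 * z * z) * ennreal (?I C) +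
     (\<Sum>i\<in>sizes. \<Sum>j\<in>neighbours i. ennreal (rate i j) * ennreal (?X i j C))) \<partial>count_space A)"
    by (intro nn_integral_cong linear I X)
  also have "\<dots> = ennreal (a 1 * z * z) * (\<integral>\<^sup>+C. ennreal (?I C) \<partial>count_space A) +
    (\<Sum>i\<in>sizes. \<Sum>j\<in>neighbours i. ennreal (rate i j) * (\<integral>\<^sup>+C. ennreal (?X i j C) \<partial>count_space A))"
    by (simp add: nn_integral_add nn_integral_sum nn_integral_cmult del: fun_upd_apply)
  also have "\<dots> = ennreal (a 1 * z * z) * ennreal (create 2 v D) +
    (\<Sum>i\<in>sizes. \<Sum>j\<in>neighbours i. ennreal (rate i j) * ennreal (?Y i j))"
    unfolding create_ennreal_immigration[OF D v] using neighbours
    by (intro arg_cong2[where f = "(+)"] refl sum.cong arg_cong2[where f = "(*)"] create_ennreal_move[OF D v]) auto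
  also have "\<dots> = ennreal (gain v D)"
    unfolding gain_def by (simp only: linear[OF Y2 Y])
  finally show ?thesis .
qed

text \<open>
  The truncated state space is left only by the growth of a cluster of size \<open>n\<close>.
\<close>

abbreviation exit_state :: "(nat \<Rightarrow> nat) \<Rightarrow> nat \<Rightarrow> nat" where
  "exit_state \<equiv> move n (n + 1)"

lemma exit_state:
  assumes D: "D \<in> A" and pos: "0 < D n"
  shows "exit_state D \<in> bd_states - A" and "a n * z * real (D n) \<le> bd_rate a b z D (exit_state D)"
proof -
  have n: "n \<in> sizes" using n_ge by simp
  have e: "exit_state D (n + 1) = 1" using D n_ge by (auto simp: move_def Let_def bd_trunc_iff)
  then show notin: "exit_state D \<in> bd_states - A"
  proof -
    have "exit_state D (n + 1) = 0" if "exit_state D \<in> A" using that unfolding bd_trunc_iff by simp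
    with e have "exit_state D \<notin> A" by auto
    moreover have "summable (\<lambda>i. real (exit_state D i))"
      by (rule summable_finite[of "insert (n + 1) sizes"])
        (use D n_ge in \<open>auto simp: move_def Let_def bd_trunc_iff\<close>)
    moreover have "exit_state D 0 = 0" "exit_state D 1 = 0"
      using D n_ge by (auto simp: move_def Let_def bd_trunc_iff)
    ultimately show ?thesis by (simp add: bd_states_def)
  qed
  then have "D \<noteq> exit_state D" using D by auto
  let ?Z = "\<lambda>i j. rate i j * (real (D i) * of_bool (move i j D = exit_state D))"
  have Z: "0 \<le> ?Z i j" if "i \<in> sizes" "j \<in> neighbours i" for i j
    using neighbours[OF that] by simp
  have "a n * z * real (D n) = ?Z n (n + 1)" using n by (simp add: cluster_rate_def)
  also have "\<dots> \<le> (\<Sum>j\<in>neighbours n. ?Z n j)"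
  proof (rule member_le_sum[where f = "?Z n"])
    show "n + 1 \<in> neighbours n" "finite (neighbours n)" by (simp_all add: neighbours_def)
  qed (use Z[OF n] in blast)
  also have "\<dots> \<le> (\<Sum>i\<in>sizes. \<Sum>j\<in>neighbours i. ?Z i j)"
    using n Z by (intro member_le_sum[where f = "\<lambda>i. \<Sum>j\<in>neighbours i. ?Z i j"] sum_nonneg) auto
  also have "\<dots> \<le> bd_rate a b z D (exit_state D)"
    unfolding bd_rate_offdiag[OF D \<open>D \<noteq> exit_state D\<close>] using immigration_nonneg by simp
  finally show "a n * z * real (D n) \<le> bd_rate a b z D (exit_state D)" .
qed

lemma exit_state_inj: "inj_on exit_state {D \<in> A. 0 < D n}"
proof (rule inj_onI)
  fix x y assume x: "x \<in> {D \<in> A. 0 < D n}" and y: "y \<in> {D \<in> A. 0 < D n}" and e: "exit_state x = exit_state y"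
  show "x = y"
  proof
    fix k show "x k = y k"
      using fun_cong[OF e, of k] x y n_ge
      by (cases "k = n"; cases "k = n + 1") (auto simp: move_def Let_def)
  qed
qed

end

section \<open>The minimal solution is the superposition\<close>

lemma nn_integral_count_space_eqD:
  fixes g h :: "'a \<Rightarrow> ennreal"
  assumes le: "\<And>x. x \<in> X \<Longrightarrow> g x \<le> h x"
    and int: "(\<integral>\<^sup>+x. h x \<partial>count_space X) \<le> (\<integral>\<^sup>+x. g x \<partial>count_space X)" "(\<integral>\<^sup>+x. g x \<partial>count_space X) \<noteq> \<infinity>"
    and x: "x \<in> X"
  shows "g x = h x"
proof -
  have "(\<integral>\<^sup>+x. (h x - g x) \<partial>count_space X) = (\<integral>\<^sup>+x. h x \<partial>count_space X) - (\<integral>\<^sup>+x. g x \<partial>count_space X)"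
    using int(2) le by (intro nn_integral_diff) (auto simp: AE_count_space)
  also have "\<dots> = 0" by (rule diff_eq_0_ennreal[OF le_less_trans[OF int(1)] int(1)]) (use int(2) in \<open>simp add: less_top\<close>)
  finally have "h x - g x = 0"
    using x by (simp add: nn_integral_0_iff_AE AE_count_space)
  moreover have "g x \<noteq> \<infinity>"
  proof
    assume "g x = \<infinity>"
    then have "(\<integral>\<^sup>+x. g x \<partial>count_space X) = \<infinity>"
      using nn_integral_ge_point[OF x, of g] by (simp add: top_unique)
    with int(2) show False by simp
  qed
  ultimately have "h x \<le> g x" by (simp add: diff_eq_0_iff_ennreal less_top[symmetric])
  with le[OF x] show ?thesis by (rule order.antisym)
qed

context bd_parameters begin

definition particles :: "(nat \<Rightarrow> nat) \<Rightarrow> nat list" where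
  "particles C = concat (map (\<lambda>i. replicate (C i) i) [2..<Suc n])"

lemma set_particles: "set (particles C) \<subseteq> sizes"
  by (auto simp: particles_def)

lemma count_particles: "j \<in> sizes \<Longrightarrow> count_list (particles C) j = C j"
proof -
  assume j: "j \<in> sizes"
  have c: "count_list (replicate k i) j = (if i = j then k else 0)" for k i
    by (induction k) auto
  have "count_list (concat (map (\<lambda>i. replicate (C i) i) xs)) j = (\<Sum>i\<leftarrow>xs. if i = j then C i else 0)" for xs
    by (induction xs) (auto simp: c count_list_append)
  then have "count_list (particles C) j = (\<Sum>i\<in>set [2..<Suc n]. if i = j then C i else 0)"
    unfolding particles_def by (simp only: sum_list_distinct_conv_sum_set distinct_upt)
  also have "set [2..<Suc n] = sizes" by auto
  finally show ?thesis using j by (simp add: sum.delta)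
qed

lemma sum_particles: "(\<Sum>i\<leftarrow>particles C. r i) = (\<Sum>i\<in>sizes. real (C i) * r i)"
proof -
  have "(\<Sum>i\<leftarrow>concat (map (\<lambda>i. replicate (C i) i) xs). r i) = (\<Sum>i\<leftarrow>xs. real (C i) * r i)" for xs
    by (induction xs) (auto simp: sum_list_replicate)
  moreover have "set [2..<Suc n] = sizes" by auto
  ultimately show ?thesis unfolding particles_def by (simp only: sum_list_distinct_conv_sum_set distinct_upt)
qed

abbreviation "q \<equiv> bd_rate a b z"

lemma law_0_particles: "C \<in> A \<Longrightarrow> D \<in> A \<Longrightarrow> law (particles C) 0 D = (if D = C then 1 else 0)"
proof -
  assume C: "C \<in> A" and D: "D \<in> A"
  have "(\<forall>j\<in>sizes. D j = count_list (particles C) j) \<longleftrightarrow> D = C"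
  proof
    assume *: "\<forall>j\<in>sizes. D j = count_list (particles C) j"
    show "D = C"
    proof
      fix k show "D k = C k" using * C D by (cases "k \<in> sizes") (auto simp: count_particles bd_trunc_iff)
    qed
  qed (simp add: count_particles)
  then show ?thesis by (simp add: law_0[OF set_particles])
qed

lemma law_le_1:
  assumes L: "set L \<subseteq> sizes" and t: "0 \<le> t" and D: "D \<in> A"
  shows "law L t D \<le> 1"
proof -
  have "(\<Sum>D\<in>{D}. law L t D) \<le> survival t * (\<Prod>i\<leftarrow>L. inside i t)"
    by (rule has_sum_mono_neutral[OF has_sum_finite has_sum_law[OF L t]]) (use law_nonneg[OF L t] D in auto)
  then show ?thesis using law_mass_le_1[OF L t] by simp
qed

lemma sum_law_le_1:
  assumes L: "set L \<subseteq> sizes" and t: "0 \<le> t"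
  shows "(\<Sum>D\<in>level R. law L t D) \<le> 1"
proof -
  have "(\<Sum>D\<in>level R. law L t D) \<le> survival t * (\<Prod>i\<leftarrow>L. inside i t)"
    by (rule has_sum_mono_neutral[OF has_sum_finite[OF finite_level] has_sum_law[OF L t]])
      (use law_nonneg[OF L t] in \<open>auto simp: level_def\<close>)
  then show ?thesis using law_mass_le_1[OF L t] by simp
qed

lemma create_continuous:
  assumes "\<And>D. continuous_on X (\<lambda>s. x s D)"
  shows "continuous_on X (\<lambda>s. create j (x s) D)"
  using assms
  by (cases "j = 1"; cases "j \<in> sizes \<and> 0 < D j")
    (simp_all only: create_def if_True if_False simp_thms continuous_on_const)

lemma annihilate_continuous:
  assumes "\<And>D. continuous_on X (\<lambda>s. x s D)"
  shows "continuous_on X (\<lambda>s. annihilate j (x s) D)"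
  unfolding annihilate_def using assms by (intro continuous_intros)

lemma gain_continuous:
  assumes "\<And>D. continuous_on X (\<lambda>s. x s D)"
  shows "continuous_on X (\<lambda>s. gain (x s) D)"
  unfolding gain_def using assms
  by (intro continuous_intros create_continuous annihilate_continuous)

lemma gain_measurable:
  assumes [measurable]: "\<And>D. (\<lambda>s. x s D) \<in> borel_measurable borel"
  shows "(\<lambda>s. gain (x s) D) \<in> borel_measurable borel"
  unfolding gain_def create_def annihilate_def by measurable

lemma gain_mono:
  assumes "\<And>D. v D \<le> v' D"
  shows "gain v D \<le> gain v' D"
proof -
  have an: "annihilate i v D \<le> annihilate i v' D" for i D
    unfolding annihilate_def using assms by (intro mult_left_mono) auto
  have cr: "create i u D \<le> create i u' D" if "\<And>D. u D \<le> u' D" for i u u' D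
    using that by (simp add: create_def)
  show ?thesis
    unfolding gain_def
    by (intro add_mono sum_mono mult_left_mono[OF _ immigration_nonneg] mult_left_mono cr an assms) (auto simp: neighbours)
qed

text \<open>
  The function \<open>law\<close> is a nonnegative solution of the forward equation with the same initial value.
\<close>

lemma minimal_flow_le_law:
  assumes C: "C \<in> A" and D: "D \<in> A" and t: "0 \<le> t"
  shows "minimal_flow q A (indicator {C}) t D \<le> ennreal (law (particles C) t D)"
proof (rule minimal_flow_le[OF countable_A _ t D, where V = "\<lambda>t D. ennreal (law (particles C) t D)"])
  fix t :: real and D assume t: "0 \<le> t" and D: "D \<in> A"
  let ?L = "particles C"
  note L = set_particles[of C]
  have cont: "continuous_on {0..} (\<lambda>s. law ?L s D)" for D
    by (rule DERIV_continuous_on[OF law_derivative[OF L]]) auto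
  have "ennreal (law ?L t D) = ennreal (law ?L 0 D) * ennreal (exp (- leave D * t)) +
    (\<integral>\<^sup>+s\<in>{0..t}. ennreal (gain (law ?L s) D) * ennreal (exp (- leave D * (t - s))) \<partial>lborel)"
    using law_derivative[OF L] law_nonneg[OF L]
    by (intro derivative_imp_mild gain_continuous cont gain_nonneg t) (auto simp: forward_gain_leave)
  also have "ennreal (law ?L 0 D) = indicator {C} D"
    using C D by (simp add: law_0_particles indicator_def)
  also have "(\<integral>\<^sup>+s\<in>{0..t}. ennreal (gain (law ?L s) D) * ennreal (exp (- leave D * (t - s))) \<partial>lborel) =
    (\<integral>\<^sup>+s\<in>{0..t}. inflow q A (\<lambda>D. ennreal (law ?L s D)) D * ennreal (exp (- leave D * (t - s))) \<partial>lborel)"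
    using inflow_bd[OF D] law_nonneg[OF L] by (intro nn_integral_cong) (auto split: split_indicator)
  finally show "indicator {C} D * ennreal (exp (q D D * t)) +
    (\<integral>\<^sup>+s\<in>{0..t}. inflow q A (\<lambda>D. ennreal (law ?L s D)) D * ennreal (exp (q D D * (t - s))) \<partial>lborel)
    \<le> ennreal (law ?L t D)"
    unfolding bd_rate_diag[OF D] by simp
qed

text \<open>
  The minimal solution started at \<open>C\<close>, extended by zero because \<open>create\<close> and \<open>annihilate\<close> act on
  functions of all configurations.
\<close>

definition flow :: "(nat \<Rightarrow> nat) \<Rightarrow> real \<Rightarrow> (nat \<Rightarrow> nat) \<Rightarrow> real" where
  "flow C t D = (if D \<in> A then enn2real (minimal_flow q A (indicator {C}) t D) else 0)"

lemma flow_nonneg: "0 \<le> flow C t D"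
  by (simp add: flow_def)

lemma flow_eq:
  assumes "C \<in> A" "D \<in> A" "0 \<le> t"
  shows "ennreal (flow C t D) = minimal_flow q A (indicator {C}) t D"
  using minimal_flow_le_law[OF assms] assms(2)
  by (auto simp: flow_def ennreal_enn2real_if top_unique)

lemma flow_le_law:
  assumes "C \<in> A" "D \<in> A" "0 \<le> t"
  shows "flow C t D \<le> law (particles C) t D"
  using minimal_flow_le_law[OF assms] flow_eq[OF assms] law_nonneg[OF set_particles assms(3)]
  by (metis ennreal_le_iff)

lemma flow_le_1: "C \<in> A \<Longrightarrow> 0 \<le> t \<Longrightarrow> flow C t D \<le> 1"
  using flow_le_law[of C D t] law_le_1[OF set_particles, of t D C] by (cases "D \<in> A") (auto simp: flow_def)

lemma flow_derivative:
  assumes C: "C \<in> A" and D: "D \<in> A" and t: "0 \<le> t"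
  shows "((\<lambda>t. flow C t D) has_real_derivative forward (flow C t) D) (at t within {0..})"
proof -
  have meas: "(\<lambda>s. flow C s D) \<in> borel_measurable borel" for D
    unfolding flow_def using borel_measurable_minimal_flow[OF countable_A] by measurable
  have mild: "ennreal (flow C t D) = ennreal ((if D = C then 1 else 0) * exp (- leave D * t)) +
    (\<integral>\<^sup>+s\<in>{0..t}. ennreal (gain (flow C s) D) * ennreal (exp (- leave D * (t - s))) \<partial>lborel)"
    if D: "D \<in> A" and t: "0 \<le> t" for D t
  proof -
    have "ennreal (flow C t D) = indicator {C} D * ennreal (exp (q D D * t)) +
      (\<integral>\<^sup>+s\<in>{0..t}. inflow q A (minimal_flow q A (indicator {C}) s) D * ennreal (exp (q D D * (t - s))) \<partial>lborel)"
      unfolding flow_eq[OF C D t] by (rule minimal_flow_eq[OF countable_A])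
    also have "(\<integral>\<^sup>+s\<in>{0..t}. inflow q A (minimal_flow q A (indicator {C}) s) D * ennreal (exp (q D D * (t - s))) \<partial>lborel) =
      (\<integral>\<^sup>+s\<in>{0..t}. ennreal (gain (flow C s) D) * ennreal (exp (q D D * (t - s))) \<partial>lborel)"
    proof (intro nn_integral_cong)
      fix s
      have "inflow q A (minimal_flow q A (indicator {C}) s) D = ennreal (gain (flow C s) D)" if "0 \<le> s"
      proof -
        have "inflow q A (minimal_flow q A (indicator {C}) s) D = inflow q A (\<lambda>D. ennreal (flow C s D)) D"
          unfolding inflow_def using that C by (intro nn_integral_cong) (auto simp: flow_eq)
        then show ?thesis using inflow_bd[OF D flow_nonneg] by simp
      qed
      then show "inflow q A (minimal_flow q A (indicator {C}) s) D * ennreal (exp (q D D * (t - s))) * indicator {0..t} s =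
        ennreal (gain (flow C s) D) * ennreal (exp (q D D * (t - s))) * indicator {0..t} s"
        by (auto split: split_indicator)
    qed
    also have "indicator {C} D * ennreal (exp (q D D * t)) = ennreal ((if D = C then 1 else 0) * exp (q D D * t))"
      by simp
    finally show ?thesis unfolding bd_rate_diag[OF D] .
  qed
  have gmeas: "(\<lambda>s. gain (flow C s) D) \<in> borel_measurable borel" for D
    by (rule gain_measurable[OF meas])
  have gnn: "0 \<le> gain (flow C s) D" for s D by (rule gain_nonneg[OF flow_nonneg])
  have gle: "gain (flow C s) D \<le> gain (\<lambda>_. 1) D" if "0 \<le> s" for s D
    by (rule gain_mono) (rule flow_le_1[OF C that])
  have cont: "continuous_on {0..} (\<lambda>s. flow C s D)" for D
  proof (cases "D \<in> A")
    case True
    show ?thesis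
      by (rule mild_imp_continuous(2)[OF flow_nonneg _ gmeas gnn gle mild[OF True]]) auto
  qed (simp add: flow_def)
  have "((\<lambda>t. flow C t D) has_real_derivative gain (flow C t) D - leave D * flow C t D) (at t within {0..})"
    by (rule mild_imp_derivative[OF flow_nonneg _ gmeas gnn gle mild[OF D] gain_continuous[OF cont] t]) auto
  then show ?thesis by (simp only: forward_gain_leave)
qed

definition exit_flux :: "(real \<Rightarrow> (nat \<Rightarrow> nat) \<Rightarrow> real) \<Rightarrow> real \<Rightarrow> (nat \<Rightarrow> nat) \<Rightarrow> ennreal" where
  "exit_flux x t D = (\<integral>\<^sup>+s\<in>{0..t}. ennreal (a n * z * real (D n) * x s D) \<partial>lborel)"

lemma flow_conservation:
  assumes C: "C \<in> A" and t: "0 \<le> t"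
  shows "(\<integral>\<^sup>+D. (ennreal (flow C t D) + exit_flux (flow C) t D) \<partial>count_space A) = 1"
  unfolding exit_flux_def
proof (rule conservation[OF C flow_derivative[OF C] flow_nonneg _ _ t])
  show "(\<Sum>D\<in>level R. flow C t D) \<le> 1" if "0 \<le> t" for R t
  proof -
    have "(\<Sum>D\<in>level R. flow C t D) \<le> (\<Sum>D\<in>level R. law (particles C) t D)"
      using flow_le_law[OF C _ that] by (intro sum_mono) (auto simp: level_def)
    also have "\<dots> \<le> 1" by (rule sum_law_le_1[OF set_particles that])
    finally show ?thesis .
  qed
  show "flow C 0 D = (if D = C then 1 else 0)" if D: "D \<in> A" for D
  proof -
    have null: "AE s in lborel. s \<noteq> (0::real)" by (rule AE_lborel_singleton)
    have "(\<integral>\<^sup>+s\<in>{0..0}. inflow q A (minimal_flow q A (indicator {C}) s) D * ennreal (exp (q D D * (0 - s))) \<partial>lborel) =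
      (\<integral>\<^sup>+s. 0 \<partial>(lborel :: real measure))"
      by (rule nn_integral_cong_AE) (use null in eventually_elim, auto)
    then have "minimal_flow q A (indicator {C}) 0 D = indicator {C} D"
      by (subst minimal_flow_eq[OF countable_A]) simp
    then show ?thesis using D by (simp add: flow_def indicator_def)
  qed
qed

lemma law_conservation:
  assumes C: "C \<in> A" and t: "0 \<le> t"
  shows "(\<integral>\<^sup>+D. (ennreal (law (particles C) t D) + exit_flux (law (particles C)) t D) \<partial>count_space A) = 1"
  unfolding exit_flux_def
  by (rule conservation[OF C law_derivative[OF set_particles] law_nonneg[OF set_particles]
        sum_law_le_1[OF set_particles] law_0_particles[OF C] t])

lemma exit_flux_mono:
  assumes "\<And>s. 0 \<le> s \<Longrightarrow> x s D \<le> y s D"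
  shows "exit_flux x t D \<le> exit_flux y t D"
  unfolding exit_flux_def using assms a_pos[of n] z_pos n_ge
  by (intro nn_integral_mono) (auto split: split_indicator intro!: ennreal_leI mult_left_mono)

text \<open>
  The mass of each solution and the mass that it has lost through size \<open>n + 1\<close> add up to \<open>1\<close>.  Both
  quantities are monotone in the solution, so the ordered solutions \<open>flow\<close> and \<open>law\<close> coincide.
\<close>

lemma flow_eq_law:
  assumes C: "C \<in> A" and D: "D \<in> A" and t: "0 \<le> t"
  shows "flow C t D = law (particles C) t D"
proof -
  let ?l = "law (particles C)"
  have le1: "ennreal (flow C t D) \<le> ennreal (?l t D)" if "D \<in> A" for D
    using flow_le_law[OF C that t] by (rule ennreal_leI)
  have le2: "exit_flux (flow C) t D \<le> exit_flux (?l) t D" if "D \<in> A" for D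
    by (rule exit_flux_mono) (rule flow_le_law[OF C that])
  have eq: "ennreal (flow C t D) + exit_flux (flow C) t D = ennreal (?l t D) + exit_flux (?l) t D"
  proof (rule nn_integral_count_space_eqD[where X = A, OF _ _ _ D])
    fix D assume "D \<in> A"
    then show "ennreal (flow C t D) + exit_flux (flow C) t D \<le> ennreal (?l t D) + exit_flux (?l) t D"
      by (intro add_mono le1 le2)
  next
    show "(\<integral>\<^sup>+D. (ennreal (?l t D) + exit_flux (?l) t D) \<partial>count_space A)
      \<le> (\<integral>\<^sup>+D. (ennreal (flow C t D) + exit_flux (flow C) t D) \<partial>count_space A)"
      by (simp only: flow_conservation[OF C t] law_conservation[OF C t] order.refl)
    show "(\<integral>\<^sup>+D. (ennreal (flow C t D) + exit_flux (flow C) t D) \<partial>count_space A) \<noteq> \<infinity>"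
      unfolding flow_conservation[OF C t] by simp
  qed
  have "exit_flux (?l) t D \<le> (\<integral>\<^sup>+D. (ennreal (?l t D) + exit_flux (?l) t D) \<partial>count_space A)"
    using nn_integral_ge_point[OF D, of "\<lambda>D. ennreal (?l t D) + exit_flux (?l) t D"]
    by (rule order.trans[rotated]) simp
  then have "exit_flux (?l) t D < top"
    unfolding law_conservation[OF C t] by (rule le_less_trans) simp
  have "ennreal (?l t D) \<le> ennreal (flow C t D)"
  proof -
    have "exit_flux (?l) t D + ennreal (?l t D) = ennreal (flow C t D) + exit_flux (flow C) t D"
      unfolding eq by (rule add.commute)
    also have "\<dots> \<le> ennreal (flow C t D) + exit_flux (?l) t D"
      by (rule add_left_mono[OF le2[OF D]])
    also have "\<dots> = exit_flux (?l) t D + ennreal (flow C t D)"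
      by (rule add.commute)
    finally have "exit_flux (?l) t D + ennreal (?l t D) \<le> exit_flux (?l) t D + ennreal (flow C t D)" .
    then show ?thesis
      using \<open>_ < top\<close> by (auto simp: ennreal_add_left_cancel_le)
  qed
  with le1[OF D] have "ennreal (flow C t D) = ennreal (?l t D)" by (rule order.antisym)
  then show ?thesis using flow_nonneg law_nonneg[OF set_particles t] by simp
qed

end

section \<open>The law of the process before its exit\<close>

lemma nn_integral_pmf_le_emeasure_Union:
  fixes p :: "'c pmf" and h :: "'c \<Rightarrow> ennreal"
  assumes E: "\<And>c. c \<in> set_pmf p \<Longrightarrow> E c \<in> sets M" "\<And>c. c \<in> set_pmf p \<Longrightarrow> E c \<subseteq> B"
    and disj: "disjoint_family_on E (set_pmf p)" and B: "B \<in> sets M"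
    and le: "\<And>c. c \<in> set_pmf p \<Longrightarrow> ennreal (pmf p c) * h c \<le> emeasure M (E c)"
  shows "(\<integral>\<^sup>+c. h c \<partial>measure_pmf p) \<le> emeasure M B"
proof -
  have "(\<integral>\<^sup>+c. h c \<partial>measure_pmf p) = (\<integral>\<^sup>+c. ennreal (pmf p c) * h c \<partial>count_space UNIV)"
    unfolding measure_pmf_eq_density by (subst nn_integral_density) auto
  also have "\<dots> = (\<integral>\<^sup>+c. ennreal (pmf p c) * h c * indicator (set_pmf p) c \<partial>count_space UNIV)"
    by (intro nn_integral_cong) (auto simp: set_pmf_iff split: split_indicator)
  also have "\<dots> = (\<integral>\<^sup>+c. ennreal (pmf p c) * h c \<partial>count_space (set_pmf p))"
    by (cases "set_pmf p = UNIV") (auto simp: nn_integral_count_space_indicator)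
  also have "\<dots> \<le> (\<integral>\<^sup>+c. emeasure M (E c) \<partial>count_space (set_pmf p))"
    by (intro nn_integral_mono) (auto intro: le)
  also have "\<dots> = emeasure M (\<Union>c\<in>set_pmf p. E c)"
    by (rule emeasure_UN_countable[symmetric]) (auto intro: E disj)
  also have "\<dots> \<le> emeasure M B"
    using E B by (intro emeasure_mono) auto
  finally show ?thesis .
qed

lemma has_sum_imp_nn_integral_count_space:
  fixes g :: "'a \<Rightarrow> real"
  assumes "\<And>x. x \<in> X \<Longrightarrow> 0 \<le> g x" and "(g has_sum S) X"
  shows "(\<integral>\<^sup>+x. ennreal (g x) \<partial>count_space X) = ennreal S"
proof -
  have "(\<lambda>x. norm (g x)) summable_on X"
    using has_sum_imp_summable[OF assms(2)] assms(1) by (simp cong: summable_on_cong)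
  then have "Infinite_Set_Sum.abs_summable_on g X"
    by (simp only: abs_summable_equivalent)
  then show ?thesis
    using assms by (simp add: nn_integral_conv_infsetsum infsetsum_infsum infsumI)
qed

lemma nn_integral_count_space_imp_has_sum:
  fixes g :: "'a \<Rightarrow> real"
  assumes nn: "\<And>x. x \<in> X \<Longrightarrow> 0 \<le> g x" and "0 \<le> S" and int: "(\<integral>\<^sup>+x. ennreal (g x) \<partial>count_space X) = ennreal S"
  shows "(g has_sum S) X"
proof -
  have "integrable (count_space X) g"
    by (rule integrableI_nonneg) (auto simp: AE_count_space nn int)
  then have abs: "Infinite_Set_Sum.abs_summable_on g X"
    by (simp add: Infinite_Set_Sum.abs_summable_on_def)
  then have s: "(\<lambda>x. norm (g x)) summable_on X"
    by (simp only: abs_summable_equivalent)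
  then have "g summable_on X"
    using nn by (simp cong: summable_on_cong)
  moreover have "infsum g X = S"
  proof -
    have "ennreal (infsetsum g X) = ennreal S"
      using nn_integral_conv_infsetsum[OF abs nn] int by simp
    moreover have "0 \<le> infsetsum g X" by (rule infsetsum_nonneg) (rule nn)
    ultimately show ?thesis using \<open>0 \<le> S\<close> infsetsum_infsum[OF abs] by simp
  qed
  ultimately show ?thesis by (auto simp: has_sum_iff)
qed

context bd_parameters begin

text \<open>
  For each state \<open>D\<close> the event on the left has at least the mass on the right, and the event of
  having left \<open>A\<close> has at least the mass lost through size \<open>n + 1\<close>.  By conservation these lower bounds
  have total mass \<open>1\<close>, so none of them can be strict.
\<close>

lemma bd_law:
  fixes M :: "'w measure" and X :: "real \<Rightarrow> 'w \<Rightarrow> nat \<Rightarrow> nat" and \<nu> :: "(nat \<Rightarrow> nat) pmf"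
  assumes BD: "ctmc M X bd_states q \<nu>" and init: "set_pmf \<nu> \<subseteq> A" and t: "0 \<le> t" and D: "D \<in> A"
  shows "emeasure M {\<omega> \<in> space M. X t \<omega> = D \<and> ennreal t < exit_time X A \<omega>} =
    (\<integral>\<^sup>+C. ennreal (law (particles C) t D) \<partial>measure_pmf \<nu>)"
proof -
  interpret prob_space M using BD unfolding ctmc_def by blast
  let ?alive = "{\<omega> \<in> space M. ennreal t < exit_time X A \<omega>}"
  let ?G = "\<lambda>D. {\<omega> \<in> space M. X t \<omega> = D \<and> ennreal t < exit_time X A \<omega>}"
  let ?g = "\<lambda>D. \<integral>\<^sup>+C. ennreal (law (particles C) t D) \<partial>measure_pmf \<nu>"
  let ?x = "\<integral>\<^sup>+C. (\<integral>\<^sup>+D. exit_flux (law (particles C)) t D \<partial>count_space A) \<partial>measure_pmf \<nu>"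
  have AS: "A \<subseteq> bd_states" by (auto simp: bd_trunc_def)
  have neg: "q D D < 0" if "D \<in> A" for D using that leave_pos[of D] by (simp add: bd_rate_diag)
  have off: "0 \<le> q C D" if "C \<in> A" "D \<in> bd_states" "C \<noteq> D" for C D using that bd_rate_nonneg by blast
  have alive: "?alive \<in> sets M" by (rule sets_ctmc_exit_time_gt[OF BD t])
  have state: "{\<omega> \<in> space M. X s \<omega> = D} \<in> sets M" if "0 \<le> s" for s D
    using sets_ctmc_state[OF BD that, of "{D}"] by simp
  have G_sets: "?G D \<in> sets M" for D
    using sets.Int[OF state[OF t, of D] alive] by (simp add: Int_def conj_ac cong: conj_cong)
  have start_G: "{\<omega> \<in> space M. X 0 \<omega> = C \<and> X t \<omega> = D \<and> ennreal t < exit_time X A \<omega>} \<in> sets M" for C D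
  proof -
    have "{\<omega> \<in> space M. X 0 \<omega> = C \<and> X t \<omega> = D \<and> ennreal t < exit_time X A \<omega>} = {\<omega> \<in> space M. X 0 \<omega> = C} \<inter> ?G D" by auto
    then show ?thesis using state[of 0 C] G_sets by auto
  qed
  have start_dead: "{\<omega> \<in> space M. X 0 \<omega> = C \<and> \<not> ennreal t < exit_time X A \<omega>} \<in> sets M" for C
  proof -
    have "{\<omega> \<in> space M. X 0 \<omega> = C \<and> \<not> ennreal t < exit_time X A \<omega>} = {\<omega> \<in> space M. X 0 \<omega> = C} - ?alive" by auto
    then show ?thesis using state[of 0 C] alive by auto
  qed
  \<comment> \<open>Paths that make finitely many jumps until \<open>t\<close> already account for the mass of the minimal solution.\<close>
  have lower_G: "?g D \<le> emeasure M (?G D)" if D: "D \<in> A" for D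
  proof (rule nn_integral_pmf_le_emeasure_Union[OF start_G])
    fix C assume "C \<in> set_pmf \<nu>"
    then have C: "C \<in> A" using init by auto
    show "ennreal (pmf \<nu> C) * ennreal (law (particles C) t D) \<le>
      emeasure M {\<omega> \<in> space M. X 0 \<omega> = C \<and> X t \<omega> = D \<and> ennreal t < exit_time X A \<omega>}"
      using ctmc_minimal_flow_le_prob[OF BD AS countable_A neg off C D t]
      unfolding flow_eq[OF C D t, symmetric] flow_eq_law[OF C D t] .
  qed (auto simp: disjoint_family_on_def G_sets)
  \<comment> \<open>Different \<open>D\<close> have different \<open>exit_state D\<close>, so the losses out of them add up.\<close>
  have lower_x: "?x \<le> emeasure M (space M - ?alive)"
  proof (rule nn_integral_pmf_le_emeasure_Union[OF start_dead])
    fix C assume "C \<in> set_pmf \<nu>"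
    then have C: "C \<in> A" using init by auto
    let ?A' = "{D \<in> A. 0 < D n}"
    let ?B = "exit_state ` ?A'"
    let ?F = "\<lambda>e. \<integral>\<^sup>+s\<in>{0..t}. inflow q A (minimal_flow q A (indicator {C}) s) e \<partial>lborel"
    have "(\<integral>\<^sup>+D. exit_flux (law (particles C)) t D \<partial>count_space A) = (\<integral>\<^sup>+D. exit_flux (law (particles C)) t D \<partial>count_space ?A')"
      by (rule nn_integral_count_space_eq) (auto simp: exit_flux_def)
    also have "\<dots> \<le> (\<integral>\<^sup>+D. ?F (exit_state D) \<partial>count_space ?A')"
      unfolding exit_flux_def
    proof (intro nn_integral_mono)
      fix D s assume "D \<in> space (count_space ?A')"
      then have D: "D \<in> A" "0 < D n" by auto
      have "ennreal (a n * z * real (D n) * law (particles C) s D) \<le>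
        inflow q A (minimal_flow q A (indicator {C}) s) (exit_state D)" if s: "0 \<le> s"
      proof -
        have "ennreal (a n * z * real (D n) * law (particles C) s D) \<le> ennreal (q D (exit_state D) * law (particles C) s D)"
          by (intro ennreal_leI mult_right_mono exit_state(2)[OF D] law_nonneg[OF set_particles s])
        also have "q D (exit_state D) * law (particles C) s D = law (particles C) s D * q D (exit_state D)"
          by (rule mult.commute)
        also have "\<dots> = (if D = exit_state D then 0 else minimal_flow q A (indicator {C}) s D * ennreal (q D (exit_state D)))"
          using exit_state(1)[OF D] D law_nonneg[OF set_particles s, of C D]
          by (auto simp: flow_eq[OF C D(1) s, symmetric] flow_eq_law[OF C D(1) s] ennreal_mult')
        also have "\<dots> \<le> inflow q A (minimal_flow q A (indicator {C}) s) (exit_state D)"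
          unfolding inflow_def by (rule nn_integral_ge_point[OF D(1)])
        finally show ?thesis .
      qed
      then show "ennreal (a n * z * real (D n) * law (particles C) s D) * indicator {0..t} s \<le>
        inflow q A (minimal_flow q A (indicator {C}) s) (exit_state D) * indicator {0..t} s"
        by (auto split: split_indicator)
    qed
    also have "\<dots> = (\<integral>\<^sup>+e. ?F e \<partial>count_space ?B)"
      by (rule nn_integral_bij_count_space) (rule inj_on_imp_bij_betw[OF exit_state_inj])
    finally have "ennreal (pmf \<nu> C) * (\<integral>\<^sup>+D. exit_flux (law (particles C)) t D \<partial>count_space A) \<le>
      ennreal (pmf \<nu> C) * (\<integral>\<^sup>+e. ?F e \<partial>count_space ?B)"
      by (rule mult_left_mono) simp
    also have "\<dots> \<le> emeasure M {\<omega> \<in> space M. X 0 \<omega> = C \<and> \<not> ennreal t < exit_time X A \<omega>}"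
      using exit_state(1) countable_A
      by (intro ctmc_exit_flow_le_prob[OF BD AS countable_A neg off C _ _ t])
        (auto intro!: countable_image intro: countable_subset[of _ A])
    finally show "ennreal (pmf \<nu> C) * (\<integral>\<^sup>+D. exit_flux (law (particles C)) t D \<partial>count_space A) \<le>
      emeasure M {\<omega> \<in> space M. X 0 \<omega> = C \<and> \<not> ennreal t < exit_time X A \<omega>}" .
  qed (use alive in \<open>auto simp: disjoint_family_on_def\<close>)
  interpret cs: sigma_finite_measure "count_space A"
    by (rule sigma_finite_measure_count_space_countable[OF countable_A])
  interpret P: pair_sigma_finite "count_space A" "measure_pmf \<nu>" ..
  have total: "(\<integral>\<^sup>+D. ?g D \<partial>count_space A) + ?x = 1"
  proof -
    have "(\<integral>\<^sup>+D. ?g D \<partial>count_space A) = (\<integral>\<^sup>+C. (\<integral>\<^sup>+D. ennreal (law (particles C) t D) \<partial>count_space A) \<partial>measure_pmf \<nu>)"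
      by (rule P.Fubini'[symmetric]) (rule measurable_pair_measure_countable1[OF countable_A], simp)
    then have "(\<integral>\<^sup>+D. ?g D \<partial>count_space A) + ?x =
      (\<integral>\<^sup>+C. (\<integral>\<^sup>+D. ennreal (law (particles C) t D) \<partial>count_space A) + (\<integral>\<^sup>+D. exit_flux (law (particles C)) t D \<partial>count_space A) \<partial>measure_pmf \<nu>)"
      by (simp add: nn_integral_add)
    also have "\<dots> = (\<integral>\<^sup>+C. 1 \<partial>measure_pmf \<nu>)"
      by (intro nn_integral_cong_AE AE_pmfI)
        (use init law_conservation[OF _ t] in \<open>auto simp: nn_integral_add[symmetric]\<close>)
    finally show ?thesis by simp
  qed
  have upper: "(\<integral>\<^sup>+D. emeasure M (?G D) \<partial>count_space A) + emeasure M (space M - ?alive) \<le> 1"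
  proof -
    have "(\<integral>\<^sup>+D. emeasure M (?G D) \<partial>count_space A) = emeasure M (\<Union>D\<in>A. ?G D)"
      by (rule emeasure_UN_countable[symmetric]) (auto simp: G_sets countable_A disjoint_family_on_def)
    then have "(\<integral>\<^sup>+D. emeasure M (?G D) \<partial>count_space A) + emeasure M (space M - ?alive) =
      emeasure M (\<Union>D\<in>A. ?G D) + emeasure M (space M - ?alive)" by simp
    also have "\<dots> = emeasure M ((\<Union>D\<in>A. ?G D) \<union> (space M - ?alive))"
      by (rule plus_emeasure) (auto intro!: sets.countable_UN' countable_A G_sets simp: alive)
    also have "\<dots> \<le> 1" by (rule emeasure_le_1)
    finally show ?thesis .
  qed
  have fin: "?x \<noteq> \<infinity>" "(\<integral>\<^sup>+D. ?g D \<partial>count_space A) \<noteq> \<infinity>" using total by auto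
  have "(\<integral>\<^sup>+D. emeasure M (?G D) \<partial>count_space A) \<le> (\<integral>\<^sup>+D. ?g D \<partial>count_space A)"
  proof -
    have "?x + (\<integral>\<^sup>+D. emeasure M (?G D) \<partial>count_space A) \<le> (\<integral>\<^sup>+D. emeasure M (?G D) \<partial>count_space A) + emeasure M (space M - ?alive)"
      using lower_x by (simp add: add.commute add_left_mono)
    also note upper
    also have "1 = ?x + (\<integral>\<^sup>+D. ?g D \<partial>count_space A)" using total by (simp add: add.commute)
    finally show ?thesis using fin(1) by (auto simp: ennreal_add_left_cancel_le)
  qed
  from nn_integral_count_space_eqD[OF lower_G this fin(2) D] show ?thesis by simp
qed

end

section \<open>Distance to the quasi-stationary distribution\<close>

text \<open>
  If \<open>\<mu>\<close> and \<open>\<nu>\<close> contain the shares \<open>\<alpha>\<close> and \<open>\<beta>\<close> of \<open>\<pi>\<close>, then each of them differs from \<open>\<pi>\<close> by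
  no more than the missing share.
\<close>

lemma tv_dist_le_common_part:
  assumes \<mu>: "(\<mu> has_sum 1) S" and \<nu>: "(\<nu> has_sum 1) S" and \<pi>: "(\<pi> has_sum 1) S"
    and le: "\<alpha> \<le> 1" "\<beta> \<le> 1" and nonneg: "\<And>x. x \<in> S \<Longrightarrow> 0 \<le> \<pi> x"
    and \<alpha>: "\<And>x. x \<in> S \<Longrightarrow> \<alpha> * \<pi> x \<le> \<mu> x" and \<beta>: "\<And>x. x \<in> S \<Longrightarrow> \<beta> * \<pi> x \<le> \<nu> x"
  shows "tv_dist S \<mu> \<nu> \<le> (1 - \<alpha>) + (1 - \<beta>)"
proof -
  let ?g = "\<lambda>x. (\<mu> x + - (\<alpha> * \<pi> x)) + (\<nu> x + - (\<beta> * \<pi> x)) + \<bar>\<alpha> - \<beta>\<bar> * \<pi> x"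
  have g: "(?g has_sum ((1 + - (\<alpha> * 1)) + (1 + - (\<beta> * 1)) + \<bar>\<alpha> - \<beta>\<bar> * 1)) S"
    by (intro has_sum_add has_sum_uminusI has_sum_cmult_right \<mu> \<nu> \<pi>)
  have bound: "\<bar>\<mu> x - \<nu> x\<bar> \<le> ?g x" if "x \<in> S" for x
  proof -
    have "\<mu> x - \<nu> x = (\<mu> x - \<alpha> * \<pi> x) - (\<nu> x - \<beta> * \<pi> x) + (\<alpha> - \<beta>) * \<pi> x"
      by (simp add: algebra_simps)
    moreover have "\<bar>(\<alpha> - \<beta>) * \<pi> x\<bar> = \<bar>\<alpha> - \<beta>\<bar> * \<pi> x"
      using nonneg[OF that] by (simp add: abs_mult)
    ultimately show ?thesis using \<alpha>[OF that] \<beta>[OF that] by linarith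
  qed
  have "(\<lambda>x. \<bar>\<mu> x - \<nu> x\<bar>) summable_on S"
    by (rule summable_on_comparison_test[OF has_sum_imp_summable[OF g]]) (use bound in auto)
  then have "(\<Sum>\<^sub>\<infinity>x\<in>S. \<bar>\<mu> x - \<nu> x\<bar>) \<le> (1 + - (\<alpha> * 1)) + (1 + - (\<beta> * 1)) + \<bar>\<alpha> - \<beta>\<bar> * 1"
    by (rule has_sum_mono[OF has_sum_infsum g bound])
  also have "\<dots> \<le> 2 * ((1 - \<alpha>) + (1 - \<beta>))" using le by (simp add: abs_if)
  finally show ?thesis by (simp add: tv_dist_def)
qed

lemma prod_list_diff_le:
  fixes x y :: "'a \<Rightarrow> real"
  assumes "\<And>i. i \<in> set L \<Longrightarrow> 0 \<le> x i \<and> x i \<le> y i \<and> y i \<le> 1"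
  shows "(\<Prod>i\<leftarrow>L. y i) - (\<Prod>i\<leftarrow>L. x i) \<le> (\<Sum>i\<leftarrow>L. y i - x i)"
    and "0 \<le> (\<Prod>i\<leftarrow>L. x i)" "(\<Prod>i\<leftarrow>L. x i) \<le> (\<Prod>i\<leftarrow>L. y i)" "(\<Prod>i\<leftarrow>L. y i) \<le> 1"
proof -
  have "(\<Prod>i\<leftarrow>L. y i) - (\<Prod>i\<leftarrow>L. x i) \<le> (\<Sum>i\<leftarrow>L. y i - x i) \<and>
    0 \<le> (\<Prod>i\<leftarrow>L. x i) \<and> (\<Prod>i\<leftarrow>L. x i) \<le> (\<Prod>i\<leftarrow>L. y i) \<and> (\<Prod>i\<leftarrow>L. y i) \<le> 1"
    using assms
  proof (induction L)
    case (Cons i L)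
    let ?X = "\<Prod>i\<leftarrow>L. x i" and ?Y = "\<Prod>i\<leftarrow>L. y i"
    have IH: "?Y - ?X \<le> (\<Sum>i\<leftarrow>L. y i - x i)" "0 \<le> ?X" "?X \<le> ?Y" "?Y \<le> 1"
      using Cons.IH Cons.prems by auto
    have i: "0 \<le> x i" "x i \<le> y i" "y i \<le> 1" using Cons.prems by auto
    have "y i * ?Y - x i * ?X = (y i - x i) * ?Y + x i * (?Y - ?X)" by (simp add: algebra_simps)
    also have "\<dots> \<le> (y i - x i) * 1 + 1 * (?Y - ?X)"
      using i IH by (intro add_mono mult_left_mono mult_right_mono) auto
    finally have "y i * ?Y - x i * ?X \<le> (y i - x i) + (\<Sum>i\<leftarrow>L. y i - x i)" using IH(1) by simp
    then show ?case using i IH by (simp add: mult_mono mult_le_one)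
  qed simp
  then show "(\<Prod>i\<leftarrow>L. y i) - (\<Prod>i\<leftarrow>L. x i) \<le> (\<Sum>i\<leftarrow>L. y i - x i)"
    "0 \<le> (\<Prod>i\<leftarrow>L. x i)" "(\<Prod>i\<leftarrow>L. x i) \<le> (\<Prod>i\<leftarrow>L. y i)" "(\<Prod>i\<leftarrow>L. y i) \<le> 1" by auto
qed

context bd_parameters begin

text \<open>
  The probability that a cluster of initial size \<open>i\<close> has neither dissolved nor reached size \<open>n + 1\<close>.
\<close>

definition surviving :: "nat \<Rightarrow> real \<Rightarrow> real" where
  "surviving i t = (\<Sum>j\<in>sizes. P i j t)"

definition poisson :: "real \<Rightarrow> (nat \<Rightarrow> nat) \<Rightarrow> real" where
  "poisson t D = (\<Prod>j\<in>sizes. m j t ^ D j / fact (D j)) * exp (- (\<Sum>j\<in>sizes. m j t))"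

lemma inside_split: "inside i t = P i 1 t + surviving i t"
proof -
  have "{1..n} = insert 1 sizes" using n_ge by auto
  then show ?thesis by (simp add: inside_def surviving_def)
qed

lemma inside_pos:
  assumes i: "i \<in> sizes" and t: "0 \<le> t"
  shows "0 < inside i t"
proof -
  have "ennreal (exp (rate i i * t)) \<le> ennreal (p i i t)"
    using p_mild[OF i i t] by simp
  then have "0 < p i i t"
    using p_nonneg[of i i t] by (simp add: less_le_trans[OF exp_gt_zero])
  also have "p i i t = P i i t" using i by (simp add: P_sizes)
  also have "P i i t \<le> inside i t"
    unfolding inside_def using i by (intro member_le_sum P_nonneg t) auto
  finally show ?thesis .
qed

lemma law_Nil_poisson: "law [] t D = survival t * poisson t D"
  by (simp add: survival_def poisson_def exp_minus)

text \<open>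
  The contribution of the event that all initial clusters have dissolved.
\<close>

lemma law_ge_Nil:
  assumes "set L \<subseteq> sizes" and t: "0 \<le> t"
  shows "(\<Prod>i\<leftarrow>L. P i 1 t) * law [] t D \<le> law L t D"
  using assms(1)
proof (induction L)
  case (Cons i L)
  then have i: "i \<in> sizes" and L: "set L \<subseteq> sizes" by auto
  have "(\<Prod>i\<leftarrow>i # L. P i 1 t) * law [] t D = P i 1 t * ((\<Prod>i\<leftarrow>L. P i 1 t) * law [] t D)" by simp
  also have "\<dots> \<le> P i 1 t * create 1 (law L t) D"
    using Cons.IH[OF L] P_nonneg[OF i t] by (simp add: mult_left_mono del: law.simps)
  also have "\<dots> \<le> law (i # L) t D"
    unfolding law.simps using n_ge law_nonneg[OF L t] P_nonneg[OF i t]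
    by (intro member_le_sum[where f = "\<lambda>k. P i k t * create k (law L t) D"]) (auto intro!: mult_nonneg_nonneg create_nonneg)
  finally show ?case .
qed simp

lemma poisson_nonneg: "0 \<le> t \<Longrightarrow> 0 \<le> poisson t D"
  unfolding poisson_def by (intro mult_nonneg_nonneg prod_nonneg) (auto intro!: divide_nonneg_nonneg zero_le_power m_nonneg)

lemma has_sum_poisson_m:
  assumes t: "0 \<le> t"
  shows "(poisson t has_sum 1) A"
proof -
  have "((\<lambda>D. (\<Prod>j\<in>sizes. m j t ^ D j / fact (D j)) * exp (- (\<Sum>j\<in>sizes. m j t))) has_sum
    (\<Prod>j\<in>sizes. exp (m j t)) * exp (- (\<Sum>j\<in>sizes. m j t))) A"
    using m_nonneg[OF _ t] by (intro has_sum_cmult_left has_sum_prod_A has_sum_poisson) auto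
  also have "(\<Prod>j\<in>sizes. exp (m j t)) * exp (- (\<Sum>j\<in>sizes. m j t)) = 1"
    by (simp add: exp_sum[symmetric] exp_minus)
  finally show ?thesis unfolding poisson_def .
qed

lemma qsd_eq:
  assumes "D \<in> A"
  shows "bd_qsd a b z n D = (\<Prod>j\<in>sizes. f j ^ D j / fact (D j)) * exp (- (\<Sum>j\<in>sizes. f j))"
  using assms unfolding bd_qsd_def sum_negf[symmetric] exp_sum[OF finite_atLeastAtMost] prod.distrib by simp

lemma has_sum_qsd: "(bd_qsd a b z n has_sum 1) A"
proof -
  have "((\<lambda>D. (\<Prod>j\<in>sizes. f j ^ D j / fact (D j)) * exp (- (\<Sum>j\<in>sizes. f j))) has_sum
    (\<Prod>j\<in>sizes. exp (f j)) * exp (- (\<Sum>j\<in>sizes. f j))) A"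
    using f_pos by (intro has_sum_cmult_left has_sum_prod_A has_sum_poisson) (auto simp: less_imp_le)
  also have "(\<Prod>j\<in>sizes. exp (f j)) * exp (- (\<Sum>j\<in>sizes. f j)) = 1"
    by (simp add: exp_sum[symmetric] exp_minus)
  finally show ?thesis
    by (rule has_sum_cong[THEN iffD1, rotated]) (simp only: qsd_eq)
qed

lemma m_le_f: "j \<in> sizes \<Longrightarrow> 0 \<le> t \<Longrightarrow> m j t \<le> f j"
  unfolding m_def using f_pos P_nonneg by (auto intro!: sum_nonneg mult_nonneg_nonneg simp: less_imp_le)

text \<open>
  A Poisson field with larger intensities contains the one with smaller intensities, up to the
  probability that the difference of the two fields is empty.
\<close>

lemma qsd_ge_poisson:
  assumes D: "D \<in> A" and t: "0 \<le> t"
  shows "exp (- (\<Sum>j\<in>sizes. f j - m j t)) * poisson t D \<le> bd_qsd a b z n D"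
proof -
  have "exp (- (\<Sum>j\<in>sizes. f j - m j t)) * poisson t D =
    (\<Prod>j\<in>sizes. m j t ^ D j / fact (D j)) * (exp (- (\<Sum>j\<in>sizes. f j - m j t)) * exp (- (\<Sum>j\<in>sizes. m j t)))"
    by (simp add: poisson_def)
  also have "exp (- (\<Sum>j\<in>sizes. f j - m j t)) * exp (- (\<Sum>j\<in>sizes. m j t)) = exp (- (\<Sum>j\<in>sizes. f j))"
    by (simp add: exp_add[symmetric] sum_subtractf)
  also have "(\<Prod>j\<in>sizes. m j t ^ D j / fact (D j)) * exp (- (\<Sum>j\<in>sizes. f j)) \<le>
    (\<Prod>j\<in>sizes. f j ^ D j / fact (D j)) * exp (- (\<Sum>j\<in>sizes. f j))"
    using m_nonneg[OF _ t] m_le_f[OF _ t]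
    by (intro mult_right_mono prod_mono) (auto intro!: divide_right_mono power_mono)
  also have "\<dots> = bd_qsd a b z n D"
    using D by (simp only: qsd_eq)
  finally show ?thesis .
qed

lemma sum_f_minus_m: "(\<Sum>j\<in>sizes. f j - m j t) = (\<Sum>i\<in>sizes. f i * surviving i t)"
  unfolding m_def surviving_def sum_distrib_left by (subst sum.swap) simp

text \<open>
  Conditional law and quasi-stationary distribution are compared with the Poisson field of the
  immigrants.  The share missing in the conditional law is at most the conditional expectation of the
  number of surviving initial clusters; conditioning on the survival of the process costs no more
  than its reciprocal probability.
\<close>

lemma tv_conditional_law:
  fixes M :: "'w measure" and X :: "real \<Rightarrow> 'w \<Rightarrow> nat \<Rightarrow> nat" and \<nu> :: "(nat \<Rightarrow> nat) pmf"
  assumes BD: "ctmc M X bd_states q \<nu>" and init: "set_pmf \<nu> \<subseteq> A" and t: "0 \<le> t"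
    and int: "\<And>i. i \<in> sizes \<Longrightarrow> integrable (measure_pmf \<nu>) (\<lambda>C. real (C i))"
    and \<delta>: "\<And>i. i \<in> sizes \<Longrightarrow> surviving i t \<le> \<delta> i"
  shows "tv_dist bd_states (\<lambda>c. \<P>(\<omega> in M. X t \<omega> = c \<bar> exit_time X A \<omega> > ennreal t)) (bd_qsd a b z n) \<le>
    (\<Sum>i\<in>sizes. measure_pmf.expectation \<nu> (\<lambda>C. real (C i)) * \<delta> i) / \<P>(\<omega> in M. exit_time X A \<omega> > ennreal t)
    + (\<Sum>i\<in>sizes. f i * \<delta> i)"
proof -
  let ?e = "(\<Sum>i\<in>sizes. measure_pmf.expectation \<nu> (\<lambda>C. real (C i)) * \<delta> i)"
  interpret prob_space M using BD unfolding ctmc_def by blast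
  let ?alive = "{\<omega> \<in> space M. ennreal t < exit_time X A \<omega>}"
  let ?G = "\<lambda>D. {\<omega> \<in> space M. X t \<omega> = D \<and> ennreal t < exit_time X A \<omega>}"
  define \<rho> \<kappa> where "\<rho> C = (\<Prod>i\<leftarrow>particles C. inside i t)" and "\<kappa> C = (\<Prod>i\<leftarrow>particles C. P i 1 t)" for C
  have bounds: "0 \<le> P i 1 t \<and> P i 1 t \<le> inside i t \<and> inside i t \<le> 1" if "i \<in> sizes" for i
    using that inside_bounds(2)[OF that t] P_nonneg[OF that t]
    by (auto simp: inside_split surviving_def intro!: sum_nonneg)
  have diff: "\<rho> C - \<kappa> C \<le> (\<Sum>i\<in>sizes. real (C i) * surviving i t)" and \<kappa>: "0 \<le> \<kappa> C" "\<kappa> C \<le> \<rho> C" and \<rho>: "\<rho> C \<le> 1" for C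
    using prod_list_diff_le[of "particles C" "\<lambda>i. P i 1 t" "\<lambda>i. inside i t"] bounds set_particles[of C]
    unfolding \<rho>_def \<kappa>_def sum_particles by (auto simp: inside_split subset_iff)
  have \<rho>_pos: "0 < \<rho> C" for C
  proof -
    have "0 < (\<Prod>i\<leftarrow>L. inside i t)" if "set L \<subseteq> sizes" for L
      using that by (induction L) (auto simp: inside_pos t)
    then show ?thesis using set_particles unfolding \<rho>_def by blast
  qed
  have int_bounded: "integrable (measure_pmf \<nu>) h" if "\<And>C. 0 \<le> h C" "\<And>C. h C \<le> 1" for h :: "_ \<Rightarrow> real"
    by (rule measure_pmf.integrable_const_bound[of _ 1]) (use that in auto)
  have int\<rho>: "integrable (measure_pmf \<nu>) \<rho>" using \<kappa> \<rho> \<rho>_pos by (intro int_bounded) (auto simp: less_imp_le)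
  have int\<kappa>: "integrable (measure_pmf \<nu>) \<kappa>" using \<kappa> \<rho> by (intro int_bounded) (auto intro: order.trans)
  define r k where "r = measure_pmf.expectation \<nu> \<rho>" and "k = measure_pmf.expectation \<nu> \<kappa>"
  have k: "0 \<le> k" "k \<le> r"
    unfolding r_def k_def using \<kappa> int\<rho> int\<kappa> by (auto intro!: Bochner_Integration.integral_nonneg integral_mono)
  have "r \<noteq> 0"
  proof
    assume "r = 0"
    then have "AE C in measure_pmf \<nu>. \<rho> C = 0"
      unfolding r_def using int\<rho> \<rho>_pos by (subst (asm) integral_nonneg_eq_0_iff_AE) (auto simp: less_imp_le)
    then have "\<rho> C = 0" if "C \<in> set_pmf \<nu>" for C using that by (simp add: AE_measure_pmf_iff)
    moreover obtain C where "C \<in> set_pmf \<nu>" using set_pmf_not_empty[of \<nu>] by blast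
    ultimately show False using \<rho>_pos[of C] by simp
  qed
  with k have r: "0 < r" by simp
  let ?E = "survival t"
  have E: "0 < ?E" "?E \<le> 1" using survival_pos survival_le_1[OF t] by auto
  have alive: "?alive \<in> sets M" by (rule sets_ctmc_exit_time_gt[OF BD t])
  have G_sets: "?G D \<in> sets M" for D
  proof -
    have "?G D = {\<omega> \<in> space M. X t \<omega> \<in> {D}} \<inter> ?alive" by auto
    then show ?thesis using sets_ctmc_state[OF BD t, of "{D}"] alive by auto
  qed
  have alive_eq: "?alive = (\<Union>D\<in>A. ?G D)"
  proof -
    have "X t \<omega> \<in> A" if "\<omega> \<in> space M" "ennreal t < exit_time X A \<omega>" for \<omega>
    proof -
      have "\<forall>\<^sub>F s in at_right t. X s \<omega> = X t \<omega>" using BD that t unfolding ctmc_def by blast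
      from exit_time_gt_iff[where X = X and \<omega> = \<omega>, OF this t] that t show ?thesis by auto
    qed
    then show ?thesis by auto
  qed
  interpret cs: sigma_finite_measure "count_space A"
    by (rule sigma_finite_measure_count_space_countable[OF countable_A])
  interpret P: pair_sigma_finite "count_space A" "measure_pmf \<nu>" ..
  have sumG: "(\<integral>\<^sup>+D. emeasure M (?G D) \<partial>count_space A) = emeasure M ?alive"
    unfolding alive_eq
    by (rule emeasure_UN_countable[symmetric]) (auto simp: G_sets countable_A disjoint_family_on_def)
  have "(\<integral>\<^sup>+D. emeasure M (?G D) \<partial>count_space A) =
    (\<integral>\<^sup>+D. (\<integral>\<^sup>+C. ennreal (law (particles C) t D) \<partial>measure_pmf \<nu>) \<partial>count_space A)"
    by (intro nn_integral_cong) (simp add: bd_law[OF BD init t])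
  also have "\<dots> = (\<integral>\<^sup>+C. (\<integral>\<^sup>+D. ennreal (law (particles C) t D) \<partial>count_space A) \<partial>measure_pmf \<nu>)"
    by (rule P.Fubini'[symmetric]) (rule measurable_pair_measure_countable1[OF countable_A], simp)
  also have "\<dots> = (\<integral>\<^sup>+C. ennreal (?E * \<rho> C) \<partial>measure_pmf \<nu>)"
    unfolding \<rho>_def
    by (intro nn_integral_cong has_sum_imp_nn_integral_count_space has_sum_law law_nonneg set_particles t)
  also have "\<dots> = ennreal (?E * r)"
    unfolding r_def using int\<rho> \<rho>_pos E by (subst nn_integral_eq_integral) (auto simp: less_imp_le)
  finally have "emeasure M ?alive = ennreal (?E * r)" by (simp only: sumG)
  then have alive_r: "prob ?alive = ?E * r"
    using E r by (simp add: emeasure_eq_measure)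
  have alive_pos: "0 < prob ?alive" unfolding alive_r using E r by simp
  have probG: "prob (?G D) = measure_pmf.expectation \<nu> (\<lambda>C. law (particles C) t D)" if D: "D \<in> A" for D
  proof -
    have "integrable (measure_pmf \<nu>) (\<lambda>C. law (particles C) t D)"
      by (rule int_bounded) (use law_nonneg[OF set_particles t] law_le_1[OF set_particles t D] in auto)
    then have "emeasure M (?G D) = ennreal (measure_pmf.expectation \<nu> (\<lambda>C. law (particles C) t D))"
      unfolding bd_law[OF BD init t D] by (rule nn_integral_eq_integral) (simp add: law_nonneg[OF set_particles t])
    then show ?thesis
      by (simp add: emeasure_eq_measure law_nonneg[OF set_particles t])
  qed
  let ?\<mu> = "\<lambda>D. prob (?G D) / prob ?alive"
  \<comment> \<open>\<open>?\<alpha>\<close> is the conditional probability that all initial clusters have dissolved, given survival;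
    \<open>?\<beta>\<close> is the probability that a field of intensities \<open>f j - m j t\<close> is empty.\<close>
  let ?\<alpha> = "?E * k / prob ?alive" and ?\<beta> = "exp (- (\<Sum>j\<in>sizes. f j - m j t))"
  have \<mu>_sum: "(?\<mu> has_sum 1) A"
  proof -
    have "((\<lambda>D. prob (?G D)) has_sum prob ?alive) A"
      by (rule nn_integral_count_space_imp_has_sum) (use sumG in \<open>auto simp: emeasure_eq_measure\<close>)
    from has_sum_cmult_left[OF this, of "inverse (prob ?alive)"] show ?thesis
      using alive_pos by (simp add: divide_inverse)
  qed
  have "tv_dist A ?\<mu> (bd_qsd a b z n) \<le> (1 - ?\<alpha>) + (1 - ?\<beta>)"
  proof (rule tv_dist_le_common_part[OF \<mu>_sum has_sum_qsd has_sum_poisson_m[OF t] _ _ poisson_nonneg[OF t]])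
    show "?\<alpha> \<le> 1" using alive_pos E k r unfolding alive_r by simp
    show "?\<beta> \<le> 1" using m_le_f[OF _ t] by (auto intro!: sum_nonneg)
    fix D assume D: "D \<in> A"
    show "?\<beta> * poisson t D \<le> bd_qsd a b z n D" by (rule qsd_ge_poisson[OF D t])
    have "k * law [] t D = measure_pmf.expectation \<nu> (\<lambda>C. \<kappa> C * law [] t D)"
      by (simp add: k_def)
    also have "\<dots> \<le> measure_pmf.expectation \<nu> (\<lambda>C. law (particles C) t D)"
    proof (rule integral_mono)
      show "integrable (measure_pmf \<nu>) (\<lambda>C. \<kappa> C * law [] t D)" using int\<kappa> by simp
      show "integrable (measure_pmf \<nu>) (\<lambda>C. law (particles C) t D)"
        by (rule int_bounded) (use law_nonneg[OF set_particles t] law_le_1[OF set_particles t D] in auto)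
      show "\<kappa> C * law [] t D \<le> law (particles C) t D" for C
        unfolding \<kappa>_def by (rule law_ge_Nil[OF set_particles t])
    qed
    finally have "k * law [] t D \<le> prob (?G D)" unfolding probG[OF D] .
    then show "?\<alpha> * poisson t D \<le> ?\<mu> D"
      unfolding law_Nil_poisson using alive_pos by (simp add: field_simps)
  qed
  also have "1 - ?\<alpha> \<le> ?e / prob ?alive"
  proof -
    have EC: "0 \<le> measure_pmf.expectation \<nu> (\<lambda>C. real (C i))" for i by (rule Bochner_Integration.integral_nonneg) simp
    have "r - k = measure_pmf.expectation \<nu> (\<lambda>C. \<rho> C - \<kappa> C)"
      unfolding r_def k_def using int\<rho> int\<kappa> by simp
    also have "\<dots> \<le> measure_pmf.expectation \<nu> (\<lambda>C. \<Sum>i\<in>sizes. real (C i) * surviving i t)"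
      using int\<rho> int\<kappa> int diff by (intro integral_mono) auto
    also have "\<dots> = (\<Sum>i\<in>sizes. measure_pmf.expectation \<nu> (\<lambda>C. real (C i)) * surviving i t)"
      using int by (subst Bochner_Integration.integral_sum) auto
    also have "\<dots> \<le> ?e"
      by (intro sum_mono mult_left_mono \<delta> EC)
    finally have "r - k \<le> ?e" .
    moreover have "?E * (r - k) \<le> 1 * (r - k)" using E k by (intro mult_right_mono) auto
    ultimately have "?E * r - ?E * k \<le> ?e"
      by (simp add: right_diff_distrib)
    then have "(prob ?alive - ?E * k) / prob ?alive \<le> ?e / prob ?alive"
      using alive_pos alive_r by (intro divide_right_mono) auto
    then show ?thesis using alive_pos by (simp add: diff_divide_distrib)
  qed
  also have "1 - ?\<beta> \<le> (\<Sum>i\<in>sizes. f i * \<delta> i)"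
  proof -
    have "1 - ?\<beta> \<le> (\<Sum>j\<in>sizes. f j - m j t)"
      using exp_ge_add_one_self[of "- (\<Sum>j\<in>sizes. f j - m j t)"] by simp
    also have "\<dots> \<le> (\<Sum>i\<in>sizes. f i * \<delta> i)"
      unfolding sum_f_minus_m using f_pos \<delta> by (intro sum_mono mult_left_mono) (auto simp: less_imp_le)
    finally show ?thesis .
  qed
  finally have main: "tv_dist A ?\<mu> (bd_qsd a b z n) \<le>
    ?e / prob ?alive + (\<Sum>i\<in>sizes. f i * \<delta> i)"
    by simp
  have "tv_dist bd_states ?\<mu> (bd_qsd a b z n) = tv_dist A ?\<mu> (bd_qsd a b z n)"
  proof -
    have "?\<mu> D = 0" if "D \<notin> A" for D
    proof -
      have "?G D = {}" using that alive_eq by auto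
      then show ?thesis by (simp only: measure_empty div_0)
    qed
    then show ?thesis
      unfolding tv_dist_def
      by (intro arg_cong2[where f = "(*)"] refl infsum_cong_neutral) (auto simp: bd_qsd_def bd_trunc_def)
  qed
  with main show ?thesis unfolding cond_prob_def by simp
qed

end

section \<open>Decay of the surviving clusters\<close>

lemma exit_time_attained:
  assumes rc: "\<And>s. 0 \<le> s \<Longrightarrow> \<forall>\<^sub>F r in at_right s. X r \<omega> = X s \<omega>"
    and T: "exit_time X A \<omega> = ennreal s" "0 \<le> s"
  shows "X s \<omega> \<notin> A"
proof
  assume Xs: "X s \<omega> \<in> A"
  have "X r \<omega> \<in> A" if r: "r \<in> {0..s}" for r
  proof (rule ccontr)
    assume out: "X r \<omega> \<notin> A"
    then have "exit_time X A \<omega> \<le> ennreal r"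
      unfolding exit_time_def using r by (intro Inf_lower) auto
    then have "s \<le> r" using T r by (simp add: ennreal_le_iff)
    then have "r = s" using r by simp
    then show False using out Xs by simp
  qed
  then have "ennreal s < exit_time X A \<omega>"
    unfolding exit_time_gt_iff[where X = X and \<omega> = \<omega>, OF rc[OF T(2)] T(2)] by blast
  then show False using T by simp
qed

text \<open>
  A right-continuous path is outside \<open>A\<close> at its exit time, so a stopped path is in \<open>A\<close> only as long
  as the exit has not happened.
\<close>

lemma stopped_eq_iff:
  assumes rc: "\<And>s. 0 \<le> s \<Longrightarrow> \<forall>\<^sub>F r in at_right s. X r \<omega> = X s \<omega>"
    and t: "0 \<le> t" and y: "y \<in> A"
  shows "stopped X (exit_time X A) t \<omega> = y \<longleftrightarrow> X t \<omega> = y \<and> ennreal t < exit_time X A \<omega>"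
proof (cases "ennreal t < exit_time X A \<omega>")
  case True
  then show ?thesis using t by (simp add: stopped_def min_absorb1[OF less_imp_le])
next
  case False
  then have le: "exit_time X A \<omega> \<le> ennreal t" by simp
  then obtain s where s: "exit_time X A \<omega> = ennreal s" "0 \<le> s"
    by (cases "exit_time X A \<omega>") (auto simp: top_unique)
  have "stopped X (exit_time X A) t \<omega> = X s \<omega>"
    using le s by (simp add: stopped_def min_absorb2)
  then show ?thesis
    using exit_time_attained[OF rc s] y False by auto
qed

context bd_parameters begin

lemma p_le_stopped_prob:
  fixes N :: "'v measure" and X :: "real \<Rightarrow> 'v \<Rightarrow> nat" and \<mu> :: "nat pmf"
  assumes cluster: "ctmc N X {1..} rate \<mu>" and \<mu>: "sizes \<subseteq> set_pmf \<mu>" "set_pmf \<mu> \<subseteq> {1..}"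
    and i: "i \<in> sizes" and j: "j \<in> sizes" and t: "0 \<le> t"
  shows "p i j t \<le> stopped_prob N X n i j t"
proof -
  interpret prob_space N using cluster unfolding ctmc_def by blast
  have rc: "\<forall>\<^sub>F r in at_right s. X r \<omega> = X s \<omega>" if "\<omega> \<in> space N" "0 \<le> s" for \<omega> s
    using cluster that unfolding ctmc_def by blast
  let ?T = "exit_time X {..n}"
  let ?E = "{\<omega> \<in> space N. stopped X ?T t \<omega> = j \<and> stopped X ?T 0 \<omega> = i}"
  have start: "stopped X ?T 0 \<omega> = X 0 \<omega>" for \<omega> by (simp add: stopped_def)
  have E_eq: "?E = {\<omega> \<in> space N. X t \<omega> \<in> {j}} \<inter> {\<omega> \<in> space N. ennreal t < ?T \<omega>} \<inter> {\<omega> \<in> space N. X 0 \<omega> \<in> {i}}"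
    using stopped_eq_iff[where X = X, OF rc t, of _ j "{..n}"] j by (auto simp: start)
  have E_sets: "?E \<in> sets N"
    unfolding E_eq
    by (intro sets.Int sets_ctmc_state[OF cluster] sets_ctmc_exit_time_gt[OF cluster] t order.refl)
  have "ennreal (pmf \<mu> i) * ennreal (p i j t) \<le>
    emeasure N {\<omega> \<in> space N. X 0 \<omega> = i \<and> X t \<omega> = j \<and> ennreal t < exit_time X sizes \<omega>}"
    unfolding p_flow(1)[OF i j t]
    by (rule ctmc_minimal_flow_le_prob[OF cluster]) (use i j t rate_diag_neg rate_offdiag in auto)
  also have "\<dots> \<le> emeasure N ?E"
  proof (rule emeasure_mono[OF _ E_sets], rule subsetI)
    fix \<omega> assume w: "\<omega> \<in> {\<omega> \<in> space N. X 0 \<omega> = i \<and> X t \<omega> = j \<and> ennreal t < exit_time X sizes \<omega>}"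
    then have "ennreal t < ?T \<omega>"
      using exit_time_gt_iff[where X = X and \<omega> = \<omega> and A = sizes, OF rc t]
        exit_time_gt_iff[where X = X and \<omega> = \<omega> and A = "{..n}", OF rc t] t by auto
    with w show "\<omega> \<in> ?E" unfolding E_eq by auto
  qed
  finally have num: "pmf \<mu> i * p i j t \<le> prob ?E"
    by (simp add: emeasure_eq_measure ennreal_mult'[symmetric])
  have den: "prob {\<omega> \<in> space N. X 0 \<omega> = i} \<le> pmf \<mu> i"
    using ctmc_initial_le[OF cluster \<mu>(2), of i] by (simp add: emeasure_eq_measure)
  have mu_pos: "0 < pmf \<mu> i" using \<mu>(1) i by (auto simp: set_pmf_iff order.strict_iff_order)
  have "prob ?E \<le> prob {\<omega> \<in> space N. X 0 \<omega> = i}"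
    using sets_ctmc_state[OF cluster, of 0 "{i}"] by (intro finite_measure_mono) (auto simp: start)
  show ?thesis
  proof (cases "prob {\<omega> \<in> space N. X 0 \<omega> = i} = 0")
    case True
    then have "prob ?E = 0"
      using \<open>prob ?E \<le> _\<close> by (intro order.antisym) auto
    then have "p i j t \<le> 0" using num mu_pos by (simp add: mult_le_0_iff)
    also have "0 \<le> stopped_prob N X n i j t" by (simp add: stopped_prob_def cond_prob_def)
    finally show ?thesis .
  next
    case False
    then have pos: "0 < prob {\<omega> \<in> space N. X 0 \<omega> = i}" by (simp add: order.strict_iff_order)
    have "p i j t * prob {\<omega> \<in> space N. X 0 \<omega> = i} \<le> p i j t * pmf \<mu> i"
      by (rule mult_left_mono[OF den p_nonneg])
    also have "\<dots> \<le> prob ?E" using num by (simp add: mult.commute)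
    finally show ?thesis
      using pos by (simp add: stopped_prob_def cond_prob_def start pos_le_divide_eq)
  qed
qed

text \<open>
  The Cauchy--Schwarz inequality with the weights \<open>w j\<close>.
\<close>

lemma surviving_le:
  assumes t: "0 \<le> t" and i: "i \<in> sizes" and s: "\<And>j. j \<in> sizes \<Longrightarrow> p i j t \<le> s j"
    and gamma: "sqrt (\<Sum>j\<in>sizes. (s j)\<^sup>2 / w j) \<le> exp (- \<gamma> * t) / sqrt (w i)"
  shows "surviving i t \<le> bd_K a b z n * exp (- \<gamma> * t) / sqrt (w i)"
proof -
  have "surviving i t \<le> (\<Sum>j\<in>sizes. \<bar>sqrt (w j)\<bar> * \<bar>s j / sqrt (w j)\<bar>)"
    unfolding surviving_def
  proof (rule sum_mono)
    fix j assume j: "j \<in> sizes"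
    have "s j \<le> \<bar>r\<bar> * \<bar>s j / r\<bar>" if "0 < r" for r
      using that by simp
    then have "s j \<le> \<bar>sqrt (w j)\<bar> * \<bar>s j / sqrt (w j)\<bar>" using w_pos[of j] real_sqrt_gt_zero by blast
    then show "P i j t \<le> \<bar>sqrt (w j)\<bar> * \<bar>s j / sqrt (w j)\<bar>"
      using s[OF j] j by (simp only: P_sizes)
  qed
  also have "\<dots> \<le> L2_set (\<lambda>j. sqrt (w j)) sizes * L2_set (\<lambda>j. s j / sqrt (w j)) sizes"
    by (rule L2_set_mult_ineq)
  also have "L2_set (\<lambda>j. sqrt (w j)) sizes = bd_K a b z n"
    using w_pos by (simp add: L2_set_def bd_K_def less_imp_le)
  also have "L2_set (\<lambda>j. s j / sqrt (w j)) sizes = sqrt (\<Sum>j\<in>sizes. (s j)\<^sup>2 / w j)"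
    using w_pos by (simp add: L2_set_def power_divide less_imp_le)
  also have "bd_K a b z n * sqrt (\<Sum>j\<in>sizes. (s j)\<^sup>2 / w j) \<le> bd_K a b z n * (exp (- \<gamma> * t) / sqrt (w i))"
    using sum_nonneg[OF less_imp_le[OF w_pos]] by (intro mult_left_mono[OF gamma]) (simp add: bd_K_def)
  finally show ?thesis by simp
qed

end

theorem theorem5p2:
  fixes a b :: "nat \<Rightarrow> real" and z \<gamma> :: real and n :: nat
    and \<Pi>in :: "(nat \<Rightarrow> nat) pmf"
    and M :: "'w measure" and C :: "real \<Rightarrow> 'w \<Rightarrow> nat \<Rightarrow> nat"
    and N :: "'v measure" and X :: "real \<Rightarrow> 'v \<Rightarrow> nat" and \<mu> :: "nat pmf"
  assumes z: "z > 0"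
    and a: "\<And>i. i \<ge> 1 \<Longrightarrow> a i > 0"
    and b: "\<And>i. i \<ge> 2 \<Longrightarrow> b i > 0"
    and divergence:
      "(\<Sum>\<^sub>\<infinity>m\<in>{2..}. ennreal (bd_Q a b m * z ^ m) *
          (\<Sum>\<^sub>\<infinity>k\<in>{m..}. ennreal (1 / (a k * bd_Q a b k * z ^ (k + 1))))) = \<infinity>"
    and n: "n \<ge> 2"
    and init: "set_pmf \<Pi>in \<subseteq> bd_trunc n"
    and init_mean: "integrable (measure_pmf \<Pi>in) (\<lambda>c. \<Sum>\<^sub>\<infinity>i\<in>{2..}. real (c i))"
    and BD: "ctmc M C bd_states (bd_rate a b z) \<Pi>in"
    and cluster: "ctmc N X {1..} (cluster_rate a b z) \<mu>"
    and cluster_init: "{2..n} \<subseteq> set_pmf \<mu>" "set_pmf \<mu> \<subseteq> {1..}"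
    and gamma_pos: "\<gamma> > 0"
    and gamma: "\<And>i t. i \<in> {2..n} \<Longrightarrow> t \<ge> 0 \<Longrightarrow>
        sqrt (\<Sum>j=2..n. (stopped_prob N X n i j t)\<^sup>2 / (bd_Q a b j * z ^ j))
          \<le> exp (- \<gamma> * t) / sqrt (bd_Q a b i * z ^ i)"
    and t: "t \<ge> 0"
  shows "tv_dist bd_states
           (\<lambda>c. \<P>(\<omega> in M. C t \<omega> = c \<bar> exit_time C (bd_trunc n) \<omega> > ennreal t))
           (bd_qsd a b z n)
         \<le> bd_K a b z n *
            (bd_Hin a b z n \<Pi>in / \<P>(\<omega> in M. exit_time C (bd_trunc n) \<omega> > ennreal t)
              + exp (bd_J a b z n * t) * bd_Hqsd a b z n) * exp (- \<gamma> * t)"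
proof -
  interpret bd_parameters a b z n
    by unfold_locales (use z a b n in auto)
  let ?P = "\<P>(\<omega> in M. exit_time C (bd_trunc n) \<omega> > ennreal t)"
  let ?K = "bd_K a b z n * exp (- \<gamma> * t)"
  let ?e = "\<lambda>i. measure_pmf.expectation \<Pi>in (\<lambda>C. real (C i))"
  have "0 \<le> (\<Sum>i=2..n. w i)" by (intro sum_nonneg less_imp_le w_pos)
  then have K: "0 \<le> ?K" by (simp add: bd_K_def)
  have int: "integrable (measure_pmf \<Pi>in) (\<lambda>c. real (c i))" if i: "i \<in> {2..n}" for i
  proof (rule Bochner_Integration.integrable_bound[OF init_mean])
    show "AE c in measure_pmf \<Pi>in. norm (real (c i)) \<le> norm (\<Sum>\<^sub>\<infinity>i\<in>{2..}. real (c i))"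
    proof (rule AE_pmfI)
      fix c assume "c \<in> set_pmf \<Pi>in"
      then have c: "c \<in> bd_trunc n" using init by auto
      have "(\<Sum>\<^sub>\<infinity>i\<in>{2..}. real (c i)) = (\<Sum>\<^sub>\<infinity>i\<in>{2..n}. real (c i))"
        by (rule infsum_cong_neutral) (use c in \<open>auto simp: bd_trunc_iff\<close>)
      also have "\<dots> = (\<Sum>i=2..n. real (c i))" by simp
      finally have "(\<Sum>\<^sub>\<infinity>i\<in>{2..}. real (c i)) = (\<Sum>i=2..n. real (c i))" .
      moreover have "real (c i) \<le> (\<Sum>i=2..n. real (c i))" using i by (intro member_le_sum) auto
      ultimately show "norm (real (c i)) \<le> norm (\<Sum>\<^sub>\<infinity>i\<in>{2..}. real (c i))" by simp
    qed
  qed simp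
  have surv: "surviving i t \<le> ?K / sqrt (w i)" if i: "i \<in> {2..n}" for i
    by (rule surviving_le[OF t i p_le_stopped_prob[OF cluster cluster_init i _ t] gamma[OF i t]])
  have main: "tv_dist bd_states
      (\<lambda>c. \<P>(\<omega> in M. C t \<omega> = c \<bar> exit_time C (bd_trunc n) \<omega> > ennreal t)) (bd_qsd a b z n) \<le>
    (\<Sum>i=2..n. ?e i * (?K / sqrt (w i))) / ?P + (\<Sum>i=2..n. f i * (?K / sqrt (w i)))"
    by (rule tv_conditional_law[OF BD init t int surv])
  have fw: "f i / sqrt (w i) \<le> sqrt (w i)" "1 / sqrt (w i) \<le> sqrt (w i) / f i" if i: "i \<in> {2..n}" for i
  proof -
    have "sqrt (w i) * sqrt (w i) = w i" "0 < sqrt (w i)" using w_pos[of i] by auto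
    then show "f i / sqrt (w i) \<le> sqrt (w i)" "1 / sqrt (w i) \<le> sqrt (w i) / f i"
      using f_le_w[of i] f_pos[of i] i by (auto simp: divide_le_eq le_divide_eq)
  qed
  have "(\<Sum>i=2..n. ?e i * (?K / sqrt (w i))) \<le> ?K * bd_Hin a b z n \<Pi>in"
    unfolding bd_Hin_def sum_distrib_left
  proof (rule sum_mono)
    fix i assume i: "i \<in> {2..n}"
    have "0 \<le> ?e i" by (rule Bochner_Integration.integral_nonneg) simp
    then have "?K * ?e i * (1 / sqrt (w i)) \<le> ?K * ?e i * (sqrt (w i) / f i)"
      by (intro mult_left_mono fw i mult_nonneg_nonneg[OF K])
    then show "?e i * (?K / sqrt (w i)) \<le> ?K * (sqrt (w i) * (?e i / f i))"
      by (simp add: mult_ac)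
  qed
  then have 1: "(\<Sum>i=2..n. ?e i * (?K / sqrt (w i))) / ?P \<le> ?K * bd_Hin a b z n \<Pi>in / ?P"
    by (intro divide_right_mono) auto
  have 2: "(\<Sum>i=2..n. f i * (?K / sqrt (w i))) \<le> ?K * (exp (bd_J a b z n * t) * bd_Hqsd a b z n)"
  proof -
    have "(\<Sum>i=2..n. f i * (?K / sqrt (w i))) \<le> ?K * bd_Hqsd a b z n"
      unfolding bd_Hqsd_def sum_distrib_left
    proof (rule sum_mono)
      fix i assume i: "i \<in> {2..n}"
      have "?K * (f i / sqrt (w i)) \<le> ?K * sqrt (w i)" using K by (intro mult_left_mono fw i)
      then show "f i * (?K / sqrt (w i)) \<le> ?K * sqrt (w i)" by (simp add: mult_ac)
    qed
    also have "\<dots> \<le> ?K * (exp (bd_J a b z n * t) * bd_Hqsd a b z n)"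
    proof (rule mult_left_mono[OF _ K])
      have "0 \<le> bd_Hqsd a b z n" unfolding bd_Hqsd_def by (intro sum_nonneg real_sqrt_ge_zero less_imp_le w_pos)
      moreover have "1 \<le> exp (bd_J a b z n * t)" using J_pos t by simp
      ultimately show "bd_Hqsd a b z n \<le> exp (bd_J a b z n * t) * bd_Hqsd a b z n"
        using mult_right_mono[of 1 "exp (bd_J a b z n * t)" "bd_Hqsd a b z n"] by simp
    qed
    finally show ?thesis .
  qed
  have "tv_dist bd_states
      (\<lambda>c. \<P>(\<omega> in M. C t \<omega> = c \<bar> exit_time C (bd_trunc n) \<omega> > ennreal t)) (bd_qsd a b z n) \<le>
    ?K * bd_Hin a b z n \<Pi>in / ?P + ?K * (exp (bd_J a b z n * t) * bd_Hqsd a b z n)"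
    using main 1 2 by linarith
  also have "\<dots> = bd_K a b z n * (bd_Hin a b z n \<Pi>in / ?P + exp (bd_J a b z n * t) * bd_Hqsd a b z n) * exp (- \<gamma> * t)"
    by (simp add: algebra_simps)
  finally show ?thesis .
qed

end
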